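(* Let $(A,\alpha)$ be a unital C*-dynamical system of multiplicity $d$ and let $\beta>\log d$. Then there is an affine weak*-homeomorphism $\tau\mapsto\psi_\tau$ from the simplex of the tracial states on $A$ onto the simplex of the $(\sigma,\beta)$-KMS states on $\mathcal{T}(A,\alpha)$ with $$\psi_\tau(V_\mu a V_\nu^* ) = \delta_{\mu,\nu}\cdot(1-e^{-\beta}d)\cdot\sum_{m=0}^\infty e^{-(m+|\mu|)\beta}\sum_{|w|=m}\tau\alpha_{\overline{w}}(a)$$ for all $a\in A$ and $\mu,\nu\in\mathbb{F}_+^d$.
   Context: A unital C*-dynamical system $(A,\alpha)$ of multiplicity $d$ (with $1 \le d < \infty$) consists of a unital C*-algebra $A$ and $d$ unital $*$-endomorphisms $\alpha_1,\dots,\alpha_d$ of $A$. $\mathbb{F}_+^d$ is the free semigroup (monoid) of words on $d$ symbols, with empty word $\emptyset$; $|\mu|$ is the length of $\mu$. For $w=i_m\cdots i_1$ write $\alpha_w=\alpha_{i_m}\circ\cdots\circ\alpha_{i_1}$ (and $\alpha_\emptyset=\mathrm{id}$), and $\overline{w}=i_1\cdots i_m$ for the reversed word. $\mathcal{T}(A,\alpha)$ (the Toeplitz-Pimsner algebra) is the universal C*-algebra generated by $A$ and elements $V_1,\dots,V_d$ such that $[V_1,\dots,V_d]$ is a row isometry ($V_i^*V_j = \delta_{i,j}1$) and $aV_i = V_i\alpha_i(a)$ for all $a\in A$, $i=1,\dots,d$. The algebra $A$ embeds in it isometrically and the unit of $A$ is its unit. For a word $\mu=\mu_n\cdots\mu_1$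 write $V_\mu = V_{\mu_n}\cdots V_{\mu_1}$, with $V_\emptyset = 1$. The elements $V_\mu a V_\nu^*$ span a dense $*$-subalgebra. The gauge action $\{\gamma_z\}_{z\in\mathbb{T}}$ satisfies $\gamma_z(a)=a$, $\gamma_z(V_i)=zV_i$, and $\sigma:\mathbb{R}\to \mathrm{Aut}(\mathcal{T}(A,\alpha))$ is $\sigma_t=\gamma_{e^{it}}$, so $\sigma_t(V_\mu aV_\nu^* )=e^{i(|\mu|-|\nu|)t}V_\mu aV_\nu^*$. For $\beta\in\mathbb{R}$, a state $\psi$ on a C*-algebra $B$ with an action $\sigma$ of $\mathbb{R}$ is a $(\sigma,\beta)$-KMS state if $\psi(xy)=\psi(y\sigma_{i\beta}(x))$ for all $x,y$ in a norm-dense $\sigma$-invariant $*$-subalgebra of the analytic elements of $B$ (elements $x$ for which $t\mapsto\sigma_t(x)$ extends to an entire function $z\mapsto\sigma_z(x)$). *)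

theory Defs
  imports "HOL-Analysis.Analysis" "HOL-Algebra.Ring"
begin

section \<open>C*-algebras\<close>

text \<open>
  The algebras \<open>A\<close> and \<open>T(A,\<alpha>)\<close> of the theorem are types of the following class.  The superclass
  \<open>real_normed_algebra_1\<close> makes the algebra non-zero.
\<close>

class unital_cstar_algebra = real_normed_algebra_1 + banach +
  fixes scaleC :: "complex \<Rightarrow> 'a \<Rightarrow> 'a"  (infixr "*\<^sub>C" 75)
    and star :: "'a \<Rightarrow> 'a"
  assumes scaleC_add_right: "c *\<^sub>C (x + y) = c *\<^sub>C x + c *\<^sub>C y"
    and scaleC_add_left: "(b + c) *\<^sub>C x = b *\<^sub>C x + c *\<^sub>C x"
    and scaleC_scaleC: "b *\<^sub>C c *\<^sub>C x = (b * c) *\<^sub>C x"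
    and scaleC_of_real: "complex_of_real r *\<^sub>C x = r *\<^sub>R x"
    and mult_scaleC_left: "(c *\<^sub>C x) * y = c *\<^sub>C (x * y)"
    and mult_scaleC_right: "x * (c *\<^sub>C y) = c *\<^sub>C (x * y)"
    and norm_scaleC: "norm (c *\<^sub>C x) = cmod c * norm x"
    and star_add: "star (x + y) = star x + star y"
    and star_scaleC: "star (c *\<^sub>C x) = cnj c *\<^sub>C star x"
    and star_mult: "star (x * y) = star y * star x"
    and star_star: "star (star x) = x"
    and cstar_identity: "norm (star x * x) = (norm x)\<^sup>2"

text \<open>
  A universal property quantifies over C*-algebras inside a formula, which a type class does not
  allow.  For this purpose we also need C*-algebras as structures on a carrier set.
\<close>

record 'c cstar = "'c ring" +
  cscale :: "complex \<Rightarrow> 'c \<Rightarrow> 'c"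
  cadj :: "'c \<Rightarrow> 'c"
  cnorm :: "'c \<Rightarrow> real"

locale carrier_cstar_algebra = ring D for D :: "'c cstar" (structure) +
  assumes cscale_closed: "x \<in> carrier D \<Longrightarrow> cscale D c x \<in> carrier D"
    and cscale_add_right: "x \<in> carrier D \<Longrightarrow> y \<in> carrier D \<Longrightarrow>
      cscale D c (x \<oplus> y) = cscale D c x \<oplus> cscale D c y"
    and cscale_add_left: "x \<in> carrier D \<Longrightarrow> cscale D (b + c) x = cscale D b x \<oplus> cscale D c x"
    and cscale_cscale: "x \<in> carrier D \<Longrightarrow> cscale D b (cscale D c x) = cscale D (b * c) x"
    and cscale_one: "x \<in> carrier D \<Longrightarrow> cscale D 1 x = x"
    and mult_cscale_left: "x \<in> carrier D \<Longrightarrow> y \<in> carrier D \<Longrightarrow>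
      cscale D c x \<otimes> y = cscale D c (x \<otimes> y)"
    and mult_cscale_right: "x \<in> carrier D \<Longrightarrow> y \<in> carrier D \<Longrightarrow>
      x \<otimes> cscale D c y = cscale D c (x \<otimes> y)"
    and cadj_closed: "x \<in> carrier D \<Longrightarrow> cadj D x \<in> carrier D"
    and cadj_add: "x \<in> carrier D \<Longrightarrow> y \<in> carrier D \<Longrightarrow> cadj D (x \<oplus> y) = cadj D x \<oplus> cadj D y"
    and cadj_cscale: "x \<in> carrier D \<Longrightarrow> cadj D (cscale D c x) = cscale D (cnj c) (cadj D x)"
    and cadj_mult: "x \<in> carrier D \<Longrightarrow> y \<in> carrier D \<Longrightarrow> cadj D (x \<otimes> y) = cadj D y \<otimes> cadj D x"
    and cadj_cadj: "x \<in> carrier D \<Longrightarrow> cadj D (cadj D x) = x"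
    and cnorm_nonneg: "x \<in> carrier D \<Longrightarrow> 0 \<le> cnorm D x"
    and cnorm_eq_0: "x \<in> carrier D \<Longrightarrow> cnorm D x = 0 \<longleftrightarrow> x = \<zero>"
    and cnorm_triangle: "x \<in> carrier D \<Longrightarrow> y \<in> carrier D \<Longrightarrow>
      cnorm D (x \<oplus> y) \<le> cnorm D x + cnorm D y"
    and cnorm_cscale: "x \<in> carrier D \<Longrightarrow> cnorm D (cscale D c x) = cmod c * cnorm D x"
    and cnorm_mult: "x \<in> carrier D \<Longrightarrow> y \<in> carrier D \<Longrightarrow>
      cnorm D (x \<otimes> y) \<le> cnorm D x * cnorm D y"
    and cnorm_cadj_mult: "x \<in> carrier D \<Longrightarrow> cnorm D (cadj D x \<otimes> x) = (cnorm D x)\<^sup>2"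
    and cnorm_complete: "range s \<subseteq> carrier D \<Longrightarrow>
      (\<And>e. e > 0 \<Longrightarrow> \<exists>N::nat. \<forall>m\<ge>N. \<forall>n\<ge>N. cnorm D (s m \<ominus> s n) < e) \<Longrightarrow>
      \<exists>x\<in>carrier D. (\<lambda>n. cnorm D (s n \<ominus> x)) \<longlonglongrightarrow> 0"

text \<open>The structure on the whole type given by an instance of the type class.\<close>

definition class_cstar :: "'a::unital_cstar_algebra cstar" where
  "class_cstar = \<lparr>carrier = UNIV, mult = (*), one = 1, zero = 0, add = (+),
     cscale = scaleC, cadj = star, cnorm = norm\<rparr>"

lemma class_cstar_simps [simp]:
  "carrier class_cstar = UNIV" "x \<otimes>\<^bsub>class_cstar\<^esub> y = x * y" "\<one>\<^bsub>class_cstar\<^esub> = 1"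
  "\<zero>\<^bsub>class_cstar\<^esub> = 0" "x \<oplus>\<^bsub>class_cstar\<^esub> y = x + y" "cscale class_cstar = scaleC"
  "cadj class_cstar = star" "cnorm class_cstar = norm"
  by (simp_all add: class_cstar_def)

lemma ring_class_cstar: "ring (class_cstar :: 'a::unital_cstar_algebra cstar)"
proof (rule ringI)
  show "abelian_group (class_cstar :: 'a cstar)"
    by (rule abelian_groupI) (auto simp: algebra_simps intro: exI[of _ "- x" for x])
  show "monoid (class_cstar :: 'a cstar)"
    by (rule monoidI) (simp_all add: mult.assoc)
qed (simp_all add: algebra_simps)

lemma class_cstar_minus [simp]: "x \<ominus>\<^bsub>class_cstar\<^esub> y = x - (y :: 'a::unital_cstar_algebra)"
proof -
  interpret ring "class_cstar :: 'a cstar" by (rule ring_class_cstar)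
  have "y + \<ominus>\<^bsub>class_cstar\<^esub> y = 0"
    using r_neg[of y] by simp
  then have "\<ominus>\<^bsub>class_cstar\<^esub> y = - y"
    by (simp add: add_eq_0_iff)
  then show ?thesis by (simp add: a_minus_def)
qed

lemma carrier_cstar_algebra_class_cstar:
  "carrier_cstar_algebra (class_cstar :: 'a::unital_cstar_algebra cstar)"
proof -
  have "\<exists>x. (\<lambda>n. norm (s n - x)) \<longlonglongrightarrow> 0"
    if "\<And>e. e > 0 \<Longrightarrow> \<exists>N::nat. \<forall>m\<ge>N. \<forall>n\<ge>N. norm (s m - s n) < e" for s :: "nat \<Rightarrow> 'a"
  proof -
    have "Cauchy s" by (rule CauchyI) (use that in blast)
    then obtain x where "s \<longlonglongrightarrow> x" using Cauchy_convergent convergentD by blast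
    then have "(\<lambda>n. norm (s n - x)) \<longlonglongrightarrow> 0"
      by (intro tendsto_norm_zero) (simp add: LIM_zero)
    then show ?thesis ..
  qed
  moreover have "1 *\<^sub>C x = x" for x :: 'a
    using scaleC_of_real[of 1 x] by simp
  ultimately show ?thesis
    by (intro carrier_cstar_algebra.intro ring_class_cstar carrier_cstar_algebra_axioms.intro)
       (simp_all add: scaleC_add_right scaleC_add_left scaleC_scaleC mult_scaleC_left
         mult_scaleC_right star_add star_scaleC star_mult star_star norm_triangle_ineq
         norm_scaleC norm_mult_ineq cstar_identity)
qed

text \<open>Unital \<open>*\<close>-homomorphisms from a type of the class to a C*-algebra on a carrier set.\<close>

definition unital_star_hom :: "'c cstar \<Rightarrow> ('a::unital_cstar_algebra \<Rightarrow> 'c) \<Rightarrow> bool" where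
  "unital_star_hom D f \<longleftrightarrow>
     (\<forall>x. f x \<in> carrier D) \<and>
     (\<forall>x y. f (x + y) = f x \<oplus>\<^bsub>D\<^esub> f y) \<and>
     (\<forall>c x. f (c *\<^sub>C x) = cscale D c (f x)) \<and>
     (\<forall>x y. f (x * y) = f x \<otimes>\<^bsub>D\<^esub> f y) \<and>
     (\<forall>x. f (star x) = cadj D (f x)) \<and>
     f 1 = \<one>\<^bsub>D\<^esub>"

definition star_subalgebra :: "'b::unital_cstar_algebra set \<Rightarrow> bool" where
  "star_subalgebra B \<longleftrightarrow>
     0 \<in> B \<and> (\<forall>x\<in>B. \<forall>y\<in>B. x + y \<in> B) \<and> (\<forall>c. \<forall>x\<in>B. c *\<^sub>C x \<in> B) \<and>
     (\<forall>x\<in>B. \<forall>y\<in>B. x * y \<in> B) \<and> (\<forall>x\<in>B. star x \<in> B)"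


section \<open>The dynamical system and its Toeplitz-Pimsner algebra\<close>

text \<open>The \<open>d\<close> symbols are \<open>0, \<dots>, d - 1\<close>; the values of \<open>\<alpha>\<close> and \<open>V\<close> at other indices play no role.\<close>

definition cstar_dynamical_system :: "nat \<Rightarrow> (nat \<Rightarrow> 'a::unital_cstar_algebra \<Rightarrow> 'a) \<Rightarrow> bool" where
  "cstar_dynamical_system d \<alpha> \<longleftrightarrow> 1 \<le> d \<and> (\<forall>i<d. unital_star_hom class_cstar (\<alpha> i))"

text \<open>
  The word \<open>i\<^sub>m \<cdots> i\<^sub>1\<close> is the list \<open>[i\<^sub>m, \<dots>, i\<^sub>1]\<close>, so that the reversed word is given by \<open>rev\<close>.
\<close>

definition words :: "nat \<Rightarrow> nat list set" where
  "words d = lists {..<d}"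

primrec word_endo :: "(nat \<Rightarrow> 'a \<Rightarrow> 'a) \<Rightarrow> nat list \<Rightarrow> 'a \<Rightarrow> 'a" where
  "word_endo \<alpha> [] = id"
| "word_endo \<alpha> (i # w) = \<alpha> i \<circ> word_endo \<alpha> w"

primrec word_prod :: "(nat \<Rightarrow> 'b::monoid_mult) \<Rightarrow> nat list \<Rightarrow> 'b" where
  "word_prod V [] = 1"
| "word_prod V (i # w) = V i * word_prod V w"

text \<open>A unital representation \<open>\<rho>\<close> of \<open>A\<close> in \<open>D\<close> and a row isometry \<open>[W\<^sub>0, \<dots>, W\<^sub>d\<^sub>-\<^sub>1]\<close> with
  \<open>\<rho>(a) W\<^sub>i = W\<^sub>i \<rho>(\<alpha>\<^sub>i(a))\<close>.\<close>

definition covariant_pair ::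
    "nat \<Rightarrow> (nat \<Rightarrow> 'a::unital_cstar_algebra \<Rightarrow> 'a) \<Rightarrow> 'c cstar \<Rightarrow> ('a \<Rightarrow> 'c) \<Rightarrow> (nat \<Rightarrow> 'c) \<Rightarrow> bool" where
  "covariant_pair d \<alpha> D \<rho> W \<longleftrightarrow>
     unital_star_hom D \<rho> \<and>
     (\<forall>i<d. W i \<in> carrier D) \<and>
     (\<forall>i<d. \<forall>j<d. cadj D (W i) \<otimes>\<^bsub>D\<^esub> W j = (if i = j then \<one>\<^bsub>D\<^esub> else \<zero>\<^bsub>D\<^esub>)) \<and>
     (\<forall>i<d. \<forall>a. \<rho> a \<otimes>\<^bsub>D\<^esub> W i = W i \<otimes>\<^bsub>D\<^esub> \<rho> (\<alpha> i a))"

text \<open>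
  The type \<open>'b\<close> with \<open>\<iota>\<close> and \<open>V\<close> is the universal C*-algebra generated by a covariant pair.
  A formula cannot quantify over types, so the test algebras \<open>D\<close> range over all C*-algebras whose
  carrier is contained in one fixed type \<open>'c\<close>.  This is the full universal property as soon as
  \<open>'c\<close> is large enough: a C*-algebra generated by a covariant pair has a dense subset of
  cardinality at most \<open>max |A| \<aleph>\<^sub>0 = |A|\<close>, hence itself at most \<open>|A|\<close> to the power \<open>\<aleph>\<^sub>0\<close> elements,
  and any covariant pair may be corestricted to the C*-algebra that it generates.  The type
  \<open>universe\<close> below has more elements than that, since it has at least \<open>2\<close> to the power \<open>|A|\<close>.
\<close>

definition toeplitz_pimsner ::
    "'c itself \<Rightarrow> nat \<Rightarrow> (nat \<Rightarrow> 'a::unital_cstar_algebra \<Rightarrow> 'a) \<Rightarrow>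
      ('a \<Rightarrow> 'b::unital_cstar_algebra) \<Rightarrow> (nat \<Rightarrow> 'b) \<Rightarrow> bool" where
  "toeplitz_pimsner TYPE('c) d \<alpha> \<iota> V \<longleftrightarrow>
     covariant_pair d \<alpha> class_cstar \<iota> V \<and>
     (\<forall>B. star_subalgebra B \<and> closed B \<and> range \<iota> \<subseteq> B \<and> V ` {..<d} \<subseteq> B \<longrightarrow> B = UNIV) \<and>
     (\<forall>(D :: 'c cstar) \<rho> W. carrier_cstar_algebra D \<and> covariant_pair d \<alpha> D \<rho> W \<longrightarrow>
        (\<exists>\<Phi>. unital_star_hom D \<Phi> \<and> (\<forall>a. \<Phi> (\<iota> a) = \<rho> a) \<and> (\<forall>i<d. \<Phi> (V i) = W i)))"

text \<open>Operators on spaces of functions on \<open>F\<^sub>+\<^sup>d \<times> A\<close>.\<close>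

type_synonym 'a universe = "(nat list \<times> 'a \<Rightarrow> complex) \<Rightarrow> (nat list \<times> 'a \<Rightarrow> complex)"

text \<open>As \<open>\<iota>\<close> and \<open>V\<close> generate, these conditions determine \<open>\<gamma>\<close> on the unit circle; they entail that it
  is a strongly continuous action of the circle.\<close>

definition gauge_action ::
    "nat \<Rightarrow> ('a \<Rightarrow> 'b::unital_cstar_algebra) \<Rightarrow> (nat \<Rightarrow> 'b) \<Rightarrow> (complex \<Rightarrow> 'b \<Rightarrow> 'b) \<Rightarrow> bool" where
  "gauge_action d \<iota> V \<gamma> \<longleftrightarrow>
     (\<forall>z. cmod z = 1 \<longrightarrow>
        unital_star_hom class_cstar (\<gamma> z) \<and> bij (\<gamma> z) \<and>
        (\<forall>a. \<gamma> z (\<iota> a) = \<iota> a) \<and> (\<forall>i<d. \<gamma> z (V i) = z *\<^sub>C V i))"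


section \<open>States\<close>

definition states :: "('a::unital_cstar_algebra \<Rightarrow> complex) set" where
  "states = {\<phi>. (\<forall>x y. \<phi> (x + y) = \<phi> x + \<phi> y) \<and> (\<forall>c x. \<phi> (c *\<^sub>C x) = c * \<phi> x) \<and>
     (\<forall>x. \<phi> (star x * x) \<in> \<real>\<^sub>\<ge>\<^sub>0) \<and> \<phi> 1 = 1}"

definition tracial_states :: "('a::unital_cstar_algebra \<Rightarrow> complex) set" where
  "tracial_states = {\<tau> \<in> states. \<forall>x y. \<tau> (x * y) = \<tau> (y * x)}"

text \<open>\<open>F\<close> is an entire extension of \<open>t \<mapsto> \<sigma>\<^sub>t(x)\<close>; such an extension is unique if it exists.\<close>

definition entire_extension ::
    "(real \<Rightarrow> 'b \<Rightarrow> 'b) \<Rightarrow> 'b \<Rightarrow> (complex \<Rightarrow> 'b::unital_cstar_algebra) \<Rightarrow> bool" where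
  "entire_extension \<sigma> x F \<longleftrightarrow>
     (\<forall>t. F (complex_of_real t) = \<sigma> t x) \<and>
     (\<forall>z. \<exists>F'. (F has_derivative (\<lambda>h. h *\<^sub>C F')) (at z))"

definition analytic_elements :: "(real \<Rightarrow> 'b \<Rightarrow> 'b) \<Rightarrow> 'b::unital_cstar_algebra set" where
  "analytic_elements \<sigma> = {x. \<exists>F. entire_extension \<sigma> x F}"

text \<open>The vector \<open>F (\<i> * \<beta>)\<close> is \<open>\<sigma>\<^sub>i\<^sub>\<beta>(x)\<close>.\<close>

definition kms_states ::
    "(real \<Rightarrow> 'b \<Rightarrow> 'b) \<Rightarrow> real \<Rightarrow> ('b::unital_cstar_algebra \<Rightarrow> complex) set" where
  "kms_states \<sigma> \<beta> = {\<psi> \<in> states. \<exists>B.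
     star_subalgebra B \<and> closure B = UNIV \<and> (\<forall>t. \<forall>x\<in>B. \<sigma> t x \<in> B) \<and> B \<subseteq> analytic_elements \<sigma> \<and>
     (\<forall>x\<in>B. \<forall>y\<in>B. \<forall>F. entire_extension \<sigma> x F \<longrightarrow>
        \<psi> (x * y) = \<psi> (y * F (\<i> * complex_of_real \<beta>)))}"

text \<open>The topology of pointwise convergence, which on functionals is the weak* topology.\<close>

definition weak_star :: "('a \<Rightarrow> complex) topology" where
  "weak_star = product_topology (\<lambda>_. euclidean) UNIV"

definition affine_map_on ::
    "('a \<Rightarrow> complex) set \<Rightarrow> (('a \<Rightarrow> complex) \<Rightarrow> ('b \<Rightarrow> complex)) \<Rightarrow> bool" where
  "affine_map_on S \<Psi> \<longleftrightarrow>
     (\<forall>\<phi>\<in>S. \<forall>\<phi>'\<in>S. \<forall>s\<in>{0..1::real}.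
        \<Psi> (\<lambda>a. of_real (1 - s) * \<phi> a + of_real s * \<phi>' a) =
        (\<lambda>x. of_real (1 - s) * \<Psi> \<phi> x + of_real s * \<Psi> \<phi>' x))"

end

theory Submission
  imports Defs "HOL-Complex_Analysis.Complex_Analysis" "HOL-Library.Function_Algebras"
begin

text \<open>
  A trace \<open>\<tau>\<close> gives the Fock representation of \<open>T(A,\<alpha>)\<close> on \<open>H\<^sub>\<tau> \<otimes> \<ell>\<^sup>2(F\<^sub>+\<^sup>d)\<close>, where \<open>H\<^sub>\<tau>\<close> is the GNS
  space and \<open>a\<close> acts by \<open>\<alpha>\<^bsub>rev w\<^esub>(a)\<close> on the summand of \<open>w\<close>.  The state \<open>\<psi>\<^sub>\<tau>\<close> is the average of
  the vector states of \<open>1 \<otimes> e\<^sub>w\<close> with weights proportional to \<open>exp (- \<beta> |w|)\<close>.  The Fock space is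
  realised as a reproducing kernel Hilbert space of functions on \<open>F\<^sub>+\<^sup>d \<times> A\<close>, so that its operators
  live in the type \<open>universe\<close> and the generators act by composition with maps of \<open>F\<^sub>+\<^sup>d \<times> A\<close>.

  A state \<open>\<psi>\<close> is KMS if and only if \<open>\<psi>(x y) = exp (- k \<beta>) \<psi>(y x)\<close> for all monomials
  \<open>x = V\<^sub>\<mu> a V\<^sub>\<nu>\<^sup>*\<close> of degree \<open>k = |\<mu>| - |\<nu>|\<close> and all \<open>y\<close>.  For the forward direction one takes the
  \<open>k\<close>-th Fourier coefficient of \<open>t \<mapsto> \<psi>(y \<sigma>\<^sub>t(u))\<close> on the lines \<open>Im z = 0\<close> and \<open>Im z = \<beta>\<close>, for \<open>u\<close>
  in the given dense subalgebra, and lets \<open>u\<close> tend to \<open>x\<close>.  Consequently a KMS state is determined by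
  its restriction \<open>\<omega>\<close> to \<open>A\<close>, and \<open>\<omega>(a) - exp (- \<beta>) \<Sum>\<^sub>i \<omega>(\<alpha>\<^sub>i(a))\<close> is a multiple of the trace that it
  comes from, by a telescoping series.
\<close>

section \<open>Positive functionals on a unital C*-algebra\<close>

text \<open>States are defined without any continuity, and a KMS state only comes with some dense
  subalgebra of analytic elements, which need not contain a single monomial. The proof therefore
  rests on bounds valid for all states at once. Positivity alone gives
  \<open>cmod (\<phi> x) \<le> norm x\<close>; the square root that this takes is a power series, so
  no spectral theory enters. A state composed with a unital star-homomorphism is again a state,
  which bounds \<psi>(\<sigma>_t(u) y) uniformly in t. The factor 1 - e^(-\<beta>) d normalises the
  weights e^(-\<beta> |w|): there are d^m words of length m, and the geometric series converges
  exactly for \<beta> > log d. It is also the value of a KMS state at the projection 1 - \<Sum> V_i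
  V_i^*, which commutes with A. Cutting \<psi> down by this projection isolates the term of the
  empty word, and this is where the formula for the inverse map comes from. The inverse is a finite
  combination of evaluations, and \<tau> \<mapsto> \<psi>_\<tau>(x) is a limit uniform in \<tau>, so
  both directions of the homeomorphism are checked directly.\<close>

lemma scaleC_one [simp]: "1 *\<^sub>C x = (x :: 'a::unital_cstar_algebra)"
  using scaleC_of_real[of 1 x] by simp

lemma scaleC_zero_left [simp]: "0 *\<^sub>C x = (0 :: 'a::unital_cstar_algebra)"
  using scaleC_of_real[of 0 x] by simp

lemma scaleC_minus_left: "(- c) *\<^sub>C x = - (c *\<^sub>C x :: 'a::unital_cstar_algebra)"
  using scaleC_add_left[of c "- c" x] by (simp add: add_eq_0_iff)

lemma star_zero [simp]: "star (0 :: 'a::unital_cstar_algebra) = 0"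
  using star_add[of "0::'a" 0] by simp

lemma star_one [simp]: "star (1 :: 'a::unital_cstar_algebra) = 1"
  by (metis mult.right_neutral star_mult star_star)

lemma star_minus: "star (- x) = - star (x :: 'a::unital_cstar_algebra)"
  using star_add[of x "- x"] by (simp add: add_eq_0_iff)

lemma star_diff: "star (x - y) = star x - star (y :: 'a::unital_cstar_algebra)"
  using star_add[of x "- y"] by (simp add: star_minus)

lemma star_scaleR: "star (r *\<^sub>R x) = r *\<^sub>R star (x :: 'a::unital_cstar_algebra)"
  using star_scaleC[of "of_real r" x] by (simp add: scaleC_of_real)

lemma star_power: "star (x ^ n) = star (x :: 'a::unital_cstar_algebra) ^ n"
  by (induction n) (simp_all add: star_mult power_commutes)

lemma norm_star [simp]: "norm (star x) = norm (x :: 'a::unital_cstar_algebra)"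
proof -
  have le: "norm y \<le> norm (star y)" for y :: 'a
  proof (cases "y = 0")
    case False
    have "norm y * norm y = norm (star y * y)"
      by (simp add: cstar_identity power2_eq_square)
    also have "\<dots> \<le> norm (star y) * norm y"
      by (rule norm_mult_ineq)
    finally show ?thesis
      using False by simp
  qed simp
  show ?thesis
    using le[of x] le[of "star x"] by (simp add: star_star)
qed

lemma bounded_linear_star: "bounded_linear (star :: 'a::unital_cstar_algebra \<Rightarrow> 'a)"
  by (rule bounded_linear_intro[where K = 1]) (simp_all add: star_add star_scaleR)

lemma bounded_linear_scaleC: "bounded_linear (\<lambda>x :: 'a::unital_cstar_algebra. c *\<^sub>C x)"
proof (rule bounded_linear_intro[where K = "cmod c"])
  show "c *\<^sub>C r *\<^sub>R x = r *\<^sub>R (c *\<^sub>C x)" for r and x :: 'a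
    by (metis scaleC_of_real scaleC_scaleC mult.commute)
qed (simp_all add: scaleC_add_right norm_scaleC mult.commute)

text \<open>The square root is the binomial series of \<open>sqrt (1 - t)\<close> evaluated at \<open>h\<close>.\<close>

lemma one_minus_square_root:
  fixes h :: "'a::unital_cstar_algebra"
  assumes "norm h < 1" and "star h = h"
  obtains b where "star b = b" and "b * b = 1 - h"
proof -
  define c where "c n = ((1/2::real) gchoose n) * (-1) ^ n" for n
  \<comment> \<open>Convergence of the binomial series at some point beyond \<open>norm h\<close>
    makes it absolutely convergent at \<open>norm h\<close>.\<close>
  obtain K where K: "norm h < K" "K < 1"
    using assms(1) dense by blast
  then have K0: "0 < K"
    using norm_ge_zero[of h] by linarith
  have "(\<lambda>n. ((1/2::real) gchoose n) * (- K) ^ n) sums (1 + (- K)) powr (1/2)"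
    using gen_binomial_real[of "- K" "1/2"] K K0 by simp
  then have "summable (\<lambda>n. c n * K ^ n)"
    unfolding c_def by (simp add: sums_iff power_mult_distrib[of "-1" K, simplified] mult.assoc)
  then have "summable (\<lambda>n. norm (c n * norm h ^ n))"
    using powser_insidea[of c K "norm h"] K K0 by simp
  then have sn: "summable (\<lambda>n. norm (c n *\<^sub>R h ^ n))"
    by (rule summable_comparison_test[rotated])
       (auto intro!: exI[of _ 0] mult_left_mono norm_power_ineq simp: abs_mult)
  define b where "b = (\<Sum>n. c n *\<^sub>R h ^ n)"
  have sm: "summable (\<lambda>n. c n *\<^sub>R h ^ n)"
    by (rule summable_norm_cancel[OF sn])
  have "star b = (\<Sum>n. star (c n *\<^sub>R h ^ n))"
    unfolding b_def using bounded_linear.suminf[OF bounded_linear_star sm] by simp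
  then have "star b = b"
    by (simp add: star_scaleR star_power assms(2) b_def)
  moreover have "b * b = 1 - h"
  proof -
    \<comment> \<open>Vandermonde: squaring the series of exponent 1/2 yields that of exponent 1,
      whose coefficients vanish beyond degree one.\<close>
    have coeff: "(\<Sum>i\<le>k. c i * c (k - i)) = (-1) ^ k * of_nat (1 choose k)" for k
    proof -
      have "(\<Sum>i\<le>k. c i * c (k - i)) =
          (\<Sum>i\<le>k. (-1) ^ k * ((1/2 gchoose i) * (1/2 gchoose (k - i))))"
        by (rule sum.cong) (simp_all add: c_def power_add[symmetric] mult_ac)
      also have "\<dots> = (-1) ^ k * ((1/2 + 1/2) gchoose k)"
        by (simp only: sum_distrib_left[symmetric] gbinomial_Vandermonde atMost_atLeast0)
      also have "(1/2 + 1/2 :: real) = of_nat 1" by simp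
      finally show ?thesis by (simp only: binomial_gbinomial)
    qed
    have "(\<lambda>k. \<Sum>i\<le>k. (c i *\<^sub>R h ^ i) * (c (k - i) *\<^sub>R h ^ (k - i))) sums (b * b)"
      unfolding b_def using Cauchy_product_sums[OF sn sn] .
    moreover have "(\<Sum>i\<le>k. (c i *\<^sub>R h ^ i) * (c (k - i) *\<^sub>R h ^ (k - i))) =
        ((-1) ^ k * of_nat (1 choose k)) *\<^sub>R h ^ k" for k
    proof -
      have "(\<Sum>i\<le>k. (c i *\<^sub>R h ^ i) * (c (k - i) *\<^sub>R h ^ (k - i))) =
          (\<Sum>i\<le>k. (c i * c (k - i)) *\<^sub>R h ^ k)"
        by (rule sum.cong) (simp_all add: power_add[symmetric])
      also have "\<dots> = (\<Sum>i\<le>k. c i * c (k - i)) *\<^sub>R h ^ k"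
        by (simp add: scaleR_left.sum)
      finally show ?thesis by (simp only: coeff)
    qed
    ultimately have s1: "(\<lambda>k. ((-1) ^ k * of_nat (1 choose k)) *\<^sub>R h ^ k) sums (b * b)"
      by simp
    have "(\<lambda>k. ((-1) ^ k * of_nat (1 choose k)) *\<^sub>R h ^ k) sums
        (\<Sum>k\<in>{0,1}. ((-1) ^ k * of_nat (1 choose k)) *\<^sub>R h ^ k)"
    proof (rule sums_finite)
      show "((-1) ^ k * of_nat (1 choose k)) *\<^sub>R h ^ k = 0" if "k \<notin> {0,1}" for k
        using that by (simp add: binomial_eq_0)
    qed simp
    then show ?thesis
      using s1 sums_unique2 by fastforce
  qed
  ultimately show ?thesis using that by blast
qed

text \<open>The discriminant argument shared by every Cauchy-Schwarz inequality below: for positive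
  functionals, for inner products, and for kernels before an inner product is available. For C > 0
  the minimum lies at t = - cnj b / C.\<close>

lemma quadratic_nonneg_cmod:
  fixes A C :: real and b :: complex
  assumes nonneg: "\<And>t. 0 \<le> A + 2 * Re (t * b) + (cmod t)\<^sup>2 * C" and "0 \<le> C"
  shows "(cmod b)\<^sup>2 \<le> A * C"
proof (cases "C = 0")
  case True
  have "b = 0"
  proof (rule ccontr)
    assume "b \<noteq> 0"
    then have b: "0 < (cmod b)\<^sup>2" by simp
    \<comment> \<open>With C = 0 the expression is affine in t; this t gives it the value - A - 2,
      which is negative because t = 0 shows A \<ge> 0.\<close>
    define t where "t = - of_real ((A + 1) / (cmod b)\<^sup>2) * cnj b"
    have "t * b = - (of_real ((A + 1) / (cmod b)\<^sup>2) * (b * cnj b))"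
      by (simp add: t_def)
    also have "\<dots> = - of_real ((A + 1) / (cmod b)\<^sup>2 * (cmod b)\<^sup>2)"
      by (simp only: complex_norm_square[symmetric] of_real_mult)
    finally have "t * b = - of_real ((A + 1) / (cmod b)\<^sup>2 * (cmod b)\<^sup>2)" .
    then have "t * b = - of_real (A + 1)"
      using b by simp
    then have "0 \<le> A - 2 * (A + 1)"
      using nonneg[of t] True by simp
    moreover have "0 \<le> A"
      using nonneg[of 0] by simp
    ultimately show False by simp
  qed
  then show ?thesis using True by simp
next
  case False
  with assms(2) have C: "0 < C" by simp
  define t where "t = - of_real (1 / C) * cnj b"
  have "t * b = - of_real ((cmod b)\<^sup>2 / C)"
    by (simp add: t_def mult.commute[of "cnj b"] flip: complex_norm_square)
  moreover have "(cmod t)\<^sup>2 * C = (cmod b)\<^sup>2 / C"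
    using C by (simp add: t_def norm_mult norm_divide power_divide) (simp add: power2_eq_square)
  ultimately have "0 \<le> A - (cmod b)\<^sup>2 / C"
    using nonneg[of t] by simp
  then show ?thesis
    using C by (simp add: field_simps)
qed

text \<open>States without the normalisation, so that the class contains the compressions y
  \<mapsto> p(star x * f y * x), whose value at 1 is arbitrary.\<close>

definition positive_functional :: "('a::unital_cstar_algebra \<Rightarrow> complex) \<Rightarrow> bool" where
  "positive_functional p \<longleftrightarrow> (\<forall>x y. p (x + y) = p x + p y) \<and> (\<forall>c x. p (c *\<^sub>C x) = c * p x) \<and>
     (\<forall>x. p (star x * x) \<in> \<real>\<^sub>\<ge>\<^sub>0)"

lemma states_iff: "\<phi> \<in> states \<longleftrightarrow> positive_functional \<phi> \<and> \<phi> 1 = 1"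
  by (auto simp: states_def positive_functional_def)

context
  fixes p :: "'a::unital_cstar_algebra \<Rightarrow> complex"
  assumes p: "positive_functional p"
begin

lemma positive_functional_add: "p (x + y) = p x + p y"
  and positive_functional_scaleC: "p (c *\<^sub>C x) = c * p x"
  and positive_functional_nonneg: "p (star x * x) \<in> \<real>\<^sub>\<ge>\<^sub>0"
  using p by (auto simp: positive_functional_def)

lemma positive_functional_scaleR: "p (r *\<^sub>R x) = of_real r * p x"
  by (metis positive_functional_scaleC scaleC_of_real)

lemma positive_functional_minus: "p (- x) = - p x"
  using positive_functional_scaleR[of "- 1" x] by simp

lemma positive_functional_diff: "p (x - y) = p x - p y"
  using positive_functional_add[of x "- y"] by (simp add: positive_functional_minus)

lemma positive_functional_zero: "p 0 = 0"
  using positive_functional_diff[of 0 0] by simp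

lemma positive_functional_sum: "p (sum f I) = (\<Sum>i\<in>I. p (f i))"
  by (induction I rule: infinite_finite_induct)
     (simp_all add: positive_functional_zero positive_functional_add)

lemma positive_functional_Re_nonneg: "0 \<le> Re (p (star x * x))"
  and positive_functional_Im: "Im (p (star x * x)) = 0"
  using positive_functional_nonneg[of x] by (auto simp: complex_nonneg_Reals_iff)

text \<open>p is real on squares; expanding the squares of 1 + x and 1 + \<i> x determines the
  imaginary and the real part of p (star x) respectively.\<close>

lemma positive_functional_star: "p (star x) = cnj (p x)"
proof -
  have "star (1 + x) * (1 + x) = 1 + x + star x + star x * x"
    by (simp add: star_add algebra_simps)
  then have "Im (p x) + Im (p (star x)) = 0"
    using positive_functional_Im[of "1 + x"] positive_functional_Im[of 1] positive_functional_Im[of x]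
    by (simp add: positive_functional_add)
  moreover have "star (1 + \<i> *\<^sub>C x) * (1 + \<i> *\<^sub>C x) = 1 + \<i> *\<^sub>C x + (- \<i>) *\<^sub>C star x + star x * x"
    by (simp add: star_add star_scaleC distrib_left distrib_right mult_scaleC_left mult_scaleC_right
        scaleC_scaleC scaleC_add_right add_ac)
  then have "Re (p x) - Re (p (star x)) = 0"
    using positive_functional_Im[of "1 + \<i> *\<^sub>C x"] positive_functional_Im[of 1]
      positive_functional_Im[of x]
    by (simp add: positive_functional_add positive_functional_scaleC)
  ultimately show ?thesis
    by (auto simp: complex_eq_iff)
qed

lemma positive_functional_Cauchy_Schwarz:
  "(cmod (p (star y * x)))\<^sup>2 \<le> Re (p (star x * x)) * Re (p (star y * y))"
proof (rule quadratic_nonneg_cmod)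
  fix t
  have "star (x + cnj t *\<^sub>C y) * (x + cnj t *\<^sub>C y) =
      star x * x + t *\<^sub>C (star y * x) + cnj t *\<^sub>C (star x * y) + (t * cnj t) *\<^sub>C (star y * y)"
    by (simp add: star_add star_scaleC distrib_left distrib_right mult_scaleC_left mult_scaleC_right
        scaleC_scaleC scaleC_add_right add_ac mult.commute[of "cnj t"])
  moreover have "p (star x * y) = cnj (p (star y * x))"
    using positive_functional_star[of "star y * x"] by (simp add: star_mult star_star)
  moreover have "(cmod t)\<^sup>2 = Re t * Re t + Im t * Im t"
    unfolding cmod_power2 by (simp add: power2_eq_square)
  ultimately show "0 \<le> Re (p (star x * x)) + 2 * Re (t * p (star y * x))
      + (cmod t)\<^sup>2 * Re (p (star y * y))"
    using positive_functional_Re_nonneg[of "x + cnj t *\<^sub>C y"]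
    by (simp add: positive_functional_add positive_functional_scaleC)
qed (rule positive_functional_Re_nonneg)

text \<open>For r > \<open>(norm x)\<^sup>2\<close> the element 1 - star x * x / r is the square of
  a self-adjoint element, hence p is non-negative on it. The square root series asks for norm
  strictly below 1; the slack is a factor s < 1, removed at the end by letting s tend to 1.\<close>

lemma positive_functional_square_le: "Re (p (star x * x)) \<le> (norm x)\<^sup>2 * Re (p 1)"
proof (rule field_le_mult_one_interval)
  fix s :: real
  assume s: "0 < s" "s < 1"
  show "s * Re (p (star x * x)) \<le> (norm x)\<^sup>2 * Re (p 1)"
  proof (cases "x = 0")
    case True
    then show ?thesis by (simp add: positive_functional_zero)
  next
    case False
    define r where "r = (norm x)\<^sup>2 / s"
    have r: "0 < r" "(norm x)\<^sup>2 < r"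
      using False s by (auto simp: r_def field_simps)
    have "norm ((1 / r) *\<^sub>R (star x * x)) < 1"
      using r by (simp add: cstar_identity)
    moreover have "star ((1 / r) *\<^sub>R (star x * x)) = (1 / r) *\<^sub>R (star x * x)"
      by (simp add: star_scaleR star_mult star_star)
    ultimately obtain b where "star b = b" and b: "b * b = 1 - (1 / r) *\<^sub>R (star x * x)"
      by (rule one_minus_square_root)
    then have "0 \<le> Re (p (1 - (1 / r) *\<^sub>R (star x * x)))"
      using positive_functional_Re_nonneg[of b] by simp
    then have "Re (p (star x * x)) / r \<le> Re (p 1)"
      by (simp add: positive_functional_diff positive_functional_scaleR)
    then show ?thesis
      using r s by (simp add: r_def field_simps)
  qed
qed

end

text \<open>With x = 1 it shows that states composed with homomorphisms are states; for general x it
  bounds the operators of the Fock representation.\<close>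

lemma positive_functional_compress:
  assumes "positive_functional p" and "unital_star_hom class_cstar f"
  shows "positive_functional (\<lambda>y. p (star x * f y * x))"
proof -
  interpret additive p
    using positive_functional_add[OF assms(1)] by unfold_locales
  have "star x * f (star y * y) * x = star (f y * x) * (f y * x)" for y
    using assms(2) by (simp add: unital_star_hom_def star_mult mult.assoc)
  then show ?thesis
    using assms(2) positive_functional_nonneg[OF assms(1)]
    by (auto simp: positive_functional_def unital_star_hom_def distrib_left distrib_right
        mult_scaleC_left mult_scaleC_right positive_functional_add[OF assms(1)]
        positive_functional_scaleC[OF assms(1)])
qed

lemma
  assumes "\<phi> \<in> states"
  shows states_positive: "positive_functional \<phi>" and states_one: "\<phi> 1 = 1"
  using assms by (auto simp: states_iff)

lemma states_mult_le:
  assumes "\<phi> \<in> states"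
  shows "cmod (\<phi> (x * y)) \<le> sqrt (Re (\<phi> (x * star x))) * sqrt (Re (\<phi> (star y * y)))"
proof -
  have "(cmod (\<phi> (x * y)))\<^sup>2 \<le> Re (\<phi> (star y * y)) * Re (\<phi> (x * star x))"
    using positive_functional_Cauchy_Schwarz[OF states_positive[OF assms], of "star x" y]
    by (simp add: star_star)
  then show ?thesis
    by (simp add: real_le_rsqrt mult.commute flip: real_sqrt_mult)
qed

lemma states_square_le:
  assumes "\<phi> \<in> states"
  shows "sqrt (Re (\<phi> (star x * x))) \<le> norm x"
  using positive_functional_square_le[OF states_positive[OF assms], of x]
  by (simp add: states_one[OF assms] real_le_lsqrt)

text \<open>Automatic continuity, by Cauchy-Schwarz against 1. It makes every density argument below
  possible, and its constant 1 does not depend on the state.\<close>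

lemma states_norm_le:
  assumes "\<phi> \<in> states"
  shows "cmod (\<phi> x) \<le> norm x"
  using states_mult_le[OF assms, of 1 x] states_square_le[OF assms, of x]
  by (simp add: states_one[OF assms])

lemma bounded_linear_states:
  assumes "\<phi> \<in> states"
  shows "bounded_linear \<phi>"
  by (rule bounded_linear_intro[where K = 1])
     (simp_all add: positive_functional_add[OF states_positive[OF assms]]
       positive_functional_scaleR[OF states_positive[OF assms]] states_norm_le[OF assms]
       scaleR_conv_of_real[where 'a = complex])

lemma states_comp_hom:
  assumes "\<phi> \<in> states" and "unital_star_hom class_cstar f"
  shows "\<phi> \<circ> f \<in> states"
  using positive_functional_compress[OF states_positive[OF assms(1)] assms(2), of 1]
    states_one[OF assms(1)] assms(2)
  by (simp add: states_iff comp_def unital_star_hom_def)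

section \<open>Adjointable operators on a Hilbert space\<close>

text \<open>Addition is that of the ambient type, and the laws of \<open>sc\<close> hold on the
  whole type: the intended instance is a subspace of a space of functions with pointwise operations.
  Completeness is phrased with the squared norm.\<close>

locale hilbert_space_on =
  fixes H :: "'h::ab_group_add set"
    and sc :: "complex \<Rightarrow> 'h \<Rightarrow> 'h"
    and ip :: "'h \<Rightarrow> 'h \<Rightarrow> complex"
  assumes zero_closed: "0 \<in> H"
    and add_closed: "x \<in> H \<Longrightarrow> y \<in> H \<Longrightarrow> x + y \<in> H"
    and sc_closed: "x \<in> H \<Longrightarrow> sc c x \<in> H"
    and sc_add_right: "sc c (x + y) = sc c x + sc c y"
    and sc_add_left: "sc (b + c) x = sc b x + sc c x"
    and sc_sc: "sc b (sc c x) = sc (b * c) x"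
    and sc_one: "sc 1 x = x"
    and ip_add_left: "x \<in> H \<Longrightarrow> y \<in> H \<Longrightarrow> z \<in> H \<Longrightarrow> ip (x + y) z = ip x z + ip y z"
    and ip_sc_left: "x \<in> H \<Longrightarrow> y \<in> H \<Longrightarrow> ip (sc c x) y = c * ip x y"
    and ip_cnj: "x \<in> H \<Longrightarrow> y \<in> H \<Longrightarrow> ip y x = cnj (ip x y)"
    and ip_nonneg: "x \<in> H \<Longrightarrow> 0 \<le> Re (ip x x)"
    and ip_definite: "x \<in> H \<Longrightarrow> Re (ip x x) = 0 \<Longrightarrow> x = 0"
    and ip_complete: "range s \<subseteq> H \<Longrightarrow>
      (\<And>e. e > 0 \<Longrightarrow> \<exists>N::nat. \<forall>m\<ge>N. \<forall>n\<ge>N. Re (ip (s m - s n) (s m - s n)) < e) \<Longrightarrow>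
      \<exists>x\<in>H. (\<lambda>n. Re (ip (s n - x) (s n - x))) \<longlonglongrightarrow> 0"
begin

definition hnorm :: "'h \<Rightarrow> real" where
  "hnorm x = sqrt (Re (ip x x))"

lemma sc_zero_left: "sc 0 x = 0"
  using sc_add_left[of 0 0 x] by simp

lemma sc_zero_right: "sc c 0 = 0"
  using sc_add_right[of c 0 0] by simp

lemma sc_minus_one: "sc (- 1) x = - x"
  using sc_add_left[of 1 "- 1" x] by (simp add: sc_one sc_zero_left eq_neg_iff_add_eq_0 add.commute)

lemma minus_closed: "x \<in> H \<Longrightarrow> - x \<in> H"
  using sc_closed[of x "- 1"] by (simp add: sc_minus_one)

lemma diff_closed: "x \<in> H \<Longrightarrow> y \<in> H \<Longrightarrow> x - y \<in> H"
  using add_closed[of x "- y"] by (simp add: minus_closed)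

lemmas closed = zero_closed add_closed sc_closed minus_closed diff_closed

lemma ip_minus_left: "x \<in> H \<Longrightarrow> y \<in> H \<Longrightarrow> ip (- x) y = - ip x y"
  using ip_sc_left[of x y "- 1"] by (simp add: sc_minus_one)

lemma ip_diff_left: "x \<in> H \<Longrightarrow> y \<in> H \<Longrightarrow> z \<in> H \<Longrightarrow> ip (x - y) z = ip x z - ip y z"
  using ip_add_left[of x "- y" z] by (simp add: minus_closed ip_minus_left)

lemma ip_zero_left: "y \<in> H \<Longrightarrow> ip 0 y = 0"
  using ip_diff_left[of y y y] by simp

lemma ip_add_right: "x \<in> H \<Longrightarrow> y \<in> H \<Longrightarrow> z \<in> H \<Longrightarrow> ip z (x + y) = ip z x + ip z y"
  using ip_cnj[of "x + y" z] ip_cnj[of x z] ip_cnj[of y z] by (simp add: closed ip_add_left)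

lemma ip_diff_right: "x \<in> H \<Longrightarrow> y \<in> H \<Longrightarrow> z \<in> H \<Longrightarrow> ip z (x - y) = ip z x - ip z y"
  using ip_cnj[of "x - y" z] ip_cnj[of x z] ip_cnj[of y z] by (simp add: closed ip_diff_left)

lemma ip_zero_right: "y \<in> H \<Longrightarrow> ip y 0 = 0"
  using ip_diff_right[of y y y] by simp

lemma ip_sc_right: "x \<in> H \<Longrightarrow> y \<in> H \<Longrightarrow> ip y (sc c x) = cnj c * ip y x"
  using ip_cnj[of "sc c x" y] ip_cnj[of x y] by (simp add: closed ip_sc_left)

lemma Im_ip_self: "x \<in> H \<Longrightarrow> Im (ip x x) = 0"
  using ip_cnj[of x x] by (simp add: complex_eq_iff)

lemma ip_self: "x \<in> H \<Longrightarrow> ip x x = of_real ((hnorm x)\<^sup>2)"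
  using Im_ip_self[of x] ip_nonneg[of x] by (simp add: hnorm_def complex_eq_iff)

lemma hnorm_nonneg: "x \<in> H \<Longrightarrow> 0 \<le> hnorm x"
  by (simp add: hnorm_def ip_nonneg)

lemma hnorm_power2: "x \<in> H \<Longrightarrow> (hnorm x)\<^sup>2 = Re (ip x x)"
  by (simp add: hnorm_def ip_nonneg)

lemma hnorm_zero [simp]: "hnorm 0 = 0"
  by (simp add: hnorm_def ip_zero_left zero_closed)

lemma hnorm_eq_0: "x \<in> H \<Longrightarrow> hnorm x = 0 \<Longrightarrow> x = 0"
  using ip_definite[of x] by (simp add: hnorm_def ip_nonneg)

lemma hnorm_sc: "x \<in> H \<Longrightarrow> hnorm (sc c x) = cmod c * hnorm x"
proof -
  assume x: "x \<in> H"
  have "ip (sc c x) (sc c x) = (c * cnj c) * ip x x"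
    by (simp add: x closed ip_sc_left ip_sc_right)
  also have "\<dots> = of_real ((cmod c)\<^sup>2 * (hnorm x)\<^sup>2)"
    by (simp only: complex_norm_square[symmetric] ip_self[OF x] of_real_mult)
  finally show ?thesis
    by (simp add: hnorm_def[of "sc c x"] real_sqrt_mult hnorm_nonneg x)
qed

lemma hnorm_minus: "x \<in> H \<Longrightarrow> hnorm (- x) = hnorm x"
  using hnorm_sc[of x "- 1"] by (simp add: sc_minus_one)

lemma Cauchy_Schwarz:
  assumes "x \<in> H" and "y \<in> H"
  shows "cmod (ip x y) \<le> hnorm x * hnorm y"
proof (rule power2_le_imp_le)
  have "(cmod (ip x y))\<^sup>2 \<le> Re (ip x x) * Re (ip y y)"
  proof (rule quadratic_nonneg_cmod)
    fix t
    have "ip (x + sc (cnj t) y) (x + sc (cnj t) y) =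
        ip x x + t * ip x y + cnj t * ip y x + (cnj t * t) * ip y y"
      using assms by (simp add: closed ip_add_left ip_add_right ip_sc_left ip_sc_right algebra_simps)
    moreover have "ip y x = cnj (ip x y)"
      using assms by (rule ip_cnj)
    moreover have "(cmod t)\<^sup>2 = Re t * Re t + Im t * Im t"
      unfolding cmod_power2 by (simp add: power2_eq_square)
    ultimately show "0 \<le> Re (ip x x) + 2 * Re (t * ip x y) + (cmod t)\<^sup>2 * Re (ip y y)"
      using ip_nonneg[of "x + sc (cnj t) y"] assms by (simp add: closed algebra_simps Im_ip_self)
  qed (use assms ip_nonneg in auto)
  then show "(cmod (ip x y))\<^sup>2 \<le> (hnorm x * hnorm y)\<^sup>2"
    using assms by (simp add: power_mult_distrib hnorm_power2)
qed (use assms hnorm_nonneg in auto)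

lemma hnorm_triangle:
  assumes "x \<in> H" and "y \<in> H"
  shows "hnorm (x + y) \<le> hnorm x + hnorm y"
proof (rule power2_le_imp_le)
  have "Re (ip (x + y) (x + y)) = (hnorm x)\<^sup>2 + (hnorm y)\<^sup>2 + 2 * Re (ip x y)"
    using assms ip_cnj[of x y] by (simp add: closed ip_add_left ip_add_right hnorm_power2)
  also have "Re (ip x y) \<le> hnorm x * hnorm y"
    using Cauchy_Schwarz[OF assms] complex_Re_le_cmod[of "ip x y"] by linarith
  finally show "(hnorm (x + y))\<^sup>2 \<le> (hnorm x + hnorm y)\<^sup>2"
    using assms by (simp add: hnorm_power2 closed power2_sum)
qed (use assms hnorm_nonneg in auto)

lemma eq_if_ip_eq:
  assumes "x \<in> H" and "y \<in> H" and "\<And>z. z \<in> H \<Longrightarrow> ip z x = ip z y"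
  shows "x = y"
proof -
  have "ip (x - y) (x - y) = 0"
    using assms by (simp add: closed ip_diff_right)
  then show ?thesis
    using ip_definite[of "x - y"] assms by (simp add: closed)
qed

section \<open>Operators with an adjoint, and the operator norm\<close>

definition maps_H :: "('h \<Rightarrow> 'h) \<Rightarrow> bool" where
  "maps_H T \<longleftrightarrow> (\<forall>x\<in>H. T x \<in> H) \<and> (\<forall>x. x \<notin> H \<longrightarrow> T x = 0)"

definition adjoint_pair :: "('h \<Rightarrow> 'h) \<Rightarrow> ('h \<Rightarrow> 'h) \<Rightarrow> bool" where
  "adjoint_pair T S \<longleftrightarrow> maps_H T \<and> maps_H S \<and> (\<forall>x\<in>H. \<forall>y\<in>H. ip (T x) y = ip x (S y))"

definition bounded_by :: "real \<Rightarrow> ('h \<Rightarrow> 'h) \<Rightarrow> bool" where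
  "bounded_by M T \<longleftrightarrow> 0 \<le> M \<and> (\<forall>x\<in>H. hnorm (T x) \<le> M * hnorm x)"

definition operators :: "('h \<Rightarrow> 'h) set" where
  "operators = {T. (\<exists>S. adjoint_pair T S) \<and> (\<exists>M. bounded_by M T)}"

definition adj :: "('h \<Rightarrow> 'h) \<Rightarrow> ('h \<Rightarrow> 'h)" where
  "adj T = (SOME S. adjoint_pair T S)"

definition opnorm :: "('h \<Rightarrow> 'h) \<Rightarrow> real" where
  "opnorm T = Inf {M. bounded_by M T}"

lemma adjoint_pair_unique:
  assumes "adjoint_pair T S" and "adjoint_pair T S'"
  shows "S = S'"
proof
  fix y
  show "S y = S' y"
  proof (cases "y \<in> H")
    case True
    then show ?thesis
      using assms by (intro eq_if_ip_eq) (auto simp: adjoint_pair_def maps_H_def)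
  next
    case False
    then show ?thesis
      using assms by (auto simp: adjoint_pair_def maps_H_def)
  qed
qed

lemma adj_eq: "adjoint_pair T S \<Longrightarrow> adj T = S"
  unfolding adj_def using adjoint_pair_unique by (blast intro: some_equality)

lemma adjoint_pair_sym:
  assumes "adjoint_pair T S"
  shows "adjoint_pair S T"
proof -
  have "ip (S x) y = ip x (T y)" if "x \<in> H" "y \<in> H" for x y
    using assms that ip_cnj[of "T y" x] ip_cnj[of y "S x"]
    by (auto simp: adjoint_pair_def maps_H_def)
  then show ?thesis
    using assms by (auto simp: adjoint_pair_def)
qed

lemma adjoint_pair_adj: "T \<in> operators \<Longrightarrow> adjoint_pair T (adj T)"
  using adj_eq by (auto simp: operators_def)

lemma adjoint_pair_closed: "adjoint_pair T S \<Longrightarrow> x \<in> H \<Longrightarrow> T x \<in> H"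
  by (auto simp: adjoint_pair_def maps_H_def)

lemma adjoint_pair_outside: "adjoint_pair T S \<Longrightarrow> x \<notin> H \<Longrightarrow> T x = 0"
  by (auto simp: adjoint_pair_def maps_H_def)

lemma adjoint_pair_ip: "adjoint_pair T S \<Longrightarrow> x \<in> H \<Longrightarrow> y \<in> H \<Longrightarrow> ip (T x) y = ip x (S y)"
  by (auto simp: adjoint_pair_def)

text \<open>An adjoint S forces T to be linear: ip z (T (x + y)) = ip (S z) (x + y) for every z in
  \<open>H\<close>, and vectors are separated by their inner products.\<close>

lemma adjoint_pair_add_arg:
  assumes "adjoint_pair T S" and "x \<in> H" and "y \<in> H"
  shows "T (x + y) = T x + T y"
proof (rule eq_if_ip_eq)
  note S = adjoint_pair_sym[OF assms(1)]
  show "ip z (T (x + y)) = ip z (T x + T y)" if "z \<in> H" for z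
    using that assms adjoint_pair_closed[OF S that]
    by (simp add: closed adjoint_pair_closed[OF assms(1)] ip_add_right
        adjoint_pair_ip[OF S, symmetric])
qed (use assms adjoint_pair_closed closed in auto)

lemma adjoint_pair_sc_arg:
  assumes "adjoint_pair T S" and "x \<in> H"
  shows "T (sc c x) = sc c (T x)"
proof (rule eq_if_ip_eq)
  note S = adjoint_pair_sym[OF assms(1)]
  show "ip z (T (sc c x)) = ip z (sc c (T x))" if "z \<in> H" for z
    using that assms adjoint_pair_closed[OF S that]
    by (simp add: closed adjoint_pair_closed[OF assms(1)] ip_sc_right
        adjoint_pair_ip[OF S, symmetric])
qed (use assms adjoint_pair_closed closed in auto)

lemma adjoint_pair_zero_arg:
  assumes "adjoint_pair T S"
  shows "T 0 = 0"
  using adjoint_pair_sc_arg[OF assms zero_closed, of 0] by (simp add: sc_zero_left)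

lemma opnorm_bdd: "bdd_below {M. bounded_by M T}"
  by (rule bdd_belowI[of _ 0]) (simp add: bounded_by_def)

lemma opnorm_le: "bounded_by M T \<Longrightarrow> opnorm T \<le> M"
  unfolding opnorm_def by (rule cInf_lower) (simp_all add: opnorm_bdd)

lemma
  assumes "bounded_by M T"
  shows opnorm_nonneg: "0 \<le> opnorm T"
    and hnorm_le_opnorm: "x \<in> H \<Longrightarrow> hnorm (T x) \<le> opnorm T * hnorm x"
proof -
  have ne: "{M. bounded_by M T} \<noteq> {}"
    using assms by auto
  show "0 \<le> opnorm T"
    unfolding opnorm_def by (rule cInf_greatest[OF ne]) (simp add: bounded_by_def)
  show "hnorm (T x) \<le> opnorm T * hnorm x" if x: "x \<in> H"
  proof (cases "hnorm x = 0")
    case True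
    then show ?thesis
      using assms x by (auto simp: bounded_by_def)
  next
    case False
    with x have pos: "0 < hnorm x"
      using hnorm_nonneg[of x] by simp
    have "hnorm (T x) / hnorm x \<le> opnorm T"
      unfolding opnorm_def
      by (rule cInf_greatest[OF ne]) (use x pos in \<open>auto simp: bounded_by_def field_simps\<close>)
    then show ?thesis
      using pos by (simp add: field_simps)
  qed
qed

lemma bounded_by_opnorm: "bounded_by M T \<Longrightarrow> bounded_by (opnorm T) T"
  using opnorm_nonneg hnorm_le_opnorm unfolding bounded_by_def by blast

lemma operators_bounded_by_opnorm: "T \<in> operators \<Longrightarrow> bounded_by (opnorm T) T"
  using bounded_by_opnorm by (auto simp: operators_def)

text \<open>The square of hnorm (S y) is ip (T (S y)) y, which is at most M * hnorm (S y) * hnorm y;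
  then one factor is cancelled.\<close>

lemma bounded_by_adjoint:
  assumes "adjoint_pair T S" and "bounded_by M T"
  shows "bounded_by M S"
proof -
  have "hnorm (S y) \<le> M * hnorm y" if y: "y \<in> H" for y
  proof -
    note S = adjoint_pair_sym[OF assms(1)]
    have Sy: "S y \<in> H"
      using S y by (rule adjoint_pair_closed)
    have "(hnorm (S y))\<^sup>2 = Re (ip (T (S y)) y)"
      using adjoint_pair_ip[OF assms(1) Sy y] Sy by (simp add: hnorm_power2)
    also have "\<dots> \<le> hnorm (T (S y)) * hnorm y"
      using Cauchy_Schwarz[of "T (S y)" y] complex_Re_le_cmod[of "ip (T (S y)) y"]
        adjoint_pair_closed[OF assms(1) Sy] y by linarith
    also have "\<dots> \<le> (M * hnorm (S y)) * hnorm y"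
      using assms(2) Sy y hnorm_nonneg by (intro mult_right_mono) (auto simp: bounded_by_def)
    finally have le: "hnorm (S y) * hnorm (S y) \<le> hnorm (S y) * (M * hnorm y)"
      by (simp add: power2_eq_square mult_ac)
    show ?thesis
    proof (cases "hnorm (S y) = 0")
      case True
      then show ?thesis
        using assms(2) hnorm_nonneg[OF y] by (simp add: bounded_by_def)
    next
      case False
      then show ?thesis
        using le hnorm_nonneg[OF Sy] by (simp add: mult_le_cancel_left)
    qed
  qed
  then show ?thesis
    using assms(2) by (simp add: bounded_by_def)
qed

lemma operatorsI: "adjoint_pair T S \<Longrightarrow> bounded_by M T \<Longrightarrow> T \<in> operators"
  by (auto simp: operators_def)

lemma adjoint_pair_add:
  "adjoint_pair T S \<Longrightarrow> adjoint_pair T' S' \<Longrightarrow>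
    adjoint_pair (\<lambda>x. T x + T' x) (\<lambda>x. S x + S' x)"
  by (auto simp: adjoint_pair_def maps_H_def closed ip_add_left ip_add_right)

lemma bounded_by_add:
  assumes "adjoint_pair T S" "adjoint_pair T' S'" "bounded_by M T" "bounded_by M' T'"
  shows "bounded_by (M + M') (\<lambda>x. T x + T' x)"
proof -
  have "hnorm (T x + T' x) \<le> (M + M') * hnorm x" if x: "x \<in> H" for x
  proof -
    have "hnorm (T x + T' x) \<le> hnorm (T x) + hnorm (T' x)"
      using assms x by (intro hnorm_triangle) (auto dest: adjoint_pair_closed)
    also have "\<dots> \<le> M * hnorm x + M' * hnorm x"
      using assms x by (intro add_mono) (auto simp: bounded_by_def)
    finally show ?thesis by (simp add: algebra_simps)
  qed
  then show ?thesis
    using assms by (simp add: bounded_by_def)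
qed

lemma adjoint_pair_sc:
  "adjoint_pair T S \<Longrightarrow> adjoint_pair (\<lambda>x. sc c (T x)) (\<lambda>x. sc (cnj c) (S x))"
  by (auto simp: adjoint_pair_def maps_H_def closed ip_sc_left ip_sc_right sc_zero_right)

lemma bounded_by_sc:
  assumes "adjoint_pair T S" "bounded_by M T"
  shows "bounded_by (cmod c * M) (\<lambda>x. sc c (T x))"
  using assms adjoint_pair_closed[OF assms(1)]
  by (auto simp: bounded_by_def hnorm_sc mult.assoc intro!: mult_left_mono)

lemma adjoint_pair_comp:
  assumes "adjoint_pair T S" "adjoint_pair T' S'"
  shows "adjoint_pair (\<lambda>x. T (T' x)) (\<lambda>x. S' (S x))"
  using assms adjoint_pair_zero_arg[OF assms(1)]
    adjoint_pair_zero_arg[OF adjoint_pair_sym[OF assms(2)]]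
  by (auto simp: adjoint_pair_def maps_H_def)

lemma bounded_by_comp:
  assumes "adjoint_pair T' S'" "bounded_by M T" "bounded_by M' T'"
  shows "bounded_by (M * M') (\<lambda>x. T (T' x))"
proof -
  have "hnorm (T (T' x)) \<le> M * M' * hnorm x" if x: "x \<in> H" for x
  proof -
    have "hnorm (T (T' x)) \<le> M * hnorm (T' x)"
      using assms x by (auto simp: bounded_by_def dest: adjoint_pair_closed)
    also have "\<dots> \<le> M * (M' * hnorm x)"
      using assms x by (intro mult_left_mono) (auto simp: bounded_by_def)
    finally show ?thesis by (simp add: mult.assoc)
  qed
  then show ?thesis
    using assms by (simp add: bounded_by_def)
qed

text \<open>By \<open>maps_H\<close> operators are zero off \<open>H\<close>, so that equality of
  functions is equality of operators on \<open>H\<close>. Hence the unit of the algebra is not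
  \<open>id\<close>.\<close>

definition ident :: "'h \<Rightarrow> 'h" where
  "ident x = (if x \<in> H then x else 0)"

lemma adjoint_pair_ident: "adjoint_pair ident ident"
  by (auto simp: adjoint_pair_def maps_H_def ident_def)

lemma adjoint_pair_zero: "adjoint_pair (\<lambda>_. 0) (\<lambda>_. 0)"
  by (auto simp: adjoint_pair_def maps_H_def zero_closed ip_zero_left ip_zero_right)

section \<open>The C*-algebra of bounded adjointable operators\<close>

definition operator_algebra :: "('h \<Rightarrow> 'h) cstar" where
  "operator_algebra = \<lparr>carrier = operators, mult = (\<lambda>T S x. T (S x)), one = ident,
     zero = (\<lambda>_. 0), add = (\<lambda>T S x. T x + S x),
     cscale = (\<lambda>c T x. sc c (T x)), cadj = adj, cnorm = opnorm\<rparr>"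

lemma operator_algebra_simps [simp]:
  "carrier operator_algebra = operators" "T \<otimes>\<^bsub>operator_algebra\<^esub> S = (\<lambda>x. T (S x))"
  "\<one>\<^bsub>operator_algebra\<^esub> = ident" "\<zero>\<^bsub>operator_algebra\<^esub> = (\<lambda>_. 0)"
  "T \<oplus>\<^bsub>operator_algebra\<^esub> S = (\<lambda>x. T x + S x)"
  "cscale operator_algebra c T = (\<lambda>x. sc c (T x))"
  "cadj operator_algebra T = adj T" "cnorm operator_algebra T = opnorm T"
  by (simp_all add: operator_algebra_def)

lemma operators_add: "T \<in> operators \<Longrightarrow> S \<in> operators \<Longrightarrow> (\<lambda>x. T x + S x) \<in> operators"
  using adjoint_pair_add bounded_by_add unfolding operators_def by blast

lemma operators_sc: "T \<in> operators \<Longrightarrow> (\<lambda>x. sc c (T x)) \<in> operators"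
  using adjoint_pair_sc bounded_by_sc unfolding operators_def by blast

lemma operators_comp: "T \<in> operators \<Longrightarrow> S \<in> operators \<Longrightarrow> (\<lambda>x. T (S x)) \<in> operators"
  using adjoint_pair_comp bounded_by_comp unfolding operators_def by blast

lemma operators_adj: "T \<in> operators \<Longrightarrow> adj T \<in> operators"
  using adjoint_pair_adj adjoint_pair_sym bounded_by_adjoint operators_bounded_by_opnorm
  by (metis operatorsI)

lemma operators_ident: "ident \<in> operators"
  by (rule operatorsI[OF adjoint_pair_ident, of 1]) (simp add: bounded_by_def ident_def)

lemma operators_zero: "(\<lambda>_. 0) \<in> operators"
  by (rule operatorsI[OF adjoint_pair_zero, of 0]) (simp add: bounded_by_def)

lemma operators_minus: "T \<in> operators \<Longrightarrow> (\<lambda>x. - T x) \<in> operators"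
  using operators_sc[of T "- 1"] by (simp add: sc_minus_one)

lemma operators_outside: "T \<in> operators \<Longrightarrow> x \<notin> H \<Longrightarrow> T x = 0"
  using adjoint_pair_adj adjoint_pair_outside by blast

lemma operators_closed: "T \<in> operators \<Longrightarrow> x \<in> H \<Longrightarrow> T x \<in> H"
  using adjoint_pair_adj adjoint_pair_closed by blast

lemma operators_zero_arg: "T \<in> operators \<Longrightarrow> T 0 = 0"
  using adjoint_pair_adj adjoint_pair_zero_arg by blast

lemma operators_arg_closed: "T \<in> operators \<Longrightarrow> T x \<in> H"
  using operators_closed operators_outside zero_closed by metis

lemma operators_add_arg:
  "T \<in> operators \<Longrightarrow> x \<in> H \<Longrightarrow> y \<in> H \<Longrightarrow> T (x + y) = T x + T y"
  using adjoint_pair_adj adjoint_pair_add_arg by blast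

lemma ring_operator_algebra: "ring operator_algebra"
proof (rule ringI)
  show "abelian_group operator_algebra"
  proof (rule abelian_groupI)
    show "\<exists>y\<in>carrier operator_algebra. y \<oplus>\<^bsub>operator_algebra\<^esub> x = \<zero>\<^bsub>operator_algebra\<^esub>"
      if "x \<in> carrier operator_algebra" for x
      using that by (intro bexI[of _ "\<lambda>t. - x t"]) (auto simp: operators_minus)
  qed (auto simp: operators_add operators_zero add_ac)
  show "monoid operator_algebra"
    by (rule monoidI)
       (auto simp: operators_comp operators_ident fun_eq_iff ident_def
         operators_outside operators_closed operators_zero_arg operators_arg_closed)
qed (auto simp: operators_add_arg operators_arg_closed)

lemma operator_algebra_minus:
  assumes "T \<in> operators" and "S \<in> operators"
  shows "T \<ominus>\<^bsub>operator_algebra\<^esub> S = (\<lambda>x. T x - S x)"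
proof -
  interpret ring operator_algebra by (rule ring_operator_algebra)
  have "\<ominus>\<^bsub>operator_algebra\<^esub> S = (\<lambda>x. - S x)"
    by (rule minus_equality) (auto simp: assms operators_minus)
  then show ?thesis by (simp add: a_minus_def)
qed

text \<open>A pointwise limit T alone would come without an adjoint. The adjoints form a Cauchy
  sequence at the same rate, because \<open>bounded_by_adjoint\<close> transfers each bound; their
  pointwise limit S is adjoint to T by continuity of the inner product.\<close>

lemma opnorm_complete:
  assumes s: "range s \<subseteq> operators"
    and Cauchy: "\<And>e. e > 0 \<Longrightarrow> \<exists>N::nat. \<forall>m\<ge>N. \<forall>n\<ge>N. opnorm (\<lambda>x. s m x - s n x) < e"
  obtains T where "T \<in> operators" and "(\<lambda>n. opnorm (\<lambda>x. s n x - T x)) \<longlonglongrightarrow> 0"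
proof -
  have so: "s n \<in> operators" for n
    using s by auto
  have diff: "(\<lambda>x. s m x - s n x) \<in> operators" for m n
    using operators_add[OF so operators_minus[OF so], of m n] by simp
  have hdiff: "hnorm (s m x - s n x) \<le> opnorm (\<lambda>x. s m x - s n x) * hnorm x" if "x \<in> H" for m n x
    using operators_bounded_by_opnorm[OF diff] that by (auto simp: bounded_by_def)
  \<comment> \<open>Stated for an arbitrary sequence u of vectors, since it serves both s n x and
    adj (s n) x.\<close>
  have ex: "\<exists>y\<in>H. (\<lambda>n. hnorm (u n - y)) \<longlonglongrightarrow> 0"
    if x: "x \<in> H" and u: "\<And>n. u n \<in> H"
      and u_diff: "\<And>m n. hnorm (u m - u n) \<le> opnorm (\<lambda>x. s m x - s n x) * hnorm x" for u x
  proof -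
    have "\<exists>y\<in>H. (\<lambda>n. Re (ip (u n - y) (u n - y))) \<longlonglongrightarrow> 0"
    proof (rule ip_complete)
      show "range u \<subseteq> H"
        using u by auto
      fix e :: real
      assume e: "0 < e"
      \<comment> \<open>The summand 1 avoids dividing by a vanishing norm.\<close>
      define e' where "e' = sqrt e / (hnorm x + 1)"
      have e': "0 < e'"
        using e hnorm_nonneg[OF x] by (auto simp: e'_def intro!: divide_pos_pos)
      then obtain N where N: "\<forall>m\<ge>N. \<forall>n\<ge>N. opnorm (\<lambda>x. s m x - s n x) < e'"
        using Cauchy by blast
      have "Re (ip (u m - u n) (u m - u n)) < e" if "m \<ge> N" "n \<ge> N" for m n
      proof -
        have "hnorm (u m - u n) \<le> opnorm (\<lambda>x. s m x - s n x) * hnorm x"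
          by (rule u_diff)
        also have "\<dots> \<le> e' * hnorm x"
          using N that hnorm_nonneg[OF x] by (intro mult_right_mono) (auto intro: less_imp_le)
        also have "\<dots> < e' * (hnorm x + 1)"
          using e' by simp
        also have "\<dots> = sqrt e"
          using hnorm_nonneg[OF x] by (simp add: e'_def)
        finally show ?thesis
          by (simp add: hnorm_def)
      qed
      then show "\<exists>N. \<forall>m\<ge>N. \<forall>n\<ge>N. Re (ip (u m - u n) (u m - u n)) < e"
        by blast
    qed
    then obtain y where "y \<in> H" "(\<lambda>n. Re (ip (u n - y) (u n - y))) \<longlonglongrightarrow> 0"
      by blast
    then show ?thesis
      unfolding hnorm_def using tendsto_real_sqrt[of _ 0] by fastforce
  qed
  define T where "T x = (if x \<in> H then SOME y. y \<in> H \<and> (\<lambda>n. hnorm (s n x - y)) \<longlonglongrightarrow> 0 else 0)" for x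
  have T: "T x \<in> H" "(\<lambda>n. hnorm (s n x - T x)) \<longlonglongrightarrow> 0" if "x \<in> H" for x
    using someI_ex[of "\<lambda>y. y \<in> H \<and> (\<lambda>n. hnorm (s n x - y)) \<longlonglongrightarrow> 0"] ex[OF that _ hdiff] that so
    by (auto simp: T_def operators_arg_closed)
  have T_bound: "bounded_by e (\<lambda>x. s m x - T x)"
    if N: "\<forall>m\<ge>N. \<forall>n\<ge>N. opnorm (\<lambda>x. s m x - s n x) < e" "m \<ge> N" and e: "0 < e" for N m e
  proof -
    have "hnorm (s m x - T x) \<le> e * hnorm x" if x: "x \<in> H" for x
    proof (rule LIMSEQ_le_const)
      show "(\<lambda>n. e * hnorm x + hnorm (s n x - T x)) \<longlonglongrightarrow> e * hnorm x"
        using tendsto_add[OF tendsto_const T(2)[OF x], of "e * hnorm x"] by simp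
      have "hnorm (s m x - T x) \<le> e * hnorm x + hnorm (s n x - T x)" if "n \<ge> N" for n
      proof -
        have "hnorm (s m x - T x) \<le> hnorm (s m x - s n x) + hnorm (s n x - T x)"
          using hnorm_triangle[of "s m x - s n x" "s n x - T x"] T(1)[OF x] so
          by (simp add: closed operators_arg_closed)
        also have "hnorm (s m x - s n x) \<le> opnorm (\<lambda>x. s m x - s n x) * hnorm x"
          by (rule hdiff[OF x])
        also have "\<dots> \<le> e * hnorm x"
          using N that hnorm_nonneg[OF x] by (intro mult_right_mono) (auto intro: less_imp_le)
        finally show ?thesis by simp
      qed
      then show "\<exists>N. \<forall>n\<ge>N. hnorm (s m x - T x) \<le> e * hnorm x + hnorm (s n x - T x)"
        by blast
    qed
    then show ?thesis
      using e by (simp add: bounded_by_def)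
  qed
  have adj_diff: "hnorm (adj (s m) x - adj (s n) x) \<le> opnorm (\<lambda>x. s m x - s n x) * hnorm x"
    if "x \<in> H" for m n x
  proof -
    have "adjoint_pair (\<lambda>x. s m x - s n x) (\<lambda>x. adj (s m) x - adj (s n) x)"
      using adjoint_pair_add[OF adjoint_pair_adj[OF so] adjoint_pair_sc[OF adjoint_pair_adj[OF so]],
          of m "- 1" n]
      by (simp add: sc_minus_one)
    then have "bounded_by (opnorm (\<lambda>x. s m x - s n x)) (\<lambda>x. adj (s m) x - adj (s n) x)"
      by (rule bounded_by_adjoint) (rule operators_bounded_by_opnorm[OF diff])
    then show ?thesis
      using that by (auto simp: bounded_by_def)
  qed
  define S where "S x = (if x \<in> H then SOME y. y \<in> H \<and> (\<lambda>n. hnorm (adj (s n) x - y)) \<longlonglongrightarrow> 0 else 0)" for x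
  have S: "S x \<in> H" "(\<lambda>n. hnorm (adj (s n) x - S x)) \<longlonglongrightarrow> 0" if "x \<in> H" for x
    using someI_ex[of "\<lambda>y. y \<in> H \<and> (\<lambda>n. hnorm (adj (s n) x - y)) \<longlonglongrightarrow> 0"] ex[OF that _ adj_diff] that so
    by (auto simp: S_def operators_arg_closed operators_adj)
  have lim: "(\<lambda>n. ip (u n) z) \<longlonglongrightarrow> ip v z"
    if "\<And>n. u n \<in> H" "v \<in> H" "z \<in> H" "(\<lambda>n. hnorm (u n - v)) \<longlonglongrightarrow> 0" for u v z
  proof (rule LIM_zero_cancel, rule Lim_null_comparison)
    show "(\<lambda>n. hnorm (u n - v) * hnorm z) \<longlonglongrightarrow> 0"
      using tendsto_mult_left_zero[OF that(4)] .
    show "\<forall>\<^sub>F n in sequentially. norm (ip (u n) z - ip v z) \<le> hnorm (u n - v) * hnorm z"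
      using Cauchy_Schwarz[of "u _ - v" z] that by (intro always_eventually) (simp add: closed ip_diff_left)
  qed
  have "adjoint_pair T S"
  proof -
    have "ip (T x) y = ip x (S y)" if xy: "x \<in> H" "y \<in> H" for x y
    proof (rule LIMSEQ_unique)
      show "(\<lambda>n. ip (s n x) y) \<longlonglongrightarrow> ip (T x) y"
        using T[OF xy(1)] xy so by (intro lim) (auto simp: operators_arg_closed)
      have "(\<lambda>n. ip (adj (s n) y) x) \<longlonglongrightarrow> ip (S y) x"
        using S[OF xy(2)] xy so by (intro lim) (auto simp: operators_arg_closed operators_adj)
      then have "(\<lambda>n. cnj (ip (adj (s n) y) x)) \<longlonglongrightarrow> cnj (ip (S y) x)"
        by (rule tendsto_cnj)
      moreover have "cnj (ip (adj (s n) y) x) = ip (s n x) y" for n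
        using adjoint_pair_ip[OF adjoint_pair_adj[OF so] xy, of n] ip_cnj[of "adj (s n) y" x] xy so
        by (simp add: operators_arg_closed operators_adj)
      moreover have "cnj (ip (S y) x) = ip x (S y)"
        using ip_cnj[of "S y" x] S(1) xy by simp
      ultimately show "(\<lambda>n. ip (s n x) y) \<longlonglongrightarrow> ip x (S y)"
        by simp
    qed
    then show ?thesis
      using T(1) S(1) by (auto simp: adjoint_pair_def maps_H_def T_def S_def)
  qed
  moreover have "\<exists>M. bounded_by M T"
  proof -
    obtain N where N: "\<forall>m\<ge>N. \<forall>n\<ge>N. opnorm (\<lambda>x. s m x - s n x) < 1"
      using Cauchy[of 1] by auto
    have b1: "bounded_by 1 (\<lambda>x. s N x - T x)"
      using T_bound[OF N order_refl] by simp
    have "hnorm (T x) \<le> (opnorm (s N) + 1) * hnorm x" if x: "x \<in> H" for x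
    proof -
      have "hnorm (T x) \<le> hnorm (s N x) + hnorm (s N x - T x)"
        using hnorm_triangle[of "s N x" "- (s N x - T x)"] hnorm_minus[of "s N x - T x"]
          T(1)[OF x] so[of N]
        by (simp add: closed operators_arg_closed)
      also have "\<dots> \<le> opnorm (s N) * hnorm x + 1 * hnorm x"
        using b1 operators_bounded_by_opnorm[OF so[of N]] x
        unfolding bounded_by_def by (intro add_mono) auto
      finally show ?thesis by (simp add: algebra_simps)
    qed
    moreover have "0 \<le> opnorm (s N)"
      using operators_bounded_by_opnorm[OF so[of N]] by (simp add: bounded_by_def)
    ultimately show ?thesis
      by (intro exI[of _ "opnorm (s N) + 1"]) (simp add: bounded_by_def)
  qed
  ultimately have To: "T \<in> operators"
    by (auto simp: operators_def)
  moreover have "(\<lambda>n. opnorm (\<lambda>x. s n x - T x)) \<longlonglongrightarrow> 0"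
  proof (rule LIMSEQ_I)
    fix e :: real
    assume e: "0 < e"
    obtain N where N: "\<forall>m\<ge>N. \<forall>n\<ge>N. opnorm (\<lambda>x. s m x - s n x) < e / 2"
      using Cauchy[of "e / 2"] e by auto
    have "norm (opnorm (\<lambda>x. s m x - T x) - 0) < e" if "m \<ge> N" for m
    proof -
      have b: "bounded_by (e / 2) (\<lambda>x. s m x - T x)"
        using T_bound[OF N that] e by simp
      show ?thesis
        using opnorm_le[OF b] opnorm_nonneg[OF b] e by simp
    qed
    then show "\<exists>no. \<forall>n\<ge>no. norm (opnorm (\<lambda>x. s n x - T x) - 0) < e"
      by blast
  qed
  ultimately show ?thesis
    using that by blast
qed

text \<open>The C*-identity. The substantial inequality comes from the square of hnorm (T x) being
  ip x (adj T (T x)), hence at most K times the square of hnorm x.\<close>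

lemma opnorm_adj_comp:
  assumes "T \<in> operators"
  shows "opnorm (\<lambda>x. adj T (T x)) = (opnorm T)\<^sup>2"
proof (rule antisym)
  note pair = adjoint_pair_adj[OF assms]
  note bT = operators_bounded_by_opnorm[OF assms]
  have "bounded_by (opnorm T * opnorm T) (\<lambda>x. adj T (T x))"
    by (rule bounded_by_comp[OF pair bounded_by_adjoint[OF pair bT] bT])
  then show "opnorm (\<lambda>x. adj T (T x)) \<le> (opnorm T)\<^sup>2"
    unfolding power2_eq_square by (rule opnorm_le)
  define K where "K = opnorm (\<lambda>x. adj T (T x))"
  have bK: "bounded_by K (\<lambda>x. adj T (T x))"
    unfolding K_def
    by (rule operators_bounded_by_opnorm[OF operators_comp[OF operators_adj[OF assms] assms]])
  have "hnorm (T x) \<le> sqrt K * hnorm x" if x: "x \<in> H" for x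
  proof -
    have Tx: "T x \<in> H" "adj T (T x) \<in> H"
      using assms by (auto simp: operators_arg_closed operators_adj)
    have "(hnorm (T x))\<^sup>2 = Re (ip x (adj T (T x)))"
      using adjoint_pair_ip[OF pair x Tx(1)] Tx by (simp add: hnorm_power2)
    also have "\<dots> \<le> hnorm x * hnorm (adj T (T x))"
      using Cauchy_Schwarz[OF x Tx(2)] complex_Re_le_cmod[of "ip x (adj T (T x))"] by linarith
    also have "\<dots> \<le> hnorm x * (K * hnorm x)"
      using bK x hnorm_nonneg[OF x] by (intro mult_left_mono) (auto simp: bounded_by_def)
    finally have "(hnorm (T x))\<^sup>2 \<le> (sqrt K * hnorm x)\<^sup>2"
      using bK by (simp add: bounded_by_def power_mult_distrib) (simp add: power2_eq_square mult_ac)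
    then show ?thesis
      by (rule power2_le_imp_le) (use bK hnorm_nonneg[OF x] in \<open>simp add: bounded_by_def\<close>)
  qed
  then have "bounded_by (sqrt K) T"
    using bK by (simp add: bounded_by_def)
  then have "opnorm T \<le> sqrt K"
    by (rule opnorm_le)
  then have "(opnorm T)\<^sup>2 \<le> (sqrt K)\<^sup>2"
    using opnorm_nonneg[OF bT] by (intro power_mono)
  then show "(opnorm T)\<^sup>2 \<le> opnorm (\<lambda>x. adj T (T x))"
    using bK by (simp add: bounded_by_def K_def)
qed

lemma opnorm_sc_le: "T \<in> operators \<Longrightarrow> opnorm (\<lambda>x. sc c (T x)) \<le> cmod c * opnorm T"
  by (rule opnorm_le, rule bounded_by_sc[OF adjoint_pair_adj])
     (auto intro: operators_bounded_by_opnorm)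

lemma opnorm_eq_0_iff: "T \<in> operators \<Longrightarrow> opnorm T = 0 \<longleftrightarrow> T = (\<lambda>_. 0)"
proof
  assume T: "T \<in> operators" and 0: "opnorm T = 0"
  have "T x = 0" for x
  proof (cases "x \<in> H")
    case True
    have "hnorm (T x) \<le> 0"
      using operators_bounded_by_opnorm[OF T] True 0 by (auto simp: bounded_by_def)
    then show ?thesis
      using hnorm_nonneg[of "T x"] hnorm_eq_0[of "T x"] operators_closed[OF T True] by simp
  qed (use T operators_outside in auto)
  then show "T = (\<lambda>_. 0)" by auto
next
  assume T: "T \<in> operators" and T0: "T = (\<lambda>_. 0)"
  have "bounded_by 0 T"
    by (simp add: T0 bounded_by_def)
  then show "opnorm T = 0"
    using opnorm_le opnorm_nonneg by (metis antisym)
qed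

lemma opnorm_sc:
  assumes T: "T \<in> operators"
  shows "opnorm (\<lambda>x. sc c (T x)) = cmod c * opnorm T"
proof (cases "c = 0")
  case True
  then show ?thesis
    using opnorm_eq_0_iff[OF operators_zero] by (simp add: sc_zero_left)
next
  case False
  have "opnorm T \<le> cmod (inverse c) * opnorm (\<lambda>x. sc c (T x))"
    using opnorm_sc_le[OF operators_sc[OF T], of "inverse c" c] False by (simp add: sc_sc sc_one)
  then have "cmod c * opnorm T \<le> opnorm (\<lambda>x. sc c (T x))"
    using False by (simp add: norm_divide divide_inverse norm_inverse flip: pos_le_divide_eq) (simp add: field_simps)
  then show ?thesis
    using opnorm_sc_le[OF T, of c] by simp
qed

lemma carrier_cstar_algebra_operators: "carrier_cstar_algebra operator_algebra"
proof (intro carrier_cstar_algebra.intro ring_operator_algebra carrier_cstar_algebra_axioms.intro,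
    unfold operator_algebra_simps)
  fix x y :: "'h \<Rightarrow> 'h" and b c :: complex
  assume x: "x \<in> operators"
  note px = adjoint_pair_adj[OF x] and bx = operators_bounded_by_opnorm[OF x]
  show "(\<lambda>t. sc c (x t)) \<in> operators" "adj x \<in> operators"
    using x by (simp_all add: operators_sc operators_adj)
  show "(\<lambda>t. sc (b + c) (x t)) = (\<lambda>t. sc b (x t) + sc c (x t))"
    "(\<lambda>t. sc b (sc c (x t))) = (\<lambda>t. sc (b * c) (x t))" "(\<lambda>t. sc 1 (x t)) = x"
    by (simp_all add: sc_add_left sc_sc sc_one)
  show "adj (\<lambda>t. sc c (x t)) = (\<lambda>t. sc (cnj c) (adj x t))"
    by (rule adj_eq[OF adjoint_pair_sc[OF px]])
  show "adj (adj x) = x"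
    by (rule adj_eq[OF adjoint_pair_sym[OF px]])
  show "0 \<le> opnorm x"
    by (rule opnorm_nonneg[OF bx])
  show "opnorm x = 0 \<longleftrightarrow> x = (\<lambda>_. 0)"
    by (rule opnorm_eq_0_iff[OF x])
  show "opnorm (\<lambda>t. sc c (x t)) = cmod c * opnorm x"
    by (rule opnorm_sc[OF x])
  show "opnorm (\<lambda>t. adj x (x t)) = (opnorm x)\<^sup>2"
    by (rule opnorm_adj_comp[OF x])
  assume y: "y \<in> operators"
  note py = adjoint_pair_adj[OF y] and by' = operators_bounded_by_opnorm[OF y]
  show "(\<lambda>t. sc c (x t + y t)) = (\<lambda>t. sc c (x t) + sc c (y t))"
    by (simp add: sc_add_right)
  show "(\<lambda>t. sc c (x (y t))) = (\<lambda>t. sc c (x (y t)))" ..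
  show "(\<lambda>t. x (sc c (y t))) = (\<lambda>t. sc c (x (y t)))"
    using adjoint_pair_sc_arg[OF px] y by (auto simp: operators_arg_closed)
  show "adj (\<lambda>t. x t + y t) = (\<lambda>t. adj x t + adj y t)"
    by (rule adj_eq[OF adjoint_pair_add[OF px py]])
  show "adj (\<lambda>t. x (y t)) = (\<lambda>t. adj y (adj x t))"
    by (rule adj_eq[OF adjoint_pair_comp[OF px py]])
  show "opnorm (\<lambda>t. x t + y t) \<le> opnorm x + opnorm y"
    by (rule opnorm_le[OF bounded_by_add[OF px py bx by']])
  show "opnorm (\<lambda>t. x (y t)) \<le> opnorm x * opnorm y"
    by (rule opnorm_le[OF bounded_by_comp[OF py bx by']])
next
  fix s :: "nat \<Rightarrow> 'h \<Rightarrow> 'h"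
  assume s: "range s \<subseteq> operators"
    and C: "\<And>e. 0 < e \<Longrightarrow> \<exists>N. \<forall>m\<ge>N. \<forall>n\<ge>N. opnorm (s m \<ominus>\<^bsub>operator_algebra\<^esub> s n) < e"
  have so: "s n \<in> operators" for n
    using s by auto
  obtain T where T: "T \<in> operators" "(\<lambda>n. opnorm (\<lambda>x. s n x - T x)) \<longlonglongrightarrow> 0"
    using opnorm_complete[OF s] C by (auto simp: operator_algebra_minus so)
  then show "\<exists>x\<in>operators. (\<lambda>n. opnorm (s n \<ominus>\<^bsub>operator_algebra\<^esub> x)) \<longlonglongrightarrow> 0"
    by (intro bexI[of _ T]) (simp_all add: operator_algebra_minus so)
qed

end

section \<open>Reproducing kernel Hilbert spaces\<close>

text \<open>The list \<open>[(c\<^sub>1, p\<^sub>1), \<dots>, (c\<^sub>n, p\<^sub>n)]\<close> stands for the formal combination \<open>c\<^sub>1 p\<^sub>1 + \<dots> + c\<^sub>n p\<^sub>n\<close>.\<close>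

definition ev :: "('k \<Rightarrow> complex) \<Rightarrow> (complex \<times> 'k) list \<Rightarrow> complex" where
  "ev f xs = (\<Sum>(c, p)\<leftarrow>xs. c * f p)"

definition list_scale :: "complex \<Rightarrow> (complex \<times> 'k) list \<Rightarrow> (complex \<times> 'k) list" where
  "list_scale b xs = map (\<lambda>(c, p). (b * c, p)) xs"

definition list_push :: "('k \<Rightarrow> 'l) \<Rightarrow> (complex \<times> 'k) list \<Rightarrow> (complex \<times> 'l) list" where
  "list_push \<phi> xs = map (\<lambda>(c, p). (c, \<phi> p)) xs"

lemma ev_simps [simp]: "ev f [] = 0" "ev f ((c, p) # xs) = c * f p + ev f xs"
  by (simp_all add: ev_def)

lemma ev_append: "ev f (xs @ ys) = ev f xs + ev f ys"
  by (simp add: ev_def)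

lemma ev_scale: "ev f (list_scale c xs) = c * ev f xs"
  by (induction xs) (auto simp: list_scale_def algebra_simps)

lemma ev_push: "ev f (list_push \<phi> xs) = ev (f \<circ> \<phi>) xs"
  by (induction xs) (auto simp: list_push_def)

lemma ev_add: "ev (f + g) xs = ev f xs + ev g xs"
  by (induction xs) (auto simp: algebra_simps)

lemma ev_diff: "ev (f - g) xs = ev f xs - ev g xs"
  by (induction xs) (auto simp: algebra_simps)

lemma ev_mult: "ev (\<lambda>p. c * f p) xs = c * ev f xs"
  by (induction xs) (auto simp: algebra_simps)

lemma ev_zero: "ev 0 xs = 0"
  by (induction xs) auto

text \<open>The conjugate makes \<open>kernel_hat k ys\<close> the vector that represents the
  functional f \<mapsto> \<open>ev f ys\<close> (see \<open>ip_hat\<close>); it is conjugate linear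
  in \<open>ys\<close>. For a hermitian kernel it is p \<mapsto> \<Sum> cnj c * k p q.\<close>

definition kernel_hat :: "('k \<Rightarrow> 'k \<Rightarrow> complex) \<Rightarrow> (complex \<times> 'k) list \<Rightarrow> 'k \<Rightarrow> complex" where
  "kernel_hat k ys = (\<lambda>p. cnj (ev (\<lambda>q. k q p) ys))"

definition kernel_form ::
    "('k \<Rightarrow> 'k \<Rightarrow> complex) \<Rightarrow> (complex \<times> 'k) list \<Rightarrow> (complex \<times> 'k) list \<Rightarrow> complex" where
  "kernel_form k xs ys = ev (kernel_hat k ys) xs"

locale positive_kernel =
  fixes k :: "'k \<Rightarrow> 'k \<Rightarrow> complex"
  assumes kernel_cnj: "k q p = cnj (k p q)"
    and kernel_nonneg: "0 \<le> Re (kernel_form k xs xs)"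
begin

abbreviation "hat \<equiv> kernel_hat k"
abbreviation "B \<equiv> kernel_form k"
abbreviation "Q xs \<equiv> Re (kernel_form k xs xs)"

lemma hat_append: "hat (xs @ ys) = hat xs + hat ys"
  by (simp add: kernel_hat_def ev_append fun_eq_iff)

lemma hat_scale: "hat (list_scale c xs) = (\<lambda>p. cnj c * hat xs p)"
  by (simp add: kernel_hat_def ev_scale fun_eq_iff)

lemma B_cnj: "B ys xs = cnj (B xs ys)"
proof (induction xs)
  case Nil
  have "hat [] = 0"
    by (simp add: kernel_hat_def fun_eq_iff)
  then show ?case
    by (simp add: kernel_form_def ev_zero)
next
  case (Cons cp xs)
  obtain c p where cp: "cp = (c, p)" by fastforce
  have "hat (cp # xs) = (\<lambda>q. cnj c * k q p) + hat xs"
    by (simp add: kernel_hat_def cp fun_eq_iff kernel_cnj[symmetric])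
  then have "B ys (cp # xs) = cnj c * ev (\<lambda>q. k q p) ys + B ys xs"
    by (simp add: kernel_form_def ev_add ev_mult)
  then show ?case
    using Cons by (simp add: kernel_form_def cp kernel_hat_def)
qed

lemma Q_append: "Q (xs @ ys) = Q xs + Q ys + 2 * Re (B xs ys)"
  using B_cnj[of xs ys] by (simp add: kernel_form_def ev_append hat_append ev_add)

lemma Q_scale: "Q (list_scale c xs) = (cmod c)\<^sup>2 * Q xs"
proof -
  have "B (list_scale c xs) (list_scale c xs) = (c * cnj c) * B xs xs"
    by (simp add: kernel_form_def ev_scale hat_scale ev_mult mult_ac)
  then show ?thesis
    by (simp only: complex_norm_square[symmetric]) simp
qed

lemma B_scale_right: "B xs (list_scale c ys) = cnj c * B xs ys"
  by (simp add: kernel_form_def hat_scale ev_mult)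

lemma Q_diff: "Q (xs @ list_scale (- 1) ys) = Q xs + Q ys - 2 * Re (B xs ys)"
  unfolding Q_append Q_scale by (simp add: B_scale_right)

text \<open>The squared norm, by the duality \<open>norm f\<close>^2 = sup (2 Re <f, h> -
  \<open>norm h\<close>^2) over the finite combinations h of kernel functions. Taking for
  \<open>H\<close> all functions with finite supremum gives a complete space at once, without
  completing a quotient.\<close>

definition N :: "('k \<Rightarrow> complex) \<Rightarrow> real" where
  "N f = (SUP xs. 2 * Re (ev f xs) - Q xs)"

definition H :: "('k \<Rightarrow> complex) set" where
  "H = {f. bdd_above (range (\<lambda>xs. 2 * Re (ev f xs) - Q xs))}"

lemma N_upper: "f \<in> H \<Longrightarrow> 2 * Re (ev f xs) - Q xs \<le> N f"
  unfolding N_def H_def by (rule cSUP_upper) auto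

lemma N_nonneg: "f \<in> H \<Longrightarrow> 0 \<le> N f"
  using N_upper[of f "[]"] by (simp add: kernel_form_def)

text \<open>Applying the bound of the supremum to all multiples of \<open>xs\<close> turns it into a
  discriminant. Together with \<open>N_le\<close> this says that N f is the least C \<ge> 0 with |ev
  f xs|^2 \<le> C * Q xs for all \<open>xs\<close>.\<close>

lemma ev_le:
  assumes "f \<in> H"
  shows "(cmod (ev f xs))\<^sup>2 \<le> N f * Q xs"
proof (rule quadratic_nonneg_cmod)
  show "0 \<le> N f + 2 * Re (t * ev f xs) + (cmod t)\<^sup>2 * Q xs" for t
    using N_upper[OF assms, of "list_scale (- t) xs"] by (simp add: ev_scale Q_scale)
qed (rule kernel_nonneg)

lemma
  assumes "0 \<le> C" and "\<And>xs. (cmod (ev f xs))\<^sup>2 \<le> C * Q xs"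
  shows H_intro: "f \<in> H" and N_le: "N f \<le> C"
proof -
  have le: "2 * Re (ev f xs) - Q xs \<le> C" for xs
  proof -
    have "cmod (ev f xs) \<le> sqrt (C * Q xs)"
      using assms(2) by (rule real_le_rsqrt)
    also have "\<dots> \<le> (C + Q xs) / 2"
      using assms(1) kernel_nonneg by (rule arith_geo_mean_sqrt)
    finally show ?thesis
      using complex_Re_le_cmod[of "ev f xs"] by simp
  qed
  then show "f \<in> H"
    unfolding H_def by (auto intro!: bdd_aboveI)
  show "N f \<le> C"
    unfolding N_def by (rule cSUP_least) (use le in auto)
qed

definition rnorm :: "('k \<Rightarrow> complex) \<Rightarrow> real" where
  "rnorm f = sqrt (N f)"

lemma rnorm_nonneg: "f \<in> H \<Longrightarrow> 0 \<le> rnorm f"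
  by (simp add: rnorm_def N_nonneg)

lemma rnorm_power2: "f \<in> H \<Longrightarrow> (rnorm f)\<^sup>2 = N f"
  by (simp add: rnorm_def N_nonneg)

lemma cmod_ev_le: "f \<in> H \<Longrightarrow> cmod (ev f xs) \<le> rnorm f * sqrt (Q xs)"
  using ev_le[of f xs] by (simp add: rnorm_def real_le_rsqrt flip: real_sqrt_mult)

lemma cmod_eval_le: "f \<in> H \<Longrightarrow> cmod (f p) \<le> rnorm f * sqrt (Q [(1, p)])"
  using cmod_ev_le[of f "[(1, p)]"] by simp

lemma
  assumes "0 \<le> M" and "\<And>xs. cmod (ev f xs) \<le> M * sqrt (Q xs)"
  shows H_intro_rnorm: "f \<in> H" and rnorm_le: "rnorm f \<le> M"
proof -
  have "(cmod (ev f xs))\<^sup>2 \<le> M\<^sup>2 * Q xs" for xs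
    using power_mono[OF assms(2), of xs 2] kernel_nonneg by (simp add: power_mult_distrib)
  then have "f \<in> H" "N f \<le> M\<^sup>2"
    using H_intro[of "M\<^sup>2" f] N_le[of "M\<^sup>2" f] by auto
  then show "f \<in> H" "rnorm f \<le> M"
    using assms(1) by (simp_all add: rnorm_def real_le_lsqrt)
qed

lemma
  assumes "f \<in> H" and "g \<in> H"
  shows H_add: "f + g \<in> H" and rnorm_triangle: "rnorm (f + g) \<le> rnorm f + rnorm g"
proof -
  have "cmod (ev (f + g) xs) \<le> (rnorm f + rnorm g) * sqrt (Q xs)" for xs
    using norm_triangle_ineq[of "ev f xs" "ev g xs"] cmod_ev_le[OF assms(1), of xs]
      cmod_ev_le[OF assms(2), of xs]
    by (simp add: ev_add distrib_right)
  then show "f + g \<in> H" "rnorm (f + g) \<le> rnorm f + rnorm g"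
    using assms rnorm_nonneg H_intro_rnorm[of "rnorm f + rnorm g"] rnorm_le[of "rnorm f + rnorm g"]
    by auto
qed

lemma
  assumes "f \<in> H"
  shows H_mult: "(\<lambda>p. c * f p) \<in> H" and rnorm_mult: "rnorm (\<lambda>p. c * f p) = cmod c * rnorm f"
proof -
  have le: "(\<lambda>p. b * g p) \<in> H \<and> rnorm (\<lambda>p. b * g p) \<le> cmod b * rnorm g" if "g \<in> H" for b g
  proof -
    have "cmod (ev (\<lambda>p. b * g p) xs) \<le> (cmod b * rnorm g) * sqrt (Q xs)" for xs
      using mult_left_mono[OF cmod_ev_le[OF that, of xs], of "cmod b"]
      by (simp add: ev_mult norm_mult mult.assoc)
    then show ?thesis
      using rnorm_nonneg[OF that] H_intro_rnorm[of "cmod b * rnorm g"] rnorm_le[of "cmod b * rnorm g"]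
      by auto
  qed
  then show "(\<lambda>p. c * f p) \<in> H"
    using assms by blast
  show "rnorm (\<lambda>p. c * f p) = cmod c * rnorm f"
  proof (cases "c = 0")
    case True
    then show ?thesis
      using le[OF assms, of 0] rnorm_nonneg[of "\<lambda>_. 0"] by simp
  next
    case False
    then have "rnorm f \<le> cmod (inverse c) * rnorm (\<lambda>p. c * f p)"
      using le[of "\<lambda>p. c * f p" "inverse c"] le[OF assms, of c] by (simp flip: mult.assoc)
    then have "cmod c * rnorm f \<le> cmod c * (cmod (inverse c) * rnorm (\<lambda>p. c * f p))"
      by (rule mult_left_mono) simp
    also have "\<dots> = rnorm (\<lambda>p. c * f p)"
      using False by (simp add: norm_inverse flip: mult.assoc)
    finally show ?thesis
      using le[OF assms, of c] by simp
  qed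
qed

lemma H_zero: "0 \<in> H"
  by (rule H_intro[of 0]) (simp_all add: ev_zero)

lemma uminus_fun_mult: "- f = (\<lambda>p. - 1 * f p)" for f :: "'k \<Rightarrow> complex"
  by (simp add: fun_eq_iff)

lemma H_minus: "f \<in> H \<Longrightarrow> - f \<in> H" and rnorm_minus: "f \<in> H \<Longrightarrow> rnorm (- f) = rnorm f"
  unfolding uminus_fun_mult by (simp_all only: H_mult rnorm_mult) simp

lemma H_diff: "f \<in> H \<Longrightarrow> g \<in> H \<Longrightarrow> f - g \<in> H"
  using H_add[of f "- g"] H_minus by simp

lemma rnorm_minus_commute: "f \<in> H \<Longrightarrow> g \<in> H \<Longrightarrow> rnorm (f - g) = rnorm (g - f)"
  using rnorm_minus[of "f - g"] H_diff by simp

lemma rnorm_diff_le: "f \<in> H \<Longrightarrow> g \<in> H \<Longrightarrow> \<bar>rnorm f - rnorm g\<bar> \<le> rnorm (f - g)"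
  using rnorm_triangle[of "f - g" g] rnorm_triangle[of "g - f" f] H_diff[of f g] H_diff[of g f]
    rnorm_minus_commute[of f g] by simp

lemma rnorm_eq_0: "f \<in> H \<Longrightarrow> rnorm f = 0 \<Longrightarrow> f = 0"
  using cmod_eval_le[of f] by (simp add: fun_eq_iff)

lemma tendsto_N:
  assumes "\<And>n. u n \<in> H" and "f \<in> H" and "(\<lambda>n. rnorm (u n - f)) \<longlonglongrightarrow> 0"
  shows "(\<lambda>n. N (u n)) \<longlonglongrightarrow> N f"
proof -
  have "(\<lambda>n. rnorm (u n)) \<longlonglongrightarrow> rnorm f"
    by (rule LIM_zero_cancel, rule Lim_null_comparison[OF _ assms(3)])
       (simp add: assms rnorm_diff_le)
  then have "(\<lambda>n. (rnorm (u n))\<^sup>2) \<longlonglongrightarrow> (rnorm f)\<^sup>2"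
    by (rule tendsto_power)
  then show ?thesis
    by (simp add: assms rnorm_power2)
qed

lemma hat_in_H: "hat xs \<in> H"
proof (rule H_intro)
  have "(cmod (B ys xs))\<^sup>2 \<le> Q xs * Q ys" for ys
  proof (rule quadratic_nonneg_cmod)
    show "0 \<le> Q xs + 2 * Re (t * B ys xs) + (cmod t)\<^sup>2 * Q ys" for t
      using kernel_nonneg[of "xs @ list_scale t ys"] B_cnj[of xs ys]
      unfolding Q_append Q_scale by (simp add: B_scale_right)
  qed (rule kernel_nonneg)
  then show "(cmod (ev (hat xs) ys))\<^sup>2 \<le> Q xs * Q ys" for ys
    by (simp add: kernel_form_def)
qed (rule kernel_nonneg)

text \<open>Completing the square in the supremum defining \<open>N\<close>.\<close>

lemma N_add_hat:
  assumes "f \<in> H"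
  shows "N (f + hat xs) = N f + 2 * Re (ev f xs) + Q xs"
proof -
  have le: "N (g + hat zs) \<le> N g + 2 * Re (ev g zs) + Q zs" if "g \<in> H" for g zs
    unfolding N_def[of "g + hat zs"]
  proof (rule cSUP_least)
    fix ys :: "(complex \<times> 'k) list"
    show "2 * Re (ev (g + hat zs) ys) - Q ys \<le> N g + 2 * Re (ev g zs) + Q zs"
      using N_upper[OF that, of "ys @ list_scale (- 1) zs"] Q_diff[of ys zs]
      by (simp add: ev_append ev_scale ev_add kernel_form_def)
  qed simp
  have "f + hat xs + hat (list_scale (- 1) xs) = f"
    by (simp add: hat_scale fun_eq_iff)
  then have "N f \<le> N (f + hat xs) - 2 * Re (ev (f + hat xs) xs) + Q xs"
    using le[of "f + hat xs" "list_scale (- 1) xs"] H_add[OF assms hat_in_H]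
    by (simp add: ev_scale Q_scale add.assoc)
  then show ?thesis
    using le[OF assms, of xs] by (simp add: ev_add kernel_form_def)
qed

text \<open>By \<open>N_add_hat\<close>, N (f - hat xs) = N f - (2 Re (ev f xs) - Q xs), so lists
  that nearly attain the supremum approximate f.\<close>

lemma hat_dense:
  assumes "f \<in> H"
  obtains X where "(\<lambda>n. rnorm (hat (X n) - f)) \<longlonglongrightarrow> 0"
proof -
  have "\<exists>xs. N (f - hat xs) < inverse (Suc n)" for n
  proof -
    have "\<exists>xs. N f - inverse (Suc n) < 2 * Re (ev f xs) - Q xs"
      using less_cSUP_iff[of UNIV "\<lambda>xs. 2 * Re (ev f xs) - Q xs" "N f - inverse (Suc n)"] assms
      by (auto simp: H_def N_def)
    then obtain xs where "N f - inverse (Suc n) < 2 * Re (ev f xs) - Q xs" ..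
    moreover have "f - hat xs = f + hat (list_scale (- 1) xs)"
      by (simp add: hat_scale fun_eq_iff)
    then have "N (f - hat xs) = N f - 2 * Re (ev f xs) + Q xs"
      by (simp only: N_add_hat[OF assms]) (simp add: ev_scale Q_scale)
    ultimately show ?thesis
      by (intro exI[of _ xs]) simp
  qed
  then obtain X where X: "N (f - hat (X n)) < inverse (Suc n)" for n
    by metis
  have "(\<lambda>n. N (f - hat (X n))) \<longlonglongrightarrow> 0"
    by (rule tendsto_sandwich[OF _ _ tendsto_const LIMSEQ_inverse_real_of_nat])
       (use X N_nonneg[OF H_diff[OF assms hat_in_H]] in \<open>auto intro!: always_eventually less_imp_le\<close>)
  then have "(\<lambda>n. rnorm (f - hat (X n))) \<longlonglongrightarrow> 0"
    unfolding rnorm_def using tendsto_real_sqrt by fastforce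
  then show ?thesis
    using that by (simp add: rnorm_minus_commute[OF assms hat_in_H])
qed

text \<open>Polarisation of \<open>N\<close>. Additivity is not visible from a supremum; it is
  inherited from \<open>ip_hat\<close>, where ip f (hat xs) = ev f xs is linear in f, by density of
  the functions hat xs.\<close>

definition ip :: "('k \<Rightarrow> complex) \<Rightarrow> ('k \<Rightarrow> complex) \<Rightarrow> complex" where
  "ip f g = (of_real (N (f + g) - N (f - g)) +
     \<i> * of_real (N (f + (\<lambda>p. \<i> * g p)) - N (f - (\<lambda>p. \<i> * g p)))) / 4"

lemma ip_hat:
  assumes "f \<in> H"
  shows "ip f (hat xs) = ev f xs"
proof -
  have h: "f - hat xs = f + hat (list_scale (- 1) xs)"
    "f + (\<lambda>p. \<i> * hat xs p) = f + hat (list_scale (- \<i>) xs)"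
    "f - (\<lambda>p. \<i> * hat xs p) = f + hat (list_scale \<i> xs)"
    by (simp_all add: hat_scale fun_eq_iff)
  show ?thesis
    unfolding ip_def h N_add_hat[OF assms] by (simp add: ev_scale Q_scale complex_eq_iff)
qed

lemma tendsto_ip:
  assumes u: "\<And>n. u n \<in> H" and g: "g \<in> H" and lim: "(\<lambda>n. rnorm (u n - g)) \<longlonglongrightarrow> 0"
    and f: "f \<in> H"
  shows "(\<lambda>n. ip f (u n)) \<longlonglongrightarrow> ip f g"
proof -
  \<comment> \<open>One limit for all scalars; polarisation takes c = 1, -1, \<i>, -\<i>.\<close>
  have "(\<lambda>n. N (f + (\<lambda>p. c * u n p))) \<longlonglongrightarrow> N (f + (\<lambda>p. c * g p))" for c
  proof (rule tendsto_N)
    have "(f + (\<lambda>p. c * u n p)) - (f + (\<lambda>p. c * g p)) = (\<lambda>p. c * (u n - g) p)" for n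
      by (simp add: fun_eq_iff algebra_simps)
    then have "rnorm ((f + (\<lambda>p. c * u n p)) - (f + (\<lambda>p. c * g p))) = cmod c * rnorm (u n - g)" for n
      using rnorm_mult[OF H_diff[OF u g], of c n] by simp
    then show "(\<lambda>n. rnorm ((f + (\<lambda>p. c * u n p)) - (f + (\<lambda>p. c * g p)))) \<longlonglongrightarrow> 0"
      using tendsto_mult_right_zero[OF lim, of "cmod c"] by simp
  qed (intro H_add H_mult f u g)+
  from this[of 1] this[of "- 1"] this[of \<i>] this[of "- \<i>"]
  have "(\<lambda>n. N (f + u n)) \<longlonglongrightarrow> N (f + g)" "(\<lambda>n. N (f - u n)) \<longlonglongrightarrow> N (f - g)"
    "(\<lambda>n. N (f + (\<lambda>p. \<i> * u n p))) \<longlonglongrightarrow> N (f + (\<lambda>p. \<i> * g p))"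
    "(\<lambda>n. N (f - (\<lambda>p. \<i> * u n p))) \<longlonglongrightarrow> N (f - (\<lambda>p. \<i> * g p))"
    by (simp_all add: fun_diff_def plus_fun_def)
  then show ?thesis
    unfolding ip_def by (intro tendsto_intros) auto
qed

lemma tendsto_ip_hat:
  assumes "g \<in> H" and "(\<lambda>n. rnorm (hat (X n) - g)) \<longlonglongrightarrow> 0" and "f \<in> H"
  shows "(\<lambda>n. ev f (X n)) \<longlonglongrightarrow> ip f g"
  using tendsto_ip[OF hat_in_H assms] assms(3) by (simp add: ip_hat)

lemma N_mult:
  assumes "f \<in> H"
  shows "N (\<lambda>p. c * f p) = (cmod c)\<^sup>2 * N f"
proof -
  have "N (\<lambda>p. c * f p) = (cmod c * rnorm f)\<^sup>2"
    using rnorm_power2[OF H_mult[OF assms], of c] unfolding rnorm_mult[OF assms] by (rule sym)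
  then show ?thesis
    by (simp only: power_mult_distrib rnorm_power2[OF assms])
qed

lemma Re_ip_self:
  assumes "f \<in> H"
  shows "Re (ip f f) = N f"
proof -
  have "f + f = (\<lambda>p. 2 * f p)" "f - f = (\<lambda>p. 0 * f p)"
    by (simp_all add: fun_eq_iff)
  then have "N (f + f) = 4 * N f" "N (f - f) = 0"
    by (simp_all only: N_mult[OF assms]) simp_all
  then show ?thesis
    by (simp add: ip_def)
qed

lemma ip_cnj:
  assumes f: "f \<in> H" and g: "g \<in> H"
  shows "ip g f = cnj (ip f g)"
proof -
  \<comment> \<open>Unimodular scalars leave \<open>N\<close> unchanged, and they permute the four
    terms of the polarisation formula.\<close>
  have "N (g - f) = N (\<lambda>p. - 1 * (f - g) p)"
    "N (g + (\<lambda>p. \<i> * f p)) = N (\<lambda>p. \<i> * (f - (\<lambda>p. \<i> * g p)) p)"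
    "N (g - (\<lambda>p. \<i> * f p)) = N (\<lambda>p. - \<i> * (f + (\<lambda>p. \<i> * g p)) p)"
    by (rule arg_cong[where f = N], simp add: fun_eq_iff algebra_simps)+
  then have "N (g - f) = N (f - g)" "N (g + (\<lambda>p. \<i> * f p)) = N (f - (\<lambda>p. \<i> * g p))"
    "N (g - (\<lambda>p. \<i> * f p)) = N (f + (\<lambda>p. \<i> * g p))"
    unfolding N_mult[OF H_diff[OF f g]] N_mult[OF H_diff[OF f H_mult[OF g]]]
      N_mult[OF H_add[OF f H_mult[OF g]]]
    by simp_all
  then show ?thesis
    unfolding ip_def by (simp add: complex_eq_iff add.commute)
qed

text \<open>Evaluations are bounded, which gives a pointwise limit. The inequality |ev (s m - s n)
  xs|^2 \<le> e * Q xs survives n \<rightarrow> \<infinity> for each \<open>xs\<close>; this places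
  the limit in \<open>H\<close> and gives convergence in norm.\<close>

lemma complete:
  assumes s: "range s \<subseteq> H"
    and Cauchy: "\<And>e. e > 0 \<Longrightarrow> \<exists>M::nat. \<forall>m\<ge>M. \<forall>n\<ge>M. N (s m - s n) < e"
  shows "\<exists>f\<in>H. (\<lambda>n. N (s n - f)) \<longlonglongrightarrow> 0"
proof -
  have sH: "s n \<in> H" for n
    using s by auto
  have lim_ex: "\<exists>l. (\<lambda>n. s n p) \<longlonglongrightarrow> l" for p
  proof -
    have "Cauchy (\<lambda>n. s n p)"
    proof (rule CauchyI)
      fix e :: real
      assume e: "0 < e"
      define C where "C = sqrt (Q [(1, p)]) + 1"
      have C: "0 < C" "sqrt (Q [(1, p)]) \<le> C"
        using kernel_nonneg[of "[(1, p)]"] by (auto simp: C_def intro: add_nonneg_pos)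
      have "0 < (e / C)\<^sup>2"
        using e C by simp
      then obtain M where M: "\<forall>m\<ge>M. \<forall>n\<ge>M. N (s m - s n) < (e / C)\<^sup>2"
        using Cauchy by blast
      have "norm (s m p - s n p) < e" if "m \<ge> M" "n \<ge> M" for m n
      proof -
        have "norm (s m p - s n p) \<le> rnorm (s m - s n) * sqrt (Q [(1, p)])"
          using cmod_eval_le[OF H_diff[OF sH sH], of m n p] by simp
        also have "\<dots> \<le> rnorm (s m - s n) * C"
          using C by (intro mult_left_mono rnorm_nonneg H_diff sH)
        also have "\<dots> < e"
        proof -
          have "sqrt (N (s m - s n)) < e / C"
            using M that e C by (intro real_less_lsqrt) auto
          then show ?thesis
            using e C by (simp add: rnorm_def field_simps)
        qed
        finally show ?thesis .
      qed
      then show "\<exists>M. \<forall>m\<ge>M. \<forall>n\<ge>M. norm (s m p - s n p) < e"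
        by blast
    qed
    then show ?thesis
      using Cauchy_convergent convergentD by blast
  qed
  define f where "f p = lim (\<lambda>n. s n p)" for p
  have f: "(\<lambda>n. s n p) \<longlonglongrightarrow> f p" for p
    using lim_ex[of p] by (auto simp: f_def limI)
  have ev_lim: "(\<lambda>n. ev (s n) xs) \<longlonglongrightarrow> ev f xs" for xs
  proof (induction xs)
    case (Cons cp xs)
    then show ?case
      using f by (cases cp) (auto intro!: tendsto_intros)
  qed simp
  have bound: "s m - f \<in> H \<and> N (s m - f) \<le> e"
    if M: "\<forall>m\<ge>M. \<forall>n\<ge>M. N (s m - s n) < e" and m: "m \<ge> M" and e: "0 < e" for M m e
  proof -
    have "(cmod (ev (s m - f) xs))\<^sup>2 \<le> e * Q xs" for xs
    proof (rule LIMSEQ_le_const2)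
      show "(\<lambda>n. (cmod (ev (s m - s n) xs))\<^sup>2) \<longlonglongrightarrow> (cmod (ev (s m - f) xs))\<^sup>2"
        unfolding ev_diff by (intro tendsto_intros ev_lim)
      have "(cmod (ev (s m - s n) xs))\<^sup>2 \<le> e * Q xs" if "n \<ge> M" for n
      proof -
        have "(cmod (ev (s m - s n) xs))\<^sup>2 \<le> N (s m - s n) * Q xs"
          by (rule ev_le) (intro H_diff sH)
        also have "\<dots> \<le> e * Q xs"
          using M m that kernel_nonneg by (intro mult_right_mono) (auto intro: less_imp_le)
        finally show ?thesis .
      qed
      then show "\<exists>M. \<forall>n\<ge>M. (cmod (ev (s m - s n) xs))\<^sup>2 \<le> e * Q xs"
        by blast
    qed
    then show ?thesis
      using e H_intro[of e "s m - f"] N_le[of e "s m - f"] by simp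
  qed
  obtain M where "\<forall>m\<ge>M. \<forall>n\<ge>M. N (s m - s n) < 1"
    using Cauchy[of 1] by auto
  then have "s M - f \<in> H"
    using bound[of M 1 M] by simp
  then have "f \<in> H"
    using H_diff[OF sH, of "s M - f" M] by simp
  moreover have "(\<lambda>n. N (s n - f)) \<longlonglongrightarrow> 0"
  proof (rule LIMSEQ_I)
    fix e :: real
    assume e: "0 < e"
    obtain M where M: "\<forall>m\<ge>M. \<forall>n\<ge>M. N (s m - s n) < e / 2"
      using Cauchy[of "e / 2"] e by auto
    have "norm (N (s m - f) - 0) < e" if "m \<ge> M" for m
      using bound[OF M that] N_nonneg[of "s m - f"] e by auto
    then show "\<exists>M. \<forall>m\<ge>M. norm (N (s m - f) - 0) < e"
      by blast
  qed
  ultimately show ?thesis by blast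
qed

sublocale hilbert: hilbert_space_on H "\<lambda>c f p. c * f p" ip
proof
  show "0 \<in> H"
    by (rule H_zero)
  fix x y z :: "'k \<Rightarrow> complex" and b c :: complex
  show "(\<lambda>p. c * (x + y) p) = (\<lambda>p. c * x p) + (\<lambda>p. c * y p)"
    "(\<lambda>p. (b + c) * x p) = (\<lambda>p. b * x p) + (\<lambda>p. c * x p)"
    "(\<lambda>p. b * (c * x p)) = (\<lambda>p. b * c * x p)" "(\<lambda>p. 1 * x p) = x"
    by (simp_all add: fun_eq_iff algebra_simps)
  assume x: "x \<in> H"
  show "(\<lambda>p. c * x p) \<in> H"
    using x by (rule H_mult)
  show "0 \<le> Re (ip x x)"
    using x by (simp add: Re_ip_self N_nonneg)
  show "x = 0" if "Re (ip x x) = 0"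
    using that rnorm_eq_0[OF x] x by (simp add: Re_ip_self rnorm_def)
  assume y: "y \<in> H"
  show "x + y \<in> H"
    using x y by (rule H_add)
  show "ip y x = cnj (ip x y)"
    using x y by (rule ip_cnj)
  \<comment> \<open>Linearity in the first argument is checked with the second one replaced by
    functions hat (Y n), against which \<open>ip\<close> is \<open>ev\<close>.\<close>
  obtain Y where Y: "(\<lambda>n. rnorm (hat (Y n) - y)) \<longlonglongrightarrow> 0"
    using hat_dense[OF y] .
  show "ip (\<lambda>p. c * x p) y = c * ip x y"
  proof (rule LIMSEQ_unique)
    show "(\<lambda>n. ev (\<lambda>p. c * x p) (Y n)) \<longlonglongrightarrow> ip (\<lambda>p. c * x p) y"
      using y Y H_mult[OF x] by (rule tendsto_ip_hat)
    show "(\<lambda>n. ev (\<lambda>p. c * x p) (Y n)) \<longlonglongrightarrow> c * ip x y"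
      unfolding ev_mult by (intro tendsto_intros tendsto_ip_hat[OF y Y x])
  qed
  assume z: "z \<in> H"
  obtain Z where Z: "(\<lambda>n. rnorm (hat (Z n) - z)) \<longlonglongrightarrow> 0"
    using hat_dense[OF z] .
  show "ip (x + y) z = ip x z + ip y z"
  proof (rule LIMSEQ_unique)
    show "(\<lambda>n. ev (x + y) (Z n)) \<longlonglongrightarrow> ip (x + y) z"
      using z Z H_add[OF x y] by (rule tendsto_ip_hat)
    show "(\<lambda>n. ev (x + y) (Z n)) \<longlonglongrightarrow> ip x z + ip y z"
      unfolding ev_add by (intro tendsto_intros tendsto_ip_hat[OF z Z] x y)
  qed
next
  fix s :: "nat \<Rightarrow> 'k \<Rightarrow> complex"
  assume s: "range s \<subseteq> H"
    and C: "\<And>e. 0 < e \<Longrightarrow> \<exists>N. \<forall>m\<ge>N. \<forall>n\<ge>N. Re (ip (s m - s n) (s m - s n)) < e"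
  have sH: "s n \<in> H" for n
    using s by auto
  have "\<exists>f\<in>H. (\<lambda>n. N (s n - f)) \<longlonglongrightarrow> 0"
    using C by (intro complete s) (simp add: Re_ip_self sH H_diff)
  then show "\<exists>x\<in>H. (\<lambda>n. Re (ip (s n - x) (s n - x))) \<longlonglongrightarrow> 0"
    by (auto simp: Re_ip_self sH H_diff)
qed

lemma hnorm_eq_rnorm: "f \<in> H \<Longrightarrow> hilbert.hnorm f = rnorm f"
  by (simp add: hilbert.hnorm_def rnorm_def Re_ip_self)

section \<open>Composition operators on a reproducing kernel Hilbert space\<close>

definition comp_operator :: "('k \<Rightarrow> 'k) \<Rightarrow> ('k \<Rightarrow> complex) \<Rightarrow> 'k \<Rightarrow> complex" where
  "comp_operator \<phi> f = (if f \<in> H then f \<circ> \<phi> else 0)"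

text \<open>Composition with \<phi> on functions is dual to pushing finite combinations forward
  along \<phi> (\<open>ev_push\<close>), so that boundedness can be tested on finite
  combinations.\<close>

definition push_bounded :: "('k \<Rightarrow> 'k) \<Rightarrow> bool" where
  "push_bounded \<phi> \<longleftrightarrow> (\<exists>M\<ge>0. \<forall>xs. Q (list_push \<phi> xs) \<le> M * Q xs)"

lemma push_bounded_comp:
  assumes "push_bounded \<phi>"
  obtains M where "0 \<le> M" "\<And>f. f \<in> H \<Longrightarrow> f \<circ> \<phi> \<in> H \<and> rnorm (f \<circ> \<phi>) \<le> M * rnorm f"
proof -
  obtain M where M: "0 \<le> M" "\<And>xs. Q (list_push \<phi> xs) \<le> M * Q xs"
    using assms by (auto simp: push_bounded_def)
  have "f \<circ> \<phi> \<in> H \<and> rnorm (f \<circ> \<phi>) \<le> sqrt M * rnorm f" if f: "f \<in> H" for f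
  proof -
    have "cmod (ev (f \<circ> \<phi>) xs) \<le> (sqrt M * rnorm f) * sqrt (Q xs)" for xs
    proof -
      have "cmod (ev (f \<circ> \<phi>) xs) \<le> rnorm f * sqrt (Q (list_push \<phi> xs))"
        using cmod_ev_le[OF f, of "list_push \<phi> xs"] by (simp add: ev_push)
      also have "\<dots> \<le> rnorm f * sqrt (M * Q xs)"
        using M(2) rnorm_nonneg[OF f] by (intro mult_left_mono) auto
      finally show ?thesis
        by (simp add: real_sqrt_mult mult_ac)
    qed
    moreover have "0 \<le> sqrt M * rnorm f"
      using M(1) rnorm_nonneg[OF f] by simp
    ultimately show ?thesis
      by (intro conjI H_intro_rnorm rnorm_le)
  qed
  then show ?thesis
    using that[of "sqrt M"] M(1) by simp
qed

text \<open>The relation between \<phi> and \<eta> makes hat (list_push \<phi> xs) equal to hat xs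
  \<circ> \<eta>. Hence ip (f \<circ> \<phi>) (hat xs) = ev f (list_push \<phi> xs) = ip f (hat xs
  \<circ> \<eta>), and boundedness of \<eta> extends this to limits.\<close>

lemma adjoint_pair_comp_operator:
  assumes \<phi>: "push_bounded \<phi>" and \<eta>: "push_bounded \<eta>" and adj: "\<And>p q. k (\<phi> p) q = k p (\<eta> q)"
  shows "hilbert.adjoint_pair (comp_operator \<phi>) (comp_operator \<eta>)"
proof -
  obtain M where M: "0 \<le> M" "\<And>f. f \<in> H \<Longrightarrow> f \<circ> \<phi> \<in> H \<and> rnorm (f \<circ> \<phi>) \<le> M * rnorm f"
    by (rule push_bounded_comp[OF \<phi>]) blast
  obtain M' where M': "0 \<le> M'" "\<And>f. f \<in> H \<Longrightarrow> f \<circ> \<eta> \<in> H \<and> rnorm (f \<circ> \<eta>) \<le> M' * rnorm f"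
    by (rule push_bounded_comp[OF \<eta>]) blast
  have hat_push: "hat (list_push \<phi> xs) = hat xs \<circ> \<eta>" for xs
    by (simp add: kernel_hat_def ev_push comp_def adj)
  have "ip (f \<circ> \<phi>) g = ip f (g \<circ> \<eta>)" if f: "f \<in> H" and g: "g \<in> H" for f g
  proof -
    obtain X where X: "(\<lambda>n. rnorm (hat (X n) - g)) \<longlonglongrightarrow> 0"
      using hat_dense[OF g] .
    show ?thesis
    proof (rule LIMSEQ_unique)
      show "(\<lambda>n. ev (f \<circ> \<phi>) (X n)) \<longlonglongrightarrow> ip (f \<circ> \<phi>) g"
        using g X by (rule tendsto_ip_hat) (use M(2) f in blast)
      have "(\<lambda>n. ev f (list_push \<phi> (X n))) \<longlonglongrightarrow> ip f (g \<circ> \<eta>)"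
      proof (rule tendsto_ip_hat)
        show "(\<lambda>n. rnorm (hat (list_push \<phi> (X n)) - (g \<circ> \<eta>))) \<longlonglongrightarrow> 0"
        proof (rule Lim_null_comparison)
          show "(\<lambda>n. M' * rnorm (hat (X n) - g)) \<longlonglongrightarrow> 0"
            using X by (rule tendsto_mult_right_zero)
          have "norm (rnorm (hat (list_push \<phi> (X n)) - (g \<circ> \<eta>))) \<le> M' * rnorm (hat (X n) - g)" for n
          proof -
            have "hat (list_push \<phi> (X n)) - (g \<circ> \<eta>) = (hat (X n) - g) \<circ> \<eta>"
              unfolding hat_push by (simp add: fun_eq_iff)
            then show ?thesis
              using M'(2)[OF H_diff[OF hat_in_H g], of "X n"] rnorm_nonneg by simp
          qed
          then show "\<forall>\<^sub>F n in sequentially.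
              norm (rnorm (hat (list_push \<phi> (X n)) - (g \<circ> \<eta>))) \<le> M' * rnorm (hat (X n) - g)"
            by simp
        qed
      qed (use M'(2) f g in auto)
      then show "(\<lambda>n. ev (f \<circ> \<phi>) (X n)) \<longlonglongrightarrow> ip f (g \<circ> \<eta>)"
        by (simp add: ev_push)
    qed
  qed
  then show ?thesis
    using M(2) M'(2) by (auto simp: hilbert.adjoint_pair_def hilbert.maps_H_def comp_operator_def)
qed

lemma bounded_by_comp_operator:
  assumes "push_bounded \<phi>"
  obtains M where "hilbert.bounded_by M (comp_operator \<phi>)"
proof -
  obtain M where "0 \<le> M" "\<And>f. f \<in> H \<Longrightarrow> f \<circ> \<phi> \<in> H \<and> rnorm (f \<circ> \<phi>) \<le> M * rnorm f"
    by (rule push_bounded_comp[OF assms]) blast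
  then have "hilbert.bounded_by M (comp_operator \<phi>)"
    by (simp add: hilbert.bounded_by_def comp_operator_def hnorm_eq_rnorm)
  then show ?thesis by (rule that)
qed

text \<open>Composition with \<open>\<phi>\<close> is a partial isometry, as \<open>\<eta> \<circ> \<phi>\<close> induces a projection.\<close>

lemma push_bounded_idem:
  assumes adj: "\<And>p q. k (\<phi> p) q = k p (\<eta> q)" and idem: "\<And>p. \<eta> (\<phi> (\<eta> (\<phi> p))) = \<eta> (\<phi> p)"
  shows "push_bounded \<phi>"
proof -
  have B_push: "B (list_push \<phi> xs) ys = B xs (list_push \<eta> ys)" for xs ys
  proof -
    have "k q (\<phi> p) = k (\<eta> q) p" for p q
      using kernel_cnj[of q "\<phi> p"] kernel_cnj[of "\<eta> q" p] adj[of p q] by simp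
    then show ?thesis
      by (simp add: kernel_form_def kernel_hat_def ev_push comp_def)
  qed
  have "Q (list_push \<phi> xs) \<le> 1 * Q xs" for xs
  proof -
    \<comment> \<open>\<open>ys\<close> stands for the orthogonal projection of \<open>xs\<close>:
      both Q ys and Q (list_push \<phi> xs) equal Re (B xs ys), and Q \<ge> 0 on the difference of
      \<open>xs\<close> and \<open>ys\<close> is the claim.\<close>
    define ys where "ys = list_push \<eta> (list_push \<phi> xs)"
    have idem': "list_push \<eta> (list_push \<phi> ys) = ys"
      by (simp add: ys_def list_push_def idem case_prod_unfold comp_def)
    have Qxs: "Q (list_push \<phi> xs) = Re (B xs ys)"
      by (simp add: B_push ys_def)
    have B_push': "B (list_push \<eta> us) vs = B us (list_push \<phi> vs)" for us vs
      using B_push[of vs us] B_cnj[of "list_push \<eta> us" vs] B_cnj[of us "list_push \<phi> vs"] by simp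
    have "B ys ys = B xs (list_push \<eta> (list_push \<phi> ys))"
      by (simp add: ys_def B_push B_push')
    then have "Q ys = Re (B xs ys)"
      by (simp add: idem')
    then show ?thesis
      using kernel_nonneg[of "xs @ list_scale (- 1) ys"] Qxs Q_diff[of xs ys] by simp
  qed
  then show ?thesis
    unfolding push_bounded_def by (intro exI[of _ 1]) simp
qed

end

section \<open>The Fock representation\<close>

lemma word_endo_append: "word_endo \<alpha> (u @ v) = word_endo \<alpha> u \<circ> word_endo \<alpha> v"
  by (induction u) (simp_all add: comp_assoc)

lemma unital_star_hom_id: "unital_star_hom class_cstar id"
  by (simp add: unital_star_hom_def)

lemma unital_star_hom_comp:
  "unital_star_hom class_cstar f \<Longrightarrow> unital_star_hom class_cstar g \<Longrightarrow>
    unital_star_hom class_cstar (f \<circ> g)"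
  by (simp add: unital_star_hom_def)

lemma unital_star_hom_word_endo:
  assumes "\<And>i. i \<in> set w \<Longrightarrow> unital_star_hom class_cstar (\<alpha> i)"
  shows "unital_star_hom class_cstar (word_endo \<alpha> w)"
  using assms by (induction w) (simp_all add: unital_star_hom_id unital_star_hom_comp)

lemma (in hilbert_space_on) vector_state:
  assumes \<Phi>: "unital_star_hom operator_algebra \<Phi>" and \<xi>: "\<xi> \<in> H" "hnorm \<xi> = 1"
  shows "(\<lambda>x. ip (\<Phi> x \<xi>) \<xi>) \<in> states"
proof -
  have op: "\<Phi> x \<in> operators" for x
    using \<Phi> by (simp add: unital_star_hom_def)
  have "ip (\<Phi> (star x * x) \<xi>) \<xi> \<in> \<real>\<^sub>\<ge>\<^sub>0" for x
  proof -
    have "ip (\<Phi> (star x * x) \<xi>) \<xi> = ip (adj (\<Phi> x) (\<Phi> x \<xi>)) \<xi>"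
      using \<Phi> by (simp add: unital_star_hom_def)
    also have "\<dots> = ip (\<Phi> x \<xi>) (\<Phi> x \<xi>)"
      by (rule adjoint_pair_ip[OF adjoint_pair_sym[OF adjoint_pair_adj[OF op]]
            operators_arg_closed[OF op] \<xi>(1)])
    also have "\<dots> \<in> \<real>\<^sub>\<ge>\<^sub>0"
      by (simp only: ip_self[OF operators_arg_closed[OF op]] nonneg_Reals_of_real_iff zero_le_power2)
    finally show ?thesis .
  qed
  moreover have "ip (\<Phi> 1 \<xi>) \<xi> = 1"
    using \<Phi> ip_self[OF \<xi>(1)] \<xi> by (simp add: unital_star_hom_def ident_def)
  ultimately show ?thesis
    using \<Phi> \<xi>(1) op
    by (auto simp: states_def unital_star_hom_def ip_add_left ip_sc_left operators_arg_closed)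
qed

text \<open>All natural numbers serve as letters here; a number d of them is singled out only in
  \<open>covariant_pair_fock\<close>. The representation exists for every state, while the trace
  property enters with the KMS condition.\<close>

locale fock_space =
  fixes \<alpha> :: "nat \<Rightarrow> 'a::unital_cstar_algebra \<Rightarrow> 'a" and \<tau> :: "'a \<Rightarrow> complex"
  assumes hom: "\<And>i. unital_star_hom class_cstar (\<alpha> i)"
    and state: "\<tau> \<in> states"
begin

lemmas \<tau>_positive = states_positive[OF state]
lemmas \<tau>_simps = positive_functional_zero[OF \<tau>_positive] positive_functional_add[OF \<tau>_positive]
  positive_functional_scaleC[OF \<tau>_positive] states_one[OF state]

lemma endo: "unital_star_hom class_cstar (word_endo \<alpha> w)"
  using hom by (rule unital_star_hom_word_endo)

lemma endo_simps:
  "word_endo \<alpha> w (x + y) = word_endo \<alpha> w x + word_endo \<alpha> w y"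
  "word_endo \<alpha> w (c *\<^sub>C x) = c *\<^sub>C word_endo \<alpha> w x"
  "word_endo \<alpha> w (x * y) = word_endo \<alpha> w x * word_endo \<alpha> w y"
  "word_endo \<alpha> w (star x) = star (word_endo \<alpha> w x)"
  "word_endo \<alpha> w 1 = 1"
  using endo[of w] by (auto simp: unital_star_hom_def)

text \<open>The value f (w, a) is to be read as the inner product of f with the vector a \<otimes>
  e_w, and kern p q as the inner product of the vectors of q and p: the GNS form of \<tau> on each
  summand.\<close>

definition kern :: "nat list \<times> 'a \<Rightarrow> nat list \<times> 'a \<Rightarrow> complex" where
  "kern p q = (if fst p = fst q then \<tau> (star (snd p) * snd q) else 0)"

text \<open>The component in A of the vector \<open>kernel_hat kern xs\<close> at e_w. Coefficients
  are conjugated because \<open>kernel_hat\<close> is conjugate linear in the list.\<close>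

fun block :: "nat list \<Rightarrow> (complex \<times> nat list \<times> 'a) list \<Rightarrow> 'a" where
  "block w [] = 0"
| "block w ((c, v, a) # xs) = (if v = w then cnj c *\<^sub>C a else 0) + block w xs"

lemma kern_apply: "kern (w, a) (v, b) = (if w = v then \<tau> (star a * b) else 0)"
  by (simp add: kern_def)

lemma kern_cnj: "kern q p = cnj (kern p q)"
  using positive_functional_star[OF \<tau>_positive, of "star (snd p) * snd q"]
  by (simp add: kern_def star_mult star_star)

lemma hat_kern: "kernel_hat kern ys (w, a) = \<tau> (star a * block w ys)"
proof (induction ys)
  case Nil
  then show ?case by (simp add: kernel_hat_def \<tau>_simps)
next
  case (Cons y ys)
  obtain c v b where y: "y = (c, v, b)" by (cases y) auto
  have "kernel_hat kern (y # ys) (w, a) = cnj c * kern (w, a) (v, b) + kernel_hat kern ys (w, a)"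
    by (simp add: kernel_hat_def y kern_cnj[symmetric])
  then show ?case
    by (simp add: Cons y kern_apply distrib_left mult_scaleC_right \<tau>_simps)
qed

text \<open>The orthogonal decomposition over words, which reduces positivity of the kernel to
  positivity of \<tau>. A set W that may exceed the words of \<open>xs\<close> stays fixed during
  the induction.\<close>

lemma kernel_form_kern:
  assumes "finite W" and "(\<lambda>(c, v, a). v) ` set xs \<subseteq> W"
  shows "kernel_form kern xs ys = (\<Sum>w\<in>W. \<tau> (star (block w xs) * block w ys))"
  using assms(2)
proof (induction xs)
  case Nil
  then show ?case by (simp add: kernel_form_def \<tau>_simps)
next
  case (Cons x xs)
  obtain c v a where x: "x = (c, v, a)" by (cases x) auto
  have v: "v \<in> W" using Cons.prems x by auto
  have "\<tau> (star (block w (x # xs)) * block w ys) =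
      (if v = w then c * \<tau> (star a * block w ys) else 0) + \<tau> (star (block w xs) * block w ys)" for w
    by (simp add: x star_add star_scaleC distrib_right mult_scaleC_left \<tau>_simps)
  then have "(\<Sum>w\<in>W. \<tau> (star (block w (x # xs)) * block w ys)) =
      c * \<tau> (star a * block v ys) + kernel_form kern xs ys"
    using Cons assms(1) v by (simp add: sum.distrib)
  then show ?case
    by (simp add: kernel_form_def x hat_kern)
qed

lemma kernel_form_kern_self:
  assumes "finite W" and "(\<lambda>(c, v, a). v) ` set xs \<subseteq> W"
  shows "Re (kernel_form kern xs xs) = (\<Sum>w\<in>W. Re (\<tau> (star (block w xs) * block w xs)))"
  by (simp add: kernel_form_kern[OF assms])

sublocale positive_kernel kern
proof
  show "kern q p = cnj (kern p q)" for p q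
    by (rule kern_cnj)
  show "0 \<le> Re (kernel_form kern xs xs)" for xs
    by (subst kernel_form_kern_self[OF _ order_refl])
       (auto intro!: sum_nonneg positive_functional_Re_nonneg[OF \<tau>_positive])
qed

text \<open>A combination whose blocks vanish has Q = 0 and is annihilated by every f in H. This is
  how a function on F \<times> A acquires additivity and conjugate homogeneity in its second
  argument.\<close>

lemma ev_eq_0:
  assumes "f \<in> H" and "\<And>w. block w xs = 0"
  shows "ev f xs = 0"
proof -
  have "Re (kernel_form kern xs xs) = 0"
    by (subst kernel_form_kern_self[OF _ order_refl]) (simp_all add: assms(2) \<tau>_simps)
  then show ?thesis
    using cmod_ev_le[OF assms(1), of xs] by simp
qed

lemma H_apply_add: "f \<in> H \<Longrightarrow> f (w, a + b) = f (w, a) + f (w, b)"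
  using ev_eq_0[of f "[(1, w, a + b), (- 1, w, a), (- 1, w, b)]"]
  by (simp add: scaleC_minus_left algebra_simps)

lemma H_apply_scaleC: "f \<in> H \<Longrightarrow> f (w, c *\<^sub>C a) = cnj c * f (w, a)"
  using ev_eq_0[of f "[(1, w, c *\<^sub>C a), (- cnj c, w, a)]"]
  by (simp add: scaleC_minus_left)

lemma H_apply_zero: "f \<in> H \<Longrightarrow> f (w, 0) = 0"
  using ev_eq_0[of f "[(1, w, 0)]"] by simp

text \<open>As f (w, a) is an inner product with a \<otimes> e_w, an operator acts on functions by
  moving points with its adjoint. This explains \<open>star b\<close> here, and why creation is
  composition with \<open>remove_letter\<close>.\<close>

definition rep_map :: "'a \<Rightarrow> nat list \<times> 'a \<Rightarrow> nat list \<times> 'a" where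
  "rep_map b = (\<lambda>(w, a). (w, word_endo \<alpha> (rev w) (star b) * a))"

text \<open>Functions in \<open>H\<close> vanish at \<open>([], 0)\<close>, which therefore encodes the value zero.\<close>

definition remove_letter :: "nat \<Rightarrow> nat list \<times> 'a \<Rightarrow> nat list \<times> 'a" where
  "remove_letter i = (\<lambda>(w, a). case w of [] \<Rightarrow> ([], 0) | j # v \<Rightarrow> if j = i then (v, a) else ([], 0))"

definition add_letter :: "nat \<Rightarrow> nat list \<times> 'a \<Rightarrow> nat list \<times> 'a" where
  "add_letter i = (\<lambda>(w, a). (i # w, a))"

lemma kern_rep_map: "kern (rep_map b p) q = kern p (rep_map (star b) q)"
  by (auto simp: kern_def rep_map_def star_mult star_star endo_simps mult.assoc split: prod.splits)

lemma kern_remove_letter: "kern (remove_letter i p) q = kern p (add_letter i q)"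
  by (auto simp: kern_def remove_letter_def add_letter_def \<tau>_simps split: prod.splits list.splits)

lemma kern_add_letter: "kern (add_letter i p) q = kern p (remove_letter i q)"
  using kern_remove_letter[of i q p] kern_cnj by metis

text \<open>Block by block: for x = block w xs the functional y \<mapsto> \<tau>(star x * word_endo
  \<alpha> (rev w) y * x) is positive, so its value at b * star b is at most
  \<open>(norm b)\<^sup>2\<close> times its value at 1.\<close>

lemma push_bounded_rep_map: "push_bounded (rep_map b)"
  unfolding push_bounded_def
proof (intro exI[of _ "(norm b)\<^sup>2"] conjI allI)
  fix xs :: "(complex \<times> nat list \<times> 'a) list"
  define W where "W = (\<lambda>(c, v, a). v) ` set xs"
  have block: "block w (list_push (rep_map b) xs) = word_endo \<alpha> (rev w) (star b) * block w xs" for w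
    by (induction xs rule: block.induct[of _ w])
       (auto simp: list_push_def rep_map_def distrib_left mult_scaleC_right)
  have "Re (kernel_form kern (list_push (rep_map b) xs) (list_push (rep_map b) xs)) =
      (\<Sum>w\<in>W. Re (\<tau> (star (word_endo \<alpha> (rev w) (star b) * block w xs) *
        (word_endo \<alpha> (rev w) (star b) * block w xs))))"
    unfolding block[symmetric]
    by (rule kernel_form_kern_self)
       (auto simp: W_def list_push_def rep_map_def image_image case_prod_unfold)
  also have "\<dots> \<le> (\<Sum>w\<in>W. (norm b)\<^sup>2 * Re (\<tau> (star (block w xs) * block w xs)))"
  proof (rule sum_mono)
    fix w
    show "Re (\<tau> (star (word_endo \<alpha> (rev w) (star b) * block w xs) *
        (word_endo \<alpha> (rev w) (star b) * block w xs))) \<le>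
        (norm b)\<^sup>2 * Re (\<tau> (star (block w xs) * block w xs))"
      using positive_functional_square_le[OF
          positive_functional_compress[OF \<tau>_positive endo[of "rev w"], of "block w xs"], of "star b"]
      by (simp add: endo_simps star_mult star_star mult.assoc)
  qed
  also have "\<dots> = (norm b)\<^sup>2 * Re (kernel_form kern xs xs)"
    by (simp add: sum_distrib_left kernel_form_kern_self[of W] W_def)
  finally show "Re (kernel_form kern (list_push (rep_map b) xs) (list_push (rep_map b) xs)) \<le>
      (norm b)\<^sup>2 * Re (kernel_form kern xs xs)" .
qed simp

lemma push_bounded_remove_letter: "push_bounded (remove_letter i)"
  by (rule push_bounded_idem[OF kern_remove_letter])
     (auto simp: remove_letter_def add_letter_def split: prod.splits list.splits)

lemma push_bounded_add_letter: "push_bounded (add_letter i)"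
  by (rule push_bounded_idem[OF kern_add_letter])
     (auto simp: remove_letter_def add_letter_def split: prod.splits list.splits)

definition rep :: "'a \<Rightarrow> (nat list \<times> 'a \<Rightarrow> complex) \<Rightarrow> nat list \<times> 'a \<Rightarrow> complex" where
  "rep b = comp_operator (rep_map b)"

definition creation :: "nat \<Rightarrow> (nat list \<times> 'a \<Rightarrow> complex) \<Rightarrow> nat list \<times> 'a \<Rightarrow> complex" where
  "creation i = comp_operator (remove_letter i)"

definition annihilation :: "nat \<Rightarrow> (nat list \<times> 'a \<Rightarrow> complex) \<Rightarrow> nat list \<times> 'a \<Rightarrow> complex" where
  "annihilation i = comp_operator (add_letter i)"

lemma rep_pair: "hilbert.adjoint_pair (rep b) (rep (star b))"
  unfolding rep_def
  by (intro adjoint_pair_comp_operator push_bounded_rep_map kern_rep_map)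

lemma creation_pair: "hilbert.adjoint_pair (creation i) (annihilation i)"
  unfolding creation_def annihilation_def
  by (intro adjoint_pair_comp_operator push_bounded_remove_letter push_bounded_add_letter
      kern_remove_letter)

lemma rep_operator: "rep b \<in> hilbert.operators"
  using bounded_by_comp_operator[OF push_bounded_rep_map] hilbert.operatorsI[OF rep_pair]
  unfolding rep_def by metis

lemma creation_operator: "creation i \<in> hilbert.operators"
  using bounded_by_comp_operator[OF push_bounded_remove_letter] hilbert.operatorsI[OF creation_pair]
  unfolding creation_def by metis

lemma annihilation_operator: "annihilation i \<in> hilbert.operators"
  using hilbert.operators_adj[OF creation_operator] hilbert.adj_eq[OF creation_pair] by simp

lemma comp_operator_apply: "f \<in> H \<Longrightarrow> comp_operator \<phi> f p = f (\<phi> p)"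
  by (simp add: comp_operator_def)

lemma operator_eqI:
  assumes "\<And>f. f \<notin> H \<Longrightarrow> T f = 0" and "\<And>f. f \<notin> H \<Longrightarrow> S f = 0"
    and "\<And>f w a. f \<in> H \<Longrightarrow> T f (w, a) = S f (w, a)"
  shows "T = S"
  using assms by (metis ext prod.exhaust)

lemma covariant_pair_fock: "covariant_pair d \<alpha> hilbert.operator_algebra rep creation"
proof -
  note closed = hilbert.operators_closed[OF rep_operator] hilbert.operators_closed[OF creation_operator]
    hilbert.operators_closed[OF annihilation_operator]
  note outside = hilbert.operators_outside[OF rep_operator]
    hilbert.operators_outside[OF creation_operator] hilbert.operators_outside[OF annihilation_operator]
  note zero = hilbert.operators_zero_arg[OF rep_operator]
    hilbert.operators_zero_arg[OF creation_operator] hilbert.operators_zero_arg[OF annihilation_operator]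
  have rep_apply: "rep b f (w, a) = f (w, word_endo \<alpha> (rev w) (star b) * a)" if "f \<in> H" for b f w a
    using that by (simp add: rep_def comp_operator_apply rep_map_def)
  have creation_apply: "creation i f (w, a) =
      (case w of [] \<Rightarrow> 0 | j # v \<Rightarrow> if j = i then f (v, a) else 0)" if "f \<in> H" for i f w a
    using that
    by (simp add: creation_def comp_operator_apply remove_letter_def H_apply_zero split: list.splits)
  have annihilation_apply: "annihilation i f (w, a) = f (i # w, a)" if "f \<in> H" for i f w a
    using that by (simp add: annihilation_def comp_operator_apply add_letter_def)
  have "unital_star_hom hilbert.operator_algebra rep"
    unfolding unital_star_hom_def hilbert.operator_algebra_simps
  proof (intro conjI allI)
    fix x y c
    show "rep x \<in> hilbert.operators"
      by (rule rep_operator)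
    show "rep (x + y) = (\<lambda>f. rep x f + rep y f)"
      by (rule operator_eqI)
         (simp_all add: outside rep_apply star_add endo_simps distrib_right H_apply_add)
    show "rep (c *\<^sub>C x) = (\<lambda>f p. c * rep x f p)"
      by (rule operator_eqI)
         (simp_all add: outside rep_apply star_scaleC endo_simps mult_scaleC_left H_apply_scaleC
           zero_fun_def)
    show "rep (x * y) = (\<lambda>f. rep x (rep y f))"
      by (rule operator_eqI)
         (simp_all add: outside zero rep_apply closed star_mult endo_simps mult.assoc)
    show "rep (star x) = hilbert.adj (rep x)"
      by (rule hilbert.adj_eq[OF rep_pair, symmetric])
    show "rep 1 = hilbert.ident"
      by (rule operator_eqI)
         (simp_all add: outside rep_apply endo_simps hilbert.ident_def)
  qed
  moreover have "(\<lambda>f. hilbert.adj (creation i) (creation j f)) =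
      (if i = j then hilbert.ident else (\<lambda>_. 0))" for i j
    unfolding hilbert.adj_eq[OF creation_pair]
    by (rule operator_eqI)
       (simp_all add: outside zero annihilation_apply creation_apply closed hilbert.ident_def)
  moreover have "(\<lambda>f. rep a (creation i f)) = (\<lambda>f. creation i (rep (\<alpha> i a) f))" for i a
  proof (rule operator_eqI)
    have "star (\<alpha> i a) = \<alpha> i (star a)"
      using hom[of i] by (simp add: unital_star_hom_def)
    \<comment> \<open>Only words i # v matter, where rev (i # v) = rev v @ [i] makes \<alpha>_i the
      innermost endomorphism.\<close>
    then show "rep a (creation i f) (w, x) = creation i (rep (\<alpha> i a) f) (w, x)" if "f \<in> H" for f w x
      using that
      by (auto simp: rep_apply creation_apply closed word_endo_append split: list.splits)
  qed (simp_all add: outside zero)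
  ultimately show ?thesis
    unfolding covariant_pair_def using creation_operator by simp
qed

section \<open>The basis vectors 1 \<otimes> e_w and their vector states\<close>

definition vac :: "nat list \<Rightarrow> nat list \<times> 'a \<Rightarrow> complex" where
  "vac w = kernel_hat kern [(1, w, 1)]"

lemma vac_apply: "vac w (v, a) = (if v = w then \<tau> (star a) else 0)"
  by (simp add: vac_def hat_kern \<tau>_simps)

lemma vac_H: "vac w \<in> H"
  unfolding vac_def by (rule hat_in_H)

lemma ip_vac: "f \<in> H \<Longrightarrow> ip f (vac w) = f (w, 1)"
  by (simp add: vac_def ip_hat)

lemma hnorm_vac: "hilbert.hnorm (vac w) = 1"
  by (simp add: hilbert.hnorm_def ip_vac vac_H vac_apply \<tau>_simps)

lemma annihilation_vac: "annihilation i (vac w) =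
    (case w of [] \<Rightarrow> 0 | j # v \<Rightarrow> if j = i then vac v else 0)"
proof
  fix p
  show "annihilation i (vac w) p = (case w of [] \<Rightarrow> 0 | j # v \<Rightarrow> if j = i then vac v else 0) p"
    by (cases p) (auto simp: annihilation_def comp_operator_apply vac_H add_letter_def vac_apply
        split: list.splits)
qed

context
  fixes \<Phi> :: "'b::unital_cstar_algebra \<Rightarrow> _" and \<iota> V d
  assumes \<Phi>: "unital_star_hom hilbert.operator_algebra \<Phi>"
    and \<Phi>_\<iota>: "\<And>a. \<Phi> (\<iota> a) = rep a" and \<Phi>_V: "\<And>i. i < d \<Longrightarrow> \<Phi> (V i) = creation i"
begin

lemma \<Phi>_operator: "\<Phi> x \<in> hilbert.operators"
  using \<Phi> by (simp add: unital_star_hom_def)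

lemma \<Phi>_star_word_vac:
  assumes "\<mu> \<in> words d"
  shows "\<Phi> (star (word_prod V \<mu>)) (vac w) =
    (if take (length \<mu>) w = \<mu> then vac (drop (length \<mu>) w) else 0)"
  using assms
proof (induction \<mu> arbitrary: w)
  case Nil
  then show ?case
    using \<Phi> by (simp add: unital_star_hom_def hilbert.ident_def vac_H)
next
  case (Cons i \<mu>)
  have "\<Phi> (star (word_prod V (i # \<mu>))) (vac w) =
      \<Phi> (star (word_prod V \<mu>)) (\<Phi> (star (V i)) (vac w))"
    using \<Phi> by (simp add: unital_star_hom_def star_mult)
  also have "\<Phi> (star (V i)) = annihilation i"
    using \<Phi> \<Phi>_V[of i] Cons.prems hilbert.adj_eq[OF creation_pair, of i]
    by (simp add: unital_star_hom_def words_def)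
  finally show ?case
    using Cons hilbert.operators_zero_arg[OF \<Phi>_operator]
    by (auto simp: annihilation_vac words_def split: list.splits)
qed

text \<open>After moving V_\<mu> to the other side as an adjoint, V_\<mu>^* and V_\<nu>^* strip
  their words from the front of w. Both images are basis vectors or zero, and \<open>rep a\<close>
  preserves the summands.\<close>

lemma ip_\<Phi>_vac:
  assumes "\<mu> \<in> words d" and "\<nu> \<in> words d"
  shows "ip (\<Phi> (word_prod V \<mu> * \<iota> a * star (word_prod V \<nu>)) (vac w)) (vac w) =
    (if \<mu> = \<nu> \<and> take (length \<mu>) w = \<mu> then \<tau> (word_endo \<alpha> (rev (drop (length \<mu>) w)) a) else 0)"
proof -
  have "ip (\<Phi> (word_prod V \<mu> * \<iota> a * star (word_prod V \<nu>)) (vac w)) (vac w) =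
      ip (\<Phi> (word_prod V \<mu>) (rep a (\<Phi> (star (word_prod V \<nu>)) (vac w)))) (vac w)"
    using \<Phi> \<Phi>_\<iota> by (simp add: unital_star_hom_def)
  also have "\<dots> = ip (rep a (\<Phi> (star (word_prod V \<nu>)) (vac w)))
      (hilbert.adj (\<Phi> (word_prod V \<mu>)) (vac w))"
    by (intro hilbert.adjoint_pair_ip hilbert.adjoint_pair_adj \<Phi>_operator vac_H
        hilbert.operators_arg_closed rep_operator)
  also have "hilbert.adj (\<Phi> (word_prod V \<mu>)) = \<Phi> (star (word_prod V \<mu>))"
    using \<Phi> by (simp add: unital_star_hom_def)
  also have "ip (rep a (\<Phi> (star (word_prod V \<nu>)) (vac w))) (\<Phi> (star (word_prod V \<mu>)) (vac w)) =
    (if \<mu> = \<nu> \<and> take (length \<mu>) w = \<mu> then \<tau> (word_endo \<alpha> (rev (drop (length \<mu>) w)) a) else 0)"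
  proof (cases "take (length \<mu>) w = \<mu> \<and> take (length \<nu>) w = \<nu>")
    case True
    have "ip (rep a (vac u)) (vac v) = (if u = v then \<tau> (word_endo \<alpha> (rev v) a) else 0)" for u v
      by (simp add: ip_vac hilbert.operators_arg_closed rep_operator)
         (simp add: rep_def comp_operator_apply vac_H rep_map_def vac_apply endo_simps star_star)
    \<comment> \<open>Both words are prefixes of w here, so equal remainders make them equally long
      and hence equal.\<close>
    moreover have "\<mu> = \<nu>" if "drop (length \<nu>) w = drop (length \<mu>) w"
    proof -
      have "length \<mu> \<le> length w" "length \<nu> \<le> length w"
        using True by (metis length_take min.cobounded1)+
      then have "length \<mu> = length \<nu>"
        using arg_cong[OF that, of length] by auto
      then show ?thesis
        using True by metis
    qed
    ultimately show ?thesis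
      using True by (auto simp: \<Phi>_star_word_vac assms)
  next
    case False
    then show ?thesis
      by (auto simp: \<Phi>_star_word_vac assms hilbert.operators_zero_arg[OF rep_operator]
          hilbert.ip_zero_left hilbert.ip_zero_right H_zero hilbert.operators_arg_closed rep_operator
          vac_H)
  qed
  finally show ?thesis .
qed

end

end

section \<open>The states \<open>\<psi>\<^sub>\<tau>\<close>\<close>

abbreviation words_of_length :: "nat \<Rightarrow> nat \<Rightarrow> nat list set" where
  "words_of_length d m \<equiv> {w \<in> words d. length w = m}"

lemma finite_words_of_length: "finite (words_of_length d m)"
  and card_words_of_length: "card (words_of_length d m) = d ^ m"
  using finite_lists_length_eq[of "{..<d}" m] card_lists_length_eq[of "{..<d}" m]
  by (simp_all add: words_def lists_eq_set)

text \<open>The weights (1 - q d) q^|w| add up to 1, there being d^m words of length m. The family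
  \<phi> is arbitrary, since the same estimate also gives the convergence of the series in
  \<open>kms_value\<close>.\<close>

lemma mixture_of_states:
  fixes \<phi> :: "nat list \<Rightarrow> 'b::unital_cstar_algebra \<Rightarrow> complex"
  assumes \<phi>: "\<And>w. \<phi> w \<in> states" and q: "0 \<le> q" "q * real d < 1"
  shows mixture_summable: "summable (\<lambda>m. of_real (q ^ m) * (\<Sum>w\<in>words_of_length d m. \<phi> w x))"
    and mixture_in_states: "(\<lambda>x. of_real (1 - q * real d) *
      (\<Sum>m. of_real (q ^ m) * (\<Sum>w\<in>words_of_length d m. \<phi> w x))) \<in> states"
proof -
  define f where "f x m = complex_of_real (q ^ m) * (\<Sum>w\<in>words_of_length d m. \<phi> w x)" for x m
  define K where "K = complex_of_real (1 - q * real d)"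
  have sm: "summable (f x)" for x
  proof (rule summable_comparison_test)
    show "summable (\<lambda>m. (q * real d) ^ m * norm x)"
      using q by (intro summable_mult2 summable_geometric) simp
    have "norm (f x m) \<le> (q * real d) ^ m * norm x" for m
    proof -
      have "norm (\<Sum>w\<in>words_of_length d m. \<phi> w x) \<le> real (card (words_of_length d m)) * norm x"
        using states_norm_le[OF \<phi>] by (rule sum_norm_bound)
      then have "q ^ m * norm (\<Sum>w\<in>words_of_length d m. \<phi> w x) \<le> q ^ m * (real d ^ m * norm x)"
        using q by (intro mult_left_mono) (simp_all add: card_words_of_length)
      then show ?thesis
        using q by (simp add: f_def norm_mult norm_power power_mult_distrib mult.assoc)
    qed
    then show "\<exists>N. \<forall>m\<ge>N. norm (f x m) \<le> (q * real d) ^ m * norm x"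
      by blast
  qed
  then show "summable (\<lambda>m. of_real (q ^ m) * (\<Sum>w\<in>words_of_length d m. \<phi> w x))"
    by (simp only: f_def[abs_def])
  note lin = positive_functional_add[OF states_positive[OF \<phi>]]
    positive_functional_scaleC[OF states_positive[OF \<phi>]]
  have "f (x + y) = (\<lambda>m. f x m + f y m)" for x y
    by (simp add: f_def fun_eq_iff lin sum.distrib distrib_left)
  then have add: "suminf (f (x + y)) = suminf (f x) + suminf (f y)" for x y
    by (simp only: suminf_add[OF sm sm])
  have "f (c *\<^sub>C x) = (\<lambda>m. c * f x m)" for c x
    by (simp add: f_def fun_eq_iff lin mult.left_commute flip: sum_distrib_left)
  then have scale: "suminf (f (c *\<^sub>C x)) = c * suminf (f x)" for c x
    by (simp only: suminf_mult[OF sm])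
  have pos: "suminf (f (star x * x)) \<in> \<real>\<^sub>\<ge>\<^sub>0" for x
  proof -
    have f_eq: "f (star x * x) =
        (\<lambda>m. of_real (q ^ m * (\<Sum>w\<in>words_of_length d m. Re (\<phi> w (star x * x)))))"
      by (rule ext) (simp add: f_def complex_eq_iff positive_functional_Im[OF states_positive[OF \<phi>]])
    then have sums: "(\<lambda>m. complex_of_real (q ^ m * (\<Sum>w\<in>words_of_length d m. Re (\<phi> w (star x * x)))))
        sums suminf (f (star x * x))"
      using summable_sums[OF sm[of "star x * x"]] by (simp only: f_eq)
    have "0 \<le> Re (suminf (f (star x * x)))"
    proof (rule sums_le[OF _ sums_zero])
      show "(\<lambda>m. q ^ m * (\<Sum>w\<in>words_of_length d m. Re (\<phi> w (star x * x))))
          sums Re (suminf (f (star x * x)))"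
        using sums_Re[OF sums] by (simp only: Re_complex_of_real)
      show "0 \<le> q ^ m * (\<Sum>w\<in>words_of_length d m. Re (\<phi> w (star x * x)))" for m
        using q by (intro mult_nonneg_nonneg sum_nonneg
            positive_functional_Re_nonneg[OF states_positive[OF \<phi>]]) simp
    qed
    moreover have "Im (suminf (f (star x * x))) = 0"
      using sums_unique2[OF sums_Im[OF sums, unfolded Im_complex_of_real] sums_zero] .
    ultimately show ?thesis
      by (simp add: complex_nonneg_Reals_iff)
  qed
  have "f 1 = (\<lambda>m. of_real ((q * real d) ^ m))"
    by (simp add: f_def fun_eq_iff states_one[OF \<phi>] card_words_of_length power_mult_distrib)
  moreover have "(\<lambda>m. (q * real d) ^ m) sums (1 / (1 - q * real d))"
    using q by (intro geometric_sums) simp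
  then have "(\<lambda>m. complex_of_real ((q * real d) ^ m)) sums of_real (1 / (1 - q * real d))"
    by (rule sums_of_real)
  ultimately have "suminf (f 1) = of_real (1 / (1 - q * real d))"
    by (simp only: sums_iff)
  then have one: "K * suminf (f 1) = 1"
    using q unfolding K_def by (simp flip: of_real_mult)
  have "K \<in> \<real>\<^sub>\<ge>\<^sub>0"
    unfolding K_def nonneg_Reals_of_real_iff using q by simp
  then have "K * suminf (f (star x * x)) \<in> \<real>\<^sub>\<ge>\<^sub>0" for x
    using pos by (rule nonneg_Reals_mult_I)
  then have "(\<lambda>x. K * suminf (f x)) \<in> states"
    using one by (simp add: states_def add scale distrib_left mult_ac)
  then show "(\<lambda>x. of_real (1 - q * real d) *
      (\<Sum>m. of_real (q ^ m) * (\<Sum>w\<in>words_of_length d m. \<phi> w x))) \<in> states"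
    by (simp only: K_def f_def[abs_def])
qed

definition kms_value :: "nat \<Rightarrow> (nat \<Rightarrow> 'a::unital_cstar_algebra \<Rightarrow> 'a) \<Rightarrow> real \<Rightarrow> ('a \<Rightarrow> complex) \<Rightarrow>
    nat \<Rightarrow> 'a \<Rightarrow> complex" where
  "kms_value d \<alpha> \<beta> \<tau> n a = of_real (1 - exp (- \<beta>) * real d) *
     (\<Sum>m. of_real (exp (- (real (m + n) * \<beta>))) *
       (\<Sum>w\<in>words_of_length d m. \<tau> (word_endo \<alpha> (rev w) a)))"

definition has_kms_values :: "nat \<Rightarrow> (nat \<Rightarrow> 'a::unital_cstar_algebra \<Rightarrow> 'a) \<Rightarrow>
    ('a \<Rightarrow> 'b::unital_cstar_algebra) \<Rightarrow> (nat \<Rightarrow> 'b) \<Rightarrow> real \<Rightarrow> ('a \<Rightarrow> complex) \<Rightarrow> ('b \<Rightarrow> complex) \<Rightarrow> bool"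
  where
  "has_kms_values d \<alpha> \<iota> V \<beta> \<tau> \<psi> \<longleftrightarrow> (\<forall>a. \<forall>\<mu>\<in>words d. \<forall>\<nu>\<in>words d.
     \<psi> (word_prod V \<mu> * \<iota> a * star (word_prod V \<nu>)) =
       (if \<mu> = \<nu> then kms_value d \<alpha> \<beta> \<tau> (length \<mu>) a else 0))"

lemma exp_mult_less_1:
  assumes "1 \<le> d" and "\<beta> > ln (real d)"
  shows "exp (- \<beta>) * real d < 1"
proof -
  have "real d < exp \<beta>"
    using assms by (metis exp_less_mono exp_ln_iff of_nat_0_less_iff order_less_le_trans zero_less_one)
  then show ?thesis
    by (simp add: exp_minus field_simps)
qed

lemma toeplitz_pimsner_universal:
  fixes D :: "'c cstar"
  assumes "toeplitz_pimsner TYPE('c) d \<alpha> \<iota> V"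
    and "carrier_cstar_algebra D" and "covariant_pair d \<alpha> D \<rho> W"
  shows "\<exists>\<Phi>. unital_star_hom D \<Phi> \<and> (\<forall>a. \<Phi> (\<iota> a) = \<rho> a) \<and> (\<forall>i<d. \<Phi> (V i) = W i)"
  using assms(1)[unfolded toeplitz_pimsner_def, THEN conjunct2, THEN conjunct2, rule_format,
      OF conjI[OF assms(2,3)]] .

text \<open>In the vector state of w the element V_\<mu> a V_\<mu>^* is seen only if w = \<mu> @ v,
  and then through v. The mixture over w thus becomes a series over v whose weights carry the extra
  factor q^|\<mu>|.\<close>

lemma exists_state_with_kms_values:
  fixes \<alpha> :: "nat \<Rightarrow> 'a::unital_cstar_algebra \<Rightarrow> 'a"
  assumes sys: "cstar_dynamical_system d \<alpha>" and tp: "toeplitz_pimsner TYPE('a universe) d \<alpha> \<iota> V"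
    and \<beta>: "\<beta> > ln (real d)" and \<tau>: "\<tau> \<in> states"
  shows "\<exists>\<psi>\<in>states. has_kms_values d \<alpha> \<iota> V \<beta> \<tau> \<psi>"
proof -
  \<comment> \<open>\<open>fock_space\<close> wants an endomorphism for every letter; the identity
    fills the indices from d on, and \<open>endo_eq\<close> shows that words in
    \<open>words d\<close> do not see it.\<close>
  define \<alpha>' where "\<alpha>' i = (if i < d then \<alpha> i else id)" for i
  interpret fock_space \<alpha>' \<tau>
    using sys \<tau>
    by unfold_locales (auto simp: \<alpha>'_def cstar_dynamical_system_def unital_star_hom_id)
  have "covariant_pair d \<alpha> hilbert.operator_algebra rep creation"
    using covariant_pair_fock[of d] by (simp add: covariant_pair_def \<alpha>'_def)
  then obtain \<Phi> where \<Phi>: "unital_star_hom hilbert.operator_algebra \<Phi>" "\<And>a. \<Phi> (\<iota> a) = rep a"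
      "\<And>i. i < d \<Longrightarrow> \<Phi> (V i) = creation i"
    using toeplitz_pimsner_universal[OF tp hilbert.carrier_cstar_algebra_operators] by blast
  define \<phi> where "\<phi> w x = ip (\<Phi> x (vac w)) (vac w)" for w x
  have \<phi>: "\<phi> w \<in> states" for w
    unfolding \<phi>_def by (rule hilbert.vector_state[OF \<Phi>(1) vac_H hnorm_vac])
  define q where "q = exp (- \<beta>)"
  have q: "0 \<le> q" "q * real d < 1"
    using exp_mult_less_1[of d \<beta>] sys \<beta> by (auto simp: q_def cstar_dynamical_system_def)
  have q_power: "q ^ m = exp (- (real m * \<beta>))" for m
    by (simp add: q_def flip: exp_of_nat_mult)
  define \<psi> where "\<psi> x = of_real (1 - q * real d) *
      (\<Sum>m. of_real (q ^ m) * (\<Sum>w\<in>words_of_length d m. \<phi> w x))" for x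
  have \<psi>: "\<psi> \<in> states"
    unfolding \<psi>_def using \<phi> q by (rule mixture_in_states)
  have endo_eq: "word_endo \<alpha>' (rev w) = word_endo \<alpha> (rev w)" if "w \<in> words d" for w
    using that by (induction w) (auto simp: words_def word_endo_append \<alpha>'_def)
  have "\<psi> (word_prod V \<mu> * \<iota> a * star (word_prod V \<nu>)) =
      (if \<mu> = \<nu> then kms_value d \<alpha> \<beta> \<tau> (length \<mu>) a else 0)"
    if \<mu>: "\<mu> \<in> words d" and \<nu>: "\<nu> \<in> words d" for a \<mu> \<nu>
  proof (cases "\<mu> = \<nu>")
    case False
    then show ?thesis
      by (simp add: \<psi>_def \<phi>_def ip_\<Phi>_vac[OF \<Phi> \<mu> \<nu>])
  next
    case True
    define x where "x = word_prod V \<mu> * \<iota> a * star (word_prod V \<nu>)"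
    define n where "n = length \<mu>"
    \<comment> \<open>f is the series of \<psi> x, which starts at m = n, and g is the same series
      with its index lowered by n.\<close>
    define f where "f m = complex_of_real (q ^ m) * (\<Sum>w\<in>words_of_length d m. \<phi> w x)" for m
    define g where "g m = complex_of_real (q ^ (m + n)) *
        (\<Sum>w\<in>words_of_length d m. \<tau> (word_endo \<alpha> (rev w) a))" for m
    have val: "\<phi> w x = (if take n w = \<mu> then \<tau> (word_endo \<alpha>' (rev (drop n w)) a) else 0)" for w
      using ip_\<Phi>_vac[OF \<Phi> \<mu> \<nu>, of a w] True by (simp add: \<phi>_def x_def n_def)
    have "f m = 0" if "m < n" for m
      using that by (auto simp: f_def val n_def intro!: sum.neutral split: if_splits)
    moreover have "f (m + n) = g m" for m
    proof -
      have "(\<Sum>w\<in>words_of_length d (m + n). \<phi> w x) = (\<Sum>w\<in>(@) \<mu> ` words_of_length d m. \<phi> w x)"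
      proof (rule sum.mono_neutral_right)
        show "(@) \<mu> ` words_of_length d m \<subseteq> words_of_length d (m + n)"
          using \<mu> by (auto simp: words_def n_def)
        show "\<forall>w\<in>words_of_length d (m + n) - (@) \<mu> ` words_of_length d m. \<phi> w x = 0"
        proof
          fix w
          assume w: "w \<in> words_of_length d (m + n) - (@) \<mu> ` words_of_length d m"
          have "take n w \<noteq> \<mu>"
          proof
            assume "take n w = \<mu>"
            then have "w = \<mu> @ drop n w"
              by (metis append_take_drop_id)
            moreover have "drop n w \<in> words_of_length d m"
              using w by (auto simp: words_def dest: in_set_dropD)
            ultimately show False
              using w by blast
          qed
          then show "\<phi> w x = 0"
            by (simp add: val)
        qed
      qed (rule finite_words_of_length)
      also have "\<dots> = (\<Sum>w\<in>words_of_length d m. \<tau> (word_endo \<alpha> (rev w) a))"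
        by (subst sum.reindex) (auto simp: val n_def endo_eq inj_on_def)
      finally show ?thesis
        by (simp add: f_def g_def)
    qed
    \<comment> \<open>An equivalence of \<open>sums\<close> for every s gives equality of the two
      \<open>suminf\<close> without a separate proof of convergence.\<close>
    ultimately have "g sums s \<longleftrightarrow> f sums s" for s
      using sums_zero_iff_shift[of n f s] by simp
    then have fg: "suminf f = suminf g"
      by (simp add: suminf_def)
    have "\<psi> x = of_real (1 - q * real d) * suminf f"
      by (simp only: \<psi>_def f_def[abs_def])
    also have "\<dots> = kms_value d \<alpha> \<beta> \<tau> (length \<mu>) a"
      unfolding fg kms_value_def g_def[abs_def] n_def q_power unfolding q_def by (rule refl)
    finally show ?thesis
      using True by (simp add: x_def)
  qed
  then show ?thesis
    unfolding has_kms_values_def by (intro bexI[OF _ \<psi>] allI ballI)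
qed

section \<open>The dense subalgebra of monomials\<close>

lemma word_prod_append: "word_prod V (u @ v) = word_prod V u * word_prod V v"
  by (induction u) (simp_all add: mult.assoc)

lemma words_Cons_iff [simp]: "i # w \<in> words d \<longleftrightarrow> i < d \<and> w \<in> words d"
  and words_append_iff [simp]: "u @ v \<in> words d \<longleftrightarrow> u \<in> words d \<and> v \<in> words d"
  and words_Nil [simp]: "[] \<in> words d"
  by (auto simp: words_def)

lemma linear_image_span_subset:
  assumes "linear f" and "\<And>x. x \<in> S \<Longrightarrow> f x \<in> span T" and "x \<in> span S"
  shows "f x \<in> span T"
proof -
  have "f ` span S = span (f ` S)"
    using assms(1) by (simp add: linear_span_image)
  also have "\<dots> \<subseteq> span T"
    using assms(2) by (intro span_minimal) auto
  finally show ?thesis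
    using assms(3) by blast
qed

lemma star_subalgebra_closure:
  assumes "star_subalgebra B"
  shows "star_subalgebra (closure B)"
  unfolding star_subalgebra_def
proof (intro conjI ballI allI)
  note B = assms[unfolded star_subalgebra_def]
  show "0 \<in> closure B"
    using B closure_subset by blast
  fix x
  assume "x \<in> closure B"
  then obtain u where u: "\<And>n. u n \<in> B" "u \<longlonglongrightarrow> x"
    by (auto simp: closure_sequential)
  show "c *\<^sub>C x \<in> closure B" for c
    using bounded_linear.tendsto[OF bounded_linear_scaleC u(2)] B u(1)
    unfolding closure_sequential by (intro exI[of _ "\<lambda>n. c *\<^sub>C u n"]) auto
  show "star x \<in> closure B"
    using bounded_linear.tendsto[OF bounded_linear_star u(2)] B u(1)
    unfolding closure_sequential by (intro exI[of _ "\<lambda>n. star (u n)"]) auto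
  fix y
  assume "y \<in> closure B"
  then obtain v where v: "\<And>n. v n \<in> B" "v \<longlonglongrightarrow> y"
    by (auto simp: closure_sequential)
  show "x + y \<in> closure B"
    using tendsto_add[OF u(2) v(2)] B u(1) v(1)
    unfolding closure_sequential by (intro exI[of _ "\<lambda>n. u n + v n"]) auto
  show "x * y \<in> closure B"
    using tendsto_mult[OF u(2) v(2)] B u(1) v(1)
    unfolding closure_sequential by (intro exI[of _ "\<lambda>n. u n * v n"]) auto
qed

text \<open>The bound is applied to the states \<phi> \<circ> f and \<phi> \<circ> g, so
  contractivity of homomorphisms is never invoked. With f = \<sigma>_t it controls
  \<psi>(\<sigma>_t(u) y) uniformly in t.\<close>

lemma states_mult_hom_le:
  assumes "\<phi> \<in> states" and f: "unital_star_hom class_cstar f" and g: "unital_star_hom class_cstar g"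
  shows "cmod (\<phi> (f x * g y)) \<le> norm x * norm y"
proof -
  have "cmod (\<phi> (f x * g y)) \<le>
      sqrt (Re (\<phi> (f x * star (f x)))) * sqrt (Re (\<phi> (star (g y) * g y)))"
    by (rule states_mult_le[OF assms(1)])
  also have "\<dots> \<le> norm x * norm y"
  proof (rule mult_mono)
    show "sqrt (Re (\<phi> (f x * star (f x)))) \<le> norm x"
      using states_square_le[OF states_comp_hom[OF assms(1) f], of "star x"] f
      by (simp add: unital_star_hom_def star_star)
    show "sqrt (Re (\<phi> (star (g y) * g y))) \<le> norm y"
      using states_square_le[OF states_comp_hom[OF assms(1) g], of y] g
      by (simp add: unital_star_hom_def)
    show "0 \<le> sqrt (Re (\<phi> (star (g y) * g y)))"
      using positive_functional_Re_nonneg[OF states_positive[OF assms(1)]] by simp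
  qed simp
  finally show ?thesis .
qed

lemma bounded_linear_states_mult:
  assumes "\<phi> \<in> states" and f: "unital_star_hom class_cstar f"
  shows "bounded_linear (\<lambda>x. \<phi> (y * f x))" and "bounded_linear (\<lambda>x. \<phi> (f x * y))"
proof -
  note lin = positive_functional_add[OF states_positive[OF assms(1)]]
    positive_functional_scaleR[OF states_positive[OF assms(1)]]
  have "f (x + z) = f x + f z" "f (r *\<^sub>R x) = r *\<^sub>R f x" for x z r
    using f by (auto simp: unital_star_hom_def simp flip: scaleC_of_real)
  then show "bounded_linear (\<lambda>x. \<phi> (y * f x))" "bounded_linear (\<lambda>x. \<phi> (f x * y))"
    using states_mult_hom_le[OF assms(1) unital_star_hom_id f, of y]
      states_mult_hom_le[OF assms(1) f unital_star_hom_id, of _ y]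
    by (auto intro!: bounded_linear_intro[where K = "norm y"]
        simp: lin distrib_left distrib_right scaleR_conv_of_real[where 'a = complex] mult.commute)
qed

locale toeplitz_pimsner_system =
  fixes d :: nat
    and \<alpha> :: "nat \<Rightarrow> 'a::unital_cstar_algebra \<Rightarrow> 'a"
    and \<iota> :: "'a \<Rightarrow> 'b::unital_cstar_algebra"
    and V :: "nat \<Rightarrow> 'b"
    and \<gamma> :: "complex \<Rightarrow> 'b \<Rightarrow> 'b"
    and \<sigma> :: "real \<Rightarrow> 'b \<Rightarrow> 'b"
    and \<beta> :: real
  assumes sys: "cstar_dynamical_system d \<alpha>"
    and tp: "toeplitz_pimsner TYPE('a universe) d \<alpha> \<iota> V"
    and gauge: "gauge_action d \<iota> V \<gamma>"
    and \<sigma>_eq: "\<And>t. \<sigma> t = \<gamma> (exp (\<i> * complex_of_real t))"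
    and \<beta>: "\<beta> > ln (real d)"
begin

lemma d_ge_1: "1 \<le> d"
  using sys by (simp add: cstar_dynamical_system_def)

lemma \<alpha>_hom: "i < d \<Longrightarrow> unital_star_hom class_cstar (\<alpha> i)"
  using sys by (simp add: cstar_dynamical_system_def)

lemma endo_hom: "w \<in> words d \<Longrightarrow> unital_star_hom class_cstar (word_endo \<alpha> (rev w))"
  by (rule unital_star_hom_word_endo) (auto simp: words_def \<alpha>_hom)

lemma covariant: "covariant_pair d \<alpha> class_cstar \<iota> V"
  using tp by (simp add: toeplitz_pimsner_def)

lemma \<iota>_hom: "unital_star_hom class_cstar \<iota>"
  using covariant by (simp add: covariant_pair_def)

lemma \<iota>_simps: "\<iota> (x + y) = \<iota> x + \<iota> y" "\<iota> (c *\<^sub>C x) = c *\<^sub>C \<iota> x" "\<iota> (x * y) = \<iota> x * \<iota> y"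
  "\<iota> (star x) = star (\<iota> x)" "\<iota> 1 = 1"
  using \<iota>_hom by (auto simp: unital_star_hom_def)

lemma \<iota>_zero: "\<iota> 0 = 0"
  using \<iota>_simps(1)[of 0 0] by simp

lemma V_orthonormal: "i < d \<Longrightarrow> j < d \<Longrightarrow> star (V i) * V j = (if i = j then 1 else 0)"
  using covariant by (auto simp: covariant_pair_def)

lemma \<iota>_V: "i < d \<Longrightarrow> \<iota> a * V i = V i * \<iota> (\<alpha> i a)"
  using covariant by (auto simp: covariant_pair_def)

lemma V_star_\<iota>: "i < d \<Longrightarrow> star (V i) * \<iota> a = \<iota> (\<alpha> i a) * star (V i)"
  using arg_cong[OF \<iota>_V[of i "star a"], of star] \<alpha>_hom[of i]
  by (simp add: star_mult \<iota>_simps star_star unital_star_hom_def)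

lemma \<iota>_word: "\<mu> \<in> words d \<Longrightarrow>
    \<iota> a * word_prod V \<mu> = word_prod V \<mu> * \<iota> (word_endo \<alpha> (rev \<mu>) a)"
proof (induction \<mu> arbitrary: a)
  case (Cons i \<mu>)
  have "\<iota> a * word_prod V (i # \<mu>) = V i * (\<iota> (\<alpha> i a) * word_prod V \<mu>)"
    using Cons.prems by (simp add: \<iota>_V flip: mult.assoc)
  then show ?case
    using Cons by (simp add: word_endo_append mult.assoc)
qed simp

lemma word_star_\<iota>:
  assumes "\<mu> \<in> words d"
  shows "star (word_prod V \<mu>) * \<iota> a = \<iota> (word_endo \<alpha> (rev \<mu>) a) * star (word_prod V \<mu>)"
  using arg_cong[OF \<iota>_word[OF assms, of "star a"], of star] endo_hom[OF assms]
  by (simp add: star_mult \<iota>_simps star_star unital_star_hom_def)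

lemma word_orthonormal:
  assumes "\<mu> \<in> words d" "\<nu> \<in> words d" "length \<mu> = length \<nu>"
  shows "star (word_prod V \<nu>) * word_prod V \<mu> = (if \<mu> = \<nu> then 1 else 0)"
  using assms(3,1,2)
proof (induction \<mu> \<nu> rule: list_induct2)
  case (Cons i \<mu> j \<nu>)
  have "star (word_prod V (j # \<nu>)) * word_prod V (i # \<mu>) =
      star (word_prod V \<nu>) * (star (V j) * V i) * word_prod V \<mu>"
    by (simp add: star_mult mult.assoc)
  then show ?case
    using Cons by (cases "\<mu> = \<nu>") (auto simp: V_orthonormal)
qed simp

definition monomial :: "nat list \<Rightarrow> 'a \<Rightarrow> nat list \<Rightarrow> 'b" where
  "monomial \<mu> a \<nu> = word_prod V \<mu> * \<iota> a * star (word_prod V \<nu>)"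

text \<open>The coefficient a absorbs complex scalars, so the real span of this set is already a
  complex subspace.\<close>

definition monomials :: "'b set" where
  "monomials = {monomial \<mu> a \<nu> | \<mu> a \<nu>. \<mu> \<in> words d \<and> \<nu> \<in> words d}"

lemma monomialsI: "\<mu> \<in> words d \<Longrightarrow> \<nu> \<in> words d \<Longrightarrow> monomial \<mu> a \<nu> \<in> monomials"
  by (auto simp: monomials_def)

lemma monomialsE:
  assumes "x \<in> monomials"
  obtains \<mu> a \<nu> where "x = monomial \<mu> a \<nu>" "\<mu> \<in> words d" "\<nu> \<in> words d"
  using assms by (auto simp: monomials_def)

lemma monomial_scaleC: "c *\<^sub>C monomial \<mu> a \<nu> = monomial \<mu> (c *\<^sub>C a) \<nu>"
  by (simp add: monomial_def \<iota>_simps mult_scaleC_left mult_scaleC_right)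

lemma monomial_star: "star (monomial \<mu> a \<nu>) = monomial \<nu> (star a) \<mu>"
  by (simp add: monomial_def star_mult star_star \<iota>_simps mult.assoc)

lemma monomial_\<iota>: "monomial [] a [] = \<iota> a"
  by (simp add: monomial_def)

lemma monomial_zero: "monomial \<mu> 0 \<nu> = 0"
  by (simp add: monomial_def \<iota>_zero)

lemma \<iota>_monomial: "\<mu> \<in> words d \<Longrightarrow> \<iota> b * monomial \<mu> a \<nu> = monomial \<mu> (word_endo \<alpha> (rev \<mu>) b * a) \<nu>"
  by (simp add: monomial_def \<iota>_simps \<iota>_word flip: mult.assoc)

lemma monomial_\<iota>_right: "\<nu> \<in> words d \<Longrightarrow> monomial \<mu> a \<nu> * \<iota> b = monomial \<mu> (a * word_endo \<alpha> (rev \<nu>) b) \<nu>"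
  by (simp add: monomial_def \<iota>_simps word_star_\<iota> mult.assoc)

lemma V_monomial: "V i * monomial \<mu> a \<nu> = monomial (i # \<mu>) a \<nu>"
  by (simp add: monomial_def mult.assoc)

lemma monomial_V: "i < d \<Longrightarrow> \<nu> \<in> words d \<Longrightarrow> monomial \<mu> a \<nu> * V i =
    (case \<nu> of [] \<Rightarrow> monomial (\<mu> @ [i]) (\<alpha> i a) [] | j # \<kappa> \<Rightarrow> if j = i then monomial \<mu> a \<kappa> else 0)"
  by (auto simp: monomial_def star_mult mult.assoc \<iota>_V V_orthonormal word_prod_append split: list.splits)

lemma V_star_monomial_in:
  assumes "i < d" "\<mu> \<in> words d" "\<nu> \<in> words d"
  shows "star (V i) * monomial \<mu> a \<nu> \<in> monomials"
proof -
  have "star (V i) * monomial \<mu> a \<nu> = star (monomial \<nu> (star a) \<mu> * V i)"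
    by (simp add: star_mult monomial_star star_star)
  also have "\<dots> \<in> monomials"
    using assms monomialsI monomial_zero[of "[]" "[]"] monomialsI[of "[]" "[]" 0]
    by (auto simp: monomial_V monomial_star split: list.splits)
  finally show ?thesis .
qed

lemma monomials_V: "i < d \<Longrightarrow> V i = monomial [i] 1 []"
  by (simp add: monomial_def \<iota>_simps)

text \<open>Left multiplication by a single V_i, star (V_i) or \<iota> a sends monomials to
  monomials, zero included. Iterating this over the factors of a monomial avoids comparing the two
  inner words of a product.\<close>

lemma span_monomials_mult:
  assumes "x \<in> span monomials" and "y \<in> span monomials"
  shows "x * y \<in> span monomials"
proof -
  have left: "g * z \<in> span monomials"
    if g: "\<And>\<mu> a \<nu>. \<mu> \<in> words d \<Longrightarrow> \<nu> \<in> words d \<Longrightarrow> g * monomial \<mu> a \<nu> \<in> monomials"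
      and z: "z \<in> span monomials" for g z
  proof (rule linear_image_span_subset[OF bounded_linear.linear[OF bounded_linear_mult_right] _ z])
    show "g * x \<in> span monomials" if "x \<in> monomials" for x
      using that by (elim monomialsE) (simp add: span_base g)
  qed
  have word: "word_prod V \<mu> * z \<in> span monomials" if "\<mu> \<in> words d" "z \<in> span monomials" for \<mu> z
    using that
  proof (induction \<mu>)
    case (Cons i \<mu>)
    then show ?case
      using left[of "V i"] by (simp add: V_monomial monomialsI mult.assoc)
  qed simp
  have star_word: "star (word_prod V \<mu>) * z \<in> span monomials" if "\<mu> \<in> words d" "z \<in> span monomials" for \<mu> z
    using that
  proof (induction \<mu> arbitrary: z)
    case (Cons i \<mu>)
    then show ?case
      using left[of "star (V i)" z] by (simp add: V_star_monomial_in star_mult mult.assoc)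
  qed simp
  have iota: "\<iota> a * z \<in> span monomials" if "z \<in> span monomials" for a z
    using left[of "\<iota> a" z] that by (simp add: \<iota>_monomial monomialsI)
  show ?thesis
  proof (rule linear_image_span_subset[OF bounded_linear.linear[OF bounded_linear_mult_left] _ assms(1)])
    show "x * y \<in> span monomials" if "x \<in> monomials" for x
      using that
      by (elim monomialsE) (simp add: monomial_def mult.assoc word star_word iota assms(2))
  qed
qed

lemma star_subalgebra_span_monomials: "star_subalgebra (span monomials)"
  unfolding star_subalgebra_def
proof (intro conjI ballI allI)
  fix x
  assume x: "x \<in> span monomials"
  show "c *\<^sub>C x \<in> span monomials" for c
    by (rule linear_image_span_subset[OF bounded_linear.linear[OF bounded_linear_scaleC] _ x])
       (auto simp: monomial_scaleC elim!: monomialsE intro!: span_base monomialsI)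
  show "star x \<in> span monomials"
    by (rule linear_image_span_subset[OF bounded_linear.linear[OF bounded_linear_star] _ x])
       (auto simp: monomial_star elim!: monomialsE intro!: span_base monomialsI)
qed (auto simp: span_add span_zero span_monomials_mult)

lemma closure_span_monomials: "closure (span monomials) = UNIV"
proof -
  have "range \<iota> \<subseteq> span monomials" "V ` {..<d} \<subseteq> span monomials"
    by (auto simp: monomials_V simp flip: monomial_\<iota> intro!: span_base monomialsI)
  then have "range \<iota> \<subseteq> closure (span monomials)" "V ` {..<d} \<subseteq> closure (span monomials)"
    using closure_subset by blast+
  moreover have "\<And>B. star_subalgebra B \<Longrightarrow> closed B \<Longrightarrow> range \<iota> \<subseteq> B \<Longrightarrow> V ` {..<d} \<subseteq> B \<Longrightarrow> B = UNIV"
    using tp by (simp add: toeplitz_pimsner_def)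
  ultimately show ?thesis
    using star_subalgebra_closure[OF star_subalgebra_span_monomials] by simp
qed

lemma bounded_linear_eq_on_monomials:
  fixes f g :: "'b \<Rightarrow> complex"
  assumes f: "bounded_linear f" and g: "bounded_linear g"
    and eq: "\<And>\<mu> a \<nu>. \<mu> \<in> words d \<Longrightarrow> \<nu> \<in> words d \<Longrightarrow> f (monomial \<mu> a \<nu>) = g (monomial \<mu> a \<nu>)"
  shows "f x = g x"
proof -
  have "closed {x. f x = g x}"
    by (intro closed_Collect_eq linear_continuous_on f g)
  moreover have "span monomials \<subseteq> {x. f x = g x}"
    using linear_eq_on_span[OF bounded_linear.linear[OF f] bounded_linear.linear[OF g], of monomials] eq
    by (auto simp: monomials_def)
  ultimately have "closure (span monomials) \<subseteq> {x. f x = g x}"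
    by (intro closure_minimal)
  then show ?thesis
    by (auto simp: closure_span_monomials)
qed

section \<open>The KMS condition on homogeneous elements\<close>

text \<open>The KMS identity for an element of degree k, on which \<sigma>_{i\<beta>} is
  multiplication by e^(-k\<beta>). The second element is arbitrary in the whole algebra, and degrees
  are real so that they can be added and negated.\<close>

definition twisted :: "('b \<Rightarrow> complex) \<Rightarrow> 'b \<Rightarrow> real \<Rightarrow> bool" where
  "twisted \<psi> x k \<longleftrightarrow> (\<forall>y. \<psi> (x * y) = of_real (exp (- (k * \<beta>))) * \<psi> (y * x))"

lemma twisted_mult:
  assumes "twisted \<psi> x k" and "twisted \<psi> y l"
  shows "twisted \<psi> (x * y) (k + l)"
proof -
  have "\<psi> (x * y * z) = of_real (exp (- (k * \<beta>))) * (of_real (exp (- (l * \<beta>))) * \<psi> (z * (x * y)))" for z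
    using assms unfolding twisted_def by (metis mult.assoc)
  moreover have "exp (- ((k + l) * \<beta>)) = exp (- (k * \<beta>)) * exp (- (l * \<beta>))"
    by (simp add: algebra_simps flip: exp_add)
  ultimately show ?thesis
    by (simp add: twisted_def mult.assoc)
qed

lemma twisted_star:
  assumes "\<psi> \<in> states" and "twisted \<psi> x k"
  shows "twisted \<psi> (star x) (- k)"
  unfolding twisted_def
proof
  fix y
  note herm = positive_functional_star[OF states_positive[OF assms(1)]]
  have "\<psi> (y * star x) = cnj (\<psi> (x * star y))"
    using herm[of "x * star y"] by (simp add: star_mult star_star)
  also have "\<dots> = of_real (exp (- (k * \<beta>))) * cnj (\<psi> (star y * x))"
    using assms(2) by (simp add: twisted_def)
  also have "cnj (\<psi> (star y * x)) = \<psi> (star x * y)"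
    using herm[of "star y * x"] by (simp add: star_mult star_star)
  finally show "\<psi> (star x * y) = of_real (exp (- (- k * \<beta>))) * \<psi> (y * star x)"
    by (simp add: exp_minus flip: of_real_mult mult.assoc)
qed

text \<open>Twisted elements multiply with added degrees and have twisted adjoints of opposite
  degree, so the generators decide for all monomials.\<close>

lemma twisted_monomial:
  assumes \<psi>: "\<psi> \<in> states" and \<iota>: "\<And>a. twisted \<psi> (\<iota> a) 0" and V: "\<And>i. i < d \<Longrightarrow> twisted \<psi> (V i) 1"
    and "\<mu> \<in> words d" "\<nu> \<in> words d"
  shows "twisted \<psi> (monomial \<mu> a \<nu>) (real (length \<mu>) - real (length \<nu>))"
proof -
  have word: "twisted \<psi> (word_prod V \<mu>) (real (length \<mu>))" if "\<mu> \<in> words d" for \<mu>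
    using that
  proof (induction \<mu>)
    case Nil
    then show ?case by (simp add: twisted_def)
  next
    case (Cons i \<mu>)
    then show ?case
      using twisted_mult[OF V[of i], of "word_prod V \<mu>"] by simp
  qed
  show ?thesis
    using twisted_mult[OF twisted_mult[OF word[OF assms(4)] \<iota>]
        twisted_star[OF \<psi> word[OF assms(5)]]]
    by (simp add: monomial_def)
qed

section \<open>The prescribed values imply the KMS identity\<close>

lemma summable_kms_value:
  assumes "\<tau> \<in> states"
  shows "summable (\<lambda>m. of_real (exp (- (real (m + n) * \<beta>))) *
    (\<Sum>w\<in>words_of_length d m. \<tau> (word_endo \<alpha> (rev w) a)))"
proof -
  \<comment> \<open>The mixture lemma needs a state for every list; \<tau> fills in for lists with
    foreign letters, which the sums never reach.\<close>
  define \<phi> where "\<phi> w = (if w \<in> words d then \<tau> \<circ> word_endo \<alpha> (rev w) else \<tau>)" for w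
  have \<phi>: "\<phi> w \<in> states" for w
    using assms by (simp add: \<phi>_def states_comp_hom endo_hom)
  have "summable (\<lambda>m. complex_of_real (exp (- (real n * \<beta>))) *
      (of_real (exp (- \<beta>) ^ m) * (\<Sum>w\<in>words_of_length d m. \<phi> w a)))"
    using exp_mult_less_1[OF d_ge_1 \<beta>] by (intro summable_mult mixture_summable[of \<phi>] \<phi>) auto
  moreover have "(\<Sum>w\<in>words_of_length d m. \<phi> w a) =
      (\<Sum>w\<in>words_of_length d m. \<tau> (word_endo \<alpha> (rev w) a))" for m
    by (rule sum.cong) (auto simp: \<phi>_def)
  moreover have "exp (- (real (m + n) * \<beta>)) = exp (- (real n * \<beta>)) * exp (- \<beta>) ^ m" for m
    by (simp add: algebra_simps flip: exp_of_nat_mult exp_add)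
  ultimately show ?thesis
    by (simp add: mult.assoc)
qed

lemma kms_value_add_length:
  assumes "\<tau> \<in> states"
  shows "kms_value d \<alpha> \<beta> \<tau> (n + l) a = of_real (exp (- (real l * \<beta>))) * kms_value d \<alpha> \<beta> \<tau> n a"
proof -
  have "exp (- (real (m + (n + l)) * \<beta>)) = exp (- (real l * \<beta>)) * exp (- (real (m + n) * \<beta>))" for m
    by (simp add: algebra_simps flip: exp_add)
  then show ?thesis
    using suminf_mult[OF summable_kms_value[OF assms, of n a], of "of_real (exp (- (real l * \<beta>)))"]
    by (simp add: kms_value_def mult_ac del: of_nat_add)
qed

lemma has_kms_values_monomial: "has_kms_values d \<alpha> \<iota> V \<beta> \<tau> \<psi> \<Longrightarrow> \<mu> \<in> words d \<Longrightarrow> \<nu> \<in> words d \<Longrightarrow>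
    \<psi> (monomial \<mu> a \<nu>) = (if \<mu> = \<nu> then kms_value d \<alpha> \<beta> \<tau> (length \<mu>) a else 0)"
  by (auto simp: has_kms_values_def monomial_def)

text \<open>By density y may be a monomial V_\<rho> c V_\<kappa>^*. For \<iota> b the two sides
  differ by the order of a product inside \<tau>, which is where the trace property enters. For V_i
  both sides vanish unless \<kappa> = i # \<rho>, and then the word lengths differ by one, which
  costs one factor e^(-\<beta>).\<close>

lemma twisted_of_kms_values:
  assumes \<psi>: "\<psi> \<in> states" and \<tau>: "\<tau> \<in> tracial_states" and val: "has_kms_values d \<alpha> \<iota> V \<beta> \<tau> \<psi>"
    and "\<mu> \<in> words d" "\<nu> \<in> words d"
  shows "twisted \<psi> (monomial \<mu> a \<nu>) (real (length \<mu>) - real (length \<nu>))"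
proof (rule twisted_monomial[OF \<psi> _ _ assms(4,5)])
  note bl = bounded_linear_compose[OF bounded_linear_states[OF \<psi>]]
  have \<tau>s: "\<tau> \<in> states" and trace: "\<tau> (x * y) = \<tau> (y * x)" for x y
    using \<tau> by (auto simp: tracial_states_def)
  have zero: "\<psi> 0 = 0"
    by (rule positive_functional_zero[OF states_positive[OF \<psi>]])
  show "twisted \<psi> (\<iota> b) 0" for b
    unfolding twisted_def
  proof
    fix y
    have "\<psi> (\<iota> b * y) = \<psi> (y * \<iota> b)"
    proof (rule bounded_linear_eq_on_monomials[of "\<lambda>y. \<psi> (\<iota> b * y)" "\<lambda>y. \<psi> (y * \<iota> b)"])
      fix \<rho> c \<kappa>
      assume w: "\<rho> \<in> words d" "\<kappa> \<in> words d"
      have "kms_value d \<alpha> \<beta> \<tau> (length \<rho>) (word_endo \<alpha> (rev \<rho>) b * c) =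
          kms_value d \<alpha> \<beta> \<tau> (length \<rho>) (c * word_endo \<alpha> (rev \<rho>) b)"
      proof -
        have "\<tau> (word_endo \<alpha> (rev u) (x * y)) = \<tau> (word_endo \<alpha> (rev u) (y * x))"
          if "u \<in> words d" for u x y
          using endo_hom[OF that] trace by (simp add: unital_star_hom_def)
        then show ?thesis
          by (simp add: kms_value_def)
      qed
      then show "\<psi> (\<iota> b * monomial \<rho> c \<kappa>) = \<psi> (monomial \<rho> c \<kappa> * \<iota> b)"
        using w by (auto simp: \<iota>_monomial monomial_\<iota>_right has_kms_values_monomial[OF val])
    qed (intro bl bounded_linear_mult_left bounded_linear_mult_right)+
    then show "\<psi> (\<iota> b * y) = of_real (exp (- (0 * \<beta>))) * \<psi> (y * \<iota> b)"
      by simp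
  qed
  show "twisted \<psi> (V i) 1" if i: "i < d" for i
    unfolding twisted_def
  proof
    fix y
    show "\<psi> (V i * y) = of_real (exp (- (1 * \<beta>))) * \<psi> (y * V i)"
    proof (rule bounded_linear_eq_on_monomials[of "\<lambda>y. \<psi> (V i * y)" "\<lambda>y. _ * \<psi> (y * V i)"])
      fix \<rho> c \<kappa>
      assume w: "\<rho> \<in> words d" "\<kappa> \<in> words d"
      show "\<psi> (V i * monomial \<rho> c \<kappa>) = of_real (exp (- (1 * \<beta>))) * \<psi> (monomial \<rho> c \<kappa> * V i)"
        using w i kms_value_add_length[OF \<tau>s, of _ 1]
        by (auto simp: V_monomial monomial_V has_kms_values_monomial[OF val] zero split: list.splits)
    qed (intro bl bounded_linear_mult_left bounded_linear_mult_right
        bounded_linear_compose[OF bounded_linear_mult_right[of "of_real (exp (- (1 * \<beta>)))"]])+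
  qed
qed

lemma \<sigma>_hom: "unital_star_hom class_cstar (\<sigma> t)"
  using gauge by (simp add: gauge_action_def \<sigma>_eq)

lemma \<sigma>_monomial:
  assumes "\<mu> \<in> words d" "\<nu> \<in> words d"
  shows "\<sigma> t (monomial \<mu> a \<nu>) =
    exp (\<i> * of_real t * of_int (int (length \<mu>) - int (length \<nu>))) *\<^sub>C monomial \<mu> a \<nu>"
proof -
  note hom = \<sigma>_hom[of t, unfolded unital_star_hom_def, simplified]
  have word: "\<sigma> t (word_prod V \<mu>) = exp (\<i> * of_real t * of_nat (length \<mu>)) *\<^sub>C word_prod V \<mu>"
    if "\<mu> \<in> words d" for \<mu>
    using that
  proof (induction \<mu>)
    case (Cons i \<mu>)
    have "\<sigma> t (V i) = exp (\<i> * of_real t) *\<^sub>C V i"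
      using gauge Cons.prems by (simp add: gauge_action_def \<sigma>_eq)
    then show ?case
      using Cons hom
      by (simp add: mult_scaleC_left mult_scaleC_right scaleC_scaleC algebra_simps flip: exp_add)
  qed (simp add: hom)
  have "\<sigma> t (\<iota> a) = \<iota> a"
    using gauge by (simp add: gauge_action_def \<sigma>_eq)
  then show ?thesis
    using hom word[OF assms(1)] word[OF assms(2)]
    by (simp add: exp_cnj monomial_def star_scaleC mult_scaleC_left mult_scaleC_right scaleC_scaleC
        algebra_simps flip: exp_add)
qed

end

section \<open>Entire functions, entire extensions and periods\<close>

lemma entire_eq_on_reals:
  fixes f g :: "complex \<Rightarrow> complex"
  assumes "f holomorphic_on UNIV" and "g holomorphic_on UNIV"
    and "\<And>t. f (of_real t) = g (of_real t)"
  shows "f z = g z"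
proof -
  have "(0::complex) islimpt \<real>"
  proof (rule islimpt_approachable[THEN iffD2], intro allI impI)
    fix e :: real
    assume "0 < e"
    then show "\<exists>x\<in>\<real>. x \<noteq> (0::complex) \<and> dist x 0 < e"
      by (intro bexI[of _ "of_real (e / 2)"]) auto
  qed
  then have "(\<lambda>z. f z - g z) z = 0"
    using assms
    by (intro analytic_continuation[of "\<lambda>z. f z - g z" UNIV \<real> 0 z])
       (auto intro!: holomorphic_intros elim!: Reals_cases)
  then show ?thesis by simp
qed

lemma holomorphic_on_entire_extension:
  assumes "\<psi> \<in> states" and "entire_extension \<sigma> x F"
  shows "(\<lambda>z. \<psi> (y * F z)) holomorphic_on UNIV"
proof -
  have "(\<lambda>z. \<psi> (y * F z)) field_differentiable (at z)" for z
  proof -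
    obtain F' where F': "(F has_derivative (\<lambda>h. h *\<^sub>C F')) (at z)"
      using assms(2) by (auto simp: entire_extension_def)
    have "bounded_linear (\<lambda>x. \<psi> (y * x))"
      using bounded_linear_states_mult(1)[OF assms(1) unital_star_hom_id] by simp
    from bounded_linear.has_derivative[OF this F']
    have "((\<lambda>z. \<psi> (y * F z)) has_derivative (\<lambda>h. \<psi> (y * F') * h)) (at z)"
      by (simp add: mult_scaleC_right positive_functional_scaleC[OF states_positive[OF assms(1)]]
          mult.commute)
    then show ?thesis
      by (auto simp: field_differentiable_def has_field_derivative_def)
  qed
  then show ?thesis
    by (simp add: holomorphic_on_def)
qed

text \<open>Uniqueness is needed only after applying \<psi>(y * _), which reduces it to the identity
  theorem for scalar functions.\<close>

lemma entire_extension_unique: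
  assumes "\<psi> \<in> states" and F: "entire_extension \<sigma> x F" and G: "entire_extension \<sigma> x G"
  shows "\<psi> (y * F z) = \<psi> (y * G z)"
proof (rule entire_eq_on_reals[of "\<lambda>z. \<psi> (y * F z)" "\<lambda>z. \<psi> (y * G z)"])
  show "\<psi> (y * F (of_real t)) = \<psi> (y * G (of_real t))" for t
    using F G by (simp add: entire_extension_def)
qed (rule holomorphic_on_entire_extension[OF assms(1)], fact)+

text \<open>If \<open>P' = h\<close>, then \<open>P (z + 2\<pi>) - P z\<close> has derivative zero.\<close>

lemma periodic_entire_integral:
  assumes h: "h holomorphic_on UNIV" and periodic: "\<And>z. h (z + of_real (2 * pi)) = h z"
  obtains I where
    "\<And>s. ((\<lambda>t. h (of_real t + \<i> * of_real s)) has_integral I) {0..2 * pi}"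
proof -
  obtain P where P: "\<And>z. (P has_field_derivative h z) (at z)"
    using holomorphic_convex_primitive'[OF convex_UNIV open_UNIV h] by auto
  have "((\<lambda>z. P (z + of_real (2 * pi)) - P z) has_field_derivative 0) (at z)" for z
  proof -
    have "((\<lambda>z. P (z + of_real (2 * pi)) - P z) has_field_derivative
        h (z + of_real (2 * pi)) * 1 - h z) (at z)"
      by (intro DERIV_diff P DERIV_chain2[OF P]) (auto intro!: derivative_eq_intros)
    then show ?thesis by (simp only: periodic) simp
  qed
  then obtain I where I: "\<And>z. P (z + of_real (2 * pi)) - P z = I"
    using has_field_derivative_zero_constant[OF convex_UNIV,
        of "\<lambda>z. P (z + of_real (2 * pi)) - P z"] by auto
  have "((\<lambda>t. h (of_real t + \<i> * of_real s)) has_integral I) {0..2 * pi}" for s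
  proof -
    have "((\<lambda>t. h (of_real t + \<i> * of_real s)) has_integral
        P (of_real (2 * pi) + \<i> * of_real s) - P (of_real 0 + \<i> * of_real s)) {0..2 * pi}"
    proof (rule fundamental_theorem_of_calculus)
      fix t
      have "((\<lambda>t. of_real t + \<i> * of_real s) has_vector_derivative 1) (at t within {0..2 * pi})"
        by (auto intro!: derivative_eq_intros)
      from field_vector_diff_chain_within[OF this
          has_field_derivative_at_within[OF P]]
      show "((\<lambda>t. P (of_real t + \<i> * of_real s)) has_vector_derivative
          h (of_real t + \<i> * of_real s)) (at t within {0..2 * pi})"
        by (simp add: comp_def)
    qed simp
    moreover have "P (of_real (2 * pi) + \<i> * of_real s) - P (of_real 0 + \<i> * of_real s) = I"
      using I[of "\<i> * of_real s"] by (simp add: add.commute)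
    ultimately show ?thesis by simp
  qed
  then show ?thesis by (rule that)
qed

context toeplitz_pimsner_system
begin

lemma \<sigma>_scaleC: "\<sigma> t (c *\<^sub>C x) = c *\<^sub>C \<sigma> t x"
  and \<sigma>_add: "\<sigma> t (x + y) = \<sigma> t x + \<sigma> t y"
  using \<sigma>_hom[of t] by (auto simp: unital_star_hom_def)

lemma entire_extension_monomial:
  assumes "\<mu> \<in> words d" "\<nu> \<in> words d"
  shows "entire_extension \<sigma> (monomial \<mu> a \<nu>)
    (\<lambda>z. exp (\<i> * z * of_int (int (length \<mu>) - int (length \<nu>))) *\<^sub>C monomial \<mu> a \<nu>)"
  unfolding entire_extension_def
proof (intro conjI allI)
  define k :: complex where "k = of_int (int (length \<mu>) - int (length \<nu>))"
  fix z
  have "((\<lambda>z. exp (\<i> * z * k)) has_field_derivative \<i> * k * exp (\<i> * z * k)) (at z)"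
    by (auto intro!: derivative_eq_intros)
  then have "((\<lambda>z. exp (\<i> * z * k)) has_derivative (\<lambda>h. h * (\<i> * k * exp (\<i> * z * k)))) (at z)"
    by (simp add: has_field_derivative_def mult.commute[of _ "\<i> * k * exp (\<i> * z * k)"])
  moreover have "bounded_linear (\<lambda>c. c *\<^sub>C monomial \<mu> a \<nu>)"
  proof (rule bounded_linear_intro[where K = "norm (monomial \<mu> a \<nu>)"])
    show "(r *\<^sub>R c) *\<^sub>C monomial \<mu> a \<nu> = r *\<^sub>R c *\<^sub>C monomial \<mu> a \<nu>" for r c
      by (simp add: scaleR_conv_of_real[where 'a = complex] flip: scaleC_of_real scaleC_scaleC)
  qed (simp_all add: scaleC_add_left norm_scaleC)
  ultimately have "((\<lambda>z. exp (\<i> * z * k) *\<^sub>C monomial \<mu> a \<nu>) has_derivative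
      (\<lambda>h. (h * (\<i> * k * exp (\<i> * z * k))) *\<^sub>C monomial \<mu> a \<nu>)) (at z)"
    using bounded_linear.has_derivative by blast
  then show "\<exists>F'. ((\<lambda>z. exp (\<i> * z * of_int (int (length \<mu>) - int (length \<nu>))) *\<^sub>C monomial \<mu> a \<nu>)
      has_derivative (\<lambda>h. h *\<^sub>C F')) (at z)"
    unfolding scaleC_scaleC[symmetric] k_def by blast
qed (simp add: \<sigma>_monomial[OF assms])

text \<open>The dense subalgebra demanded by \<open>kms_states\<close> is the span of the monomials,
  where each \<sigma>_t is diagonal.\<close>

lemma kms_if_twisted:
  assumes \<psi>: "\<psi> \<in> states"
    and tw: "\<And>\<mu> a \<nu>. \<mu> \<in> words d \<Longrightarrow> \<nu> \<in> words d \<Longrightarrow>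
      twisted \<psi> (monomial \<mu> a \<nu>) (real (length \<mu>) - real (length \<nu>))"
  shows "\<psi> \<in> kms_states \<sigma> \<beta>"
proof -
  \<comment> \<open>One extension with its KMS identity is carried through the span induction;
    \<open>entire_extension_unique\<close> then passes to every extension F of the same
    element.\<close>
  define Q where "Q x \<longleftrightarrow> (\<exists>F. entire_extension \<sigma> x F \<and>
      (\<forall>y. \<psi> (x * y) = \<psi> (y * F (\<i> * complex_of_real \<beta>))))" for x
  note lin = positive_functional_add[OF states_positive[OF \<psi>]]
    positive_functional_scaleC[OF states_positive[OF \<psi>]]
    positive_functional_zero[OF states_positive[OF \<psi>]]
  have Q_monomial: "Q (monomial \<mu> a \<nu>)" if w: "\<mu> \<in> words d" "\<nu> \<in> words d" for \<mu> a \<nu>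
  proof -
    have "\<i> * (\<i> * of_real \<beta>) * of_int (int (length \<mu>) - int (length \<nu>)) =
        complex_of_real (- ((real (length \<mu>) - real (length \<nu>)) * \<beta>))"
      by (simp add: algebra_simps flip: mult.assoc)
    then have "exp (\<i> * (\<i> * of_real \<beta>) * of_int (int (length \<mu>) - int (length \<nu>))) =
        complex_of_real (exp (- ((real (length \<mu>) - real (length \<nu>)) * \<beta>)))"
      by (simp only: exp_of_real)
    then show ?thesis
      unfolding Q_def using entire_extension_monomial[OF w, of a] tw[OF w, of a]
      by (intro exI conjI) (auto simp: twisted_def mult_scaleC_right lin)
  qed
  have Q_add: "Q (x + y)" if "Q x" "Q y" for x y
  proof -
    obtain F G where FG: "entire_extension \<sigma> x F" "entire_extension \<sigma> y G"
        "\<And>z. \<psi> (x * z) = \<psi> (z * F (\<i> * complex_of_real \<beta>))"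
        "\<And>z. \<psi> (y * z) = \<psi> (z * G (\<i> * complex_of_real \<beta>))"
      using \<open>Q x\<close> \<open>Q y\<close> unfolding Q_def by blast
    have "entire_extension \<sigma> (x + y) (\<lambda>z. F z + G z)"
      unfolding entire_extension_def
    proof (intro conjI allI)
      fix z
      obtain F' G' where "(F has_derivative (\<lambda>h. h *\<^sub>C F')) (at z)"
          "(G has_derivative (\<lambda>h. h *\<^sub>C G')) (at z)"
        using FG unfolding entire_extension_def by blast
      then show "\<exists>F'. ((\<lambda>z. F z + G z) has_derivative (\<lambda>h. h *\<^sub>C F')) (at z)"
        using has_derivative_add by (intro exI[of _ "F' + G'"]) (auto simp: scaleC_add_right)
    qed (use FG in \<open>simp add: entire_extension_def \<sigma>_add\<close>)
    then show ?thesis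
      unfolding Q_def using FG by (intro exI conjI) (auto simp: distrib_left distrib_right lin)
  qed
  have Q_span: "Q x" if "x \<in> span monomials" for x
    using that
  proof (induction rule: span_induct_alt)
    case base
    show ?case
      using Q_monomial[of "[]" "[]" 0] by (simp add: monomial_zero)
  next
    case (step r x y)
    have "Q (r *\<^sub>R x)"
      using step(1) Q_monomial by (auto simp: monomials_def monomial_scaleC simp flip: scaleC_of_real)
    then show ?case
      using step Q_add by blast
  qed
  have "span monomials \<subseteq> analytic_elements \<sigma>"
    using Q_span by (auto simp: Q_def analytic_elements_def)
  moreover have "\<sigma> t x \<in> span monomials" if "x \<in> span monomials" for t x
  proof (rule linear_image_span_subset[OF _ _ that])
    show "linear (\<sigma> t)"
      by (simp add: linear_iff \<sigma>_add \<sigma>_scaleC flip: scaleC_of_real)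
    show "\<sigma> t x \<in> span monomials" if "x \<in> monomials" for x
      using that by (auto simp: \<sigma>_monomial monomial_scaleC elim!: monomialsE intro!: span_base monomialsI)
  qed
  moreover have "\<psi> (x * y) = \<psi> (y * F (\<i> * complex_of_real \<beta>))"
    if "x \<in> span monomials" "entire_extension \<sigma> x F" for x y F
    using Q_span[OF that(1)] entire_extension_unique[OF \<psi> that(2)] unfolding Q_def by metis
  ultimately show ?thesis
    using \<psi> star_subalgebra_span_monomials closure_span_monomials unfolding kms_states_def by blast
qed

text \<open>The vector F (i\<beta>) does not depend continuously on u, so approximating x by u in B
  cannot be done in the KMS identity itself. On both lines, however, the function z \<mapsto>
  \<psi>(y F(z)) is expressed by \<sigma>_t(u) with t real, where the error is at most
  \<open>norm y * norm (u - x)\<close>; equality of the two Fourier integrals links the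
  lines.\<close>

lemma twisted_if_kms:
  assumes kms: "\<psi> \<in> kms_states \<sigma> \<beta>" and w: "\<mu> \<in> words d" "\<nu> \<in> words d"
  shows "twisted \<psi> (monomial \<mu> a \<nu>) (real (length \<mu>) - real (length \<nu>))"
  unfolding twisted_def
proof
  fix y
  define k where "k = int (length \<mu>) - int (length \<nu>)"
  define x where "x = monomial \<mu> a \<nu>"
  \<comment> \<open>The modulus of e^(-ikz) on the line Im z = \<beta>.\<close>
  define E where "E = exp (real_of_int k * \<beta>)"
  have \<psi>: "\<psi> \<in> states"
    using kms by (simp add: kms_states_def)
  note lin = positive_functional_add[OF states_positive[OF \<psi>]]
    positive_functional_diff[OF states_positive[OF \<psi>]]
    positive_functional_scaleC[OF states_positive[OF \<psi>]]
  obtain B where B: "star_subalgebra B" "closure B = UNIV" "\<And>t x. x \<in> B \<Longrightarrow> \<sigma> t x \<in> B"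
      "B \<subseteq> analytic_elements \<sigma>"
    and B_kms: "\<And>x y F. x \<in> B \<Longrightarrow> y \<in> B \<Longrightarrow> entire_extension \<sigma> x F \<Longrightarrow>
      \<psi> (x * y) = \<psi> (y * F (\<i> * complex_of_real \<beta>))"
    using kms unfolding kms_states_def by blast
  have kms_all: "\<psi> (u * z) = \<psi> (z * F (\<i> * complex_of_real \<beta>))"
    if u: "u \<in> B" "entire_extension \<sigma> u F" for u z F
  proof -
    note bl = bounded_linear_compose[OF bounded_linear_states[OF \<psi>]]
    have "closed {z. \<psi> (u * z) = \<psi> (z * F (\<i> * complex_of_real \<beta>))}"
      by (intro closed_Collect_eq linear_continuous_on bl bounded_linear_mult_left
          bounded_linear_mult_right)
    then have "closure B \<subseteq> {z. \<psi> (u * z) = \<psi> (z * F (\<i> * complex_of_real \<beta>))}"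
      using B_kms[OF u(1) _ u(2)] by (intro closure_minimal) auto
    then show ?thesis
      using B(2) by auto
  qed
  \<comment> \<open>The group law of \<sigma> is not among the conditions on the gauge action. Its
    weak form is read off the monomials and extended by density.\<close>
  have \<sigma>_\<sigma>: "\<psi> (z * \<sigma> s (\<sigma> t u)) = \<psi> (z * \<sigma> (s + t) u)" for z s t u
  proof (rule bounded_linear_eq_on_monomials[of "\<lambda>u. \<psi> (z * \<sigma> s (\<sigma> t u))" "\<lambda>u. \<psi> (z * \<sigma> (s + t) u)"])
    show "bounded_linear (\<lambda>u. \<psi> (z * \<sigma> s (\<sigma> t u)))"
      using bounded_linear_states_mult(1)[OF \<psi> unital_star_hom_comp[OF \<sigma>_hom \<sigma>_hom]] by simp
    show "bounded_linear (\<lambda>u. \<psi> (z * \<sigma> (s + t) u))"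
      by (rule bounded_linear_states_mult(1)[OF \<psi> \<sigma>_hom])
    show "\<psi> (z * \<sigma> s (\<sigma> t (monomial \<mu> a \<nu>))) = \<psi> (z * \<sigma> (s + t) (monomial \<mu> a \<nu>))"
      if "\<mu> \<in> words d" "\<nu> \<in> words d" for \<mu> a \<nu>
      using that
      by (simp add: \<sigma>_monomial \<sigma>_scaleC scaleC_scaleC algebra_simps flip: exp_add)
  qed
  have main: "cmod (\<psi> (y * x) - of_real E * \<psi> (x * y)) \<le> (1 + E) * norm y * norm (u - x)"
    if u: "u \<in> B" for u
  proof -
    obtain F where F: "entire_extension \<sigma> u F"
      using u B(4) by (auto simp: analytic_elements_def)
    define g where "g z = \<psi> (y * F z)" for z
    \<comment> \<open>This factor makes the k-th Fourier coefficient of g the mean value of h over a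
      period.\<close>
    define h where "h z = g z * exp (- (\<i> * z * of_int k))" for z
    have g_hol: "g holomorphic_on UNIV"
      unfolding g_def[abs_def] using \<psi> F by (rule holomorphic_on_entire_extension)
    have g_real: "g (of_real t) = \<psi> (y * \<sigma> t u)" for t
      using F by (simp add: g_def entire_extension_def)
    \<comment> \<open>The translate of g by t agrees on the real line with the function of an
      extension G of \<sigma>_t(u), hence everywhere; the KMS identity for \<sigma>_t(u) at G
      (i\<beta>) gives the value on the upper line.\<close>
    have g_shift: "g (of_real t + \<i> * of_real \<beta>) = \<psi> (\<sigma> t u * y)" for t
    proof -
      obtain G where G: "entire_extension \<sigma> (\<sigma> t u) G"
        using B(3)[OF u, of t] B(4) unfolding analytic_elements_def by blast
      have "\<psi> (y * G z) = g (of_real t + z)" for z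
      proof (rule entire_eq_on_reals[of "\<lambda>z. \<psi> (y * G z)" "\<lambda>z. g (of_real t + z)"])
        show "(\<lambda>z. g (of_real t + z)) holomorphic_on UNIV"
          by (rule holomorphic_on_compose_gen[OF _ g_hol, unfolded comp_def])
             (auto intro!: holomorphic_intros)
        show "\<psi> (y * G (of_real s)) = g (of_real t + of_real s)" for s
          using G g_real[of "t + s"] \<sigma>_\<sigma>[of y s t u]
          by (simp add: entire_extension_def add.commute)
      qed (rule holomorphic_on_entire_extension[OF \<psi> G])
      then show ?thesis
        using kms_all[OF B(3)[OF u] G, of y] by simp
    qed
    have "g (z + of_real (2 * pi)) = g z" for z
    proof (rule entire_eq_on_reals[of "\<lambda>z. g (z + of_real (2 * pi))" g])
      show "(\<lambda>z. g (z + of_real (2 * pi))) holomorphic_on UNIV"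
        by (rule holomorphic_on_compose_gen[OF _ g_hol, unfolded comp_def])
           (auto intro!: holomorphic_intros)
      show "g (of_real t + of_real (2 * pi)) = g (of_real t)" for t
      proof -
        have "\<sigma> (t + 2 * pi) = \<sigma> t"
          by (simp add: \<sigma>_eq distrib_left exp_add mult.commute[of \<i>])
        then show ?thesis
          using g_real[of t] g_real[of "t + 2 * pi"] by simp
      qed
    qed (rule g_hol)
    moreover have "exp (- (\<i> * (z + of_real (2 * pi)) * of_int k)) = exp (- (\<i> * z * of_int k))" for z
    proof -
      have "exp (- (\<i> * (z + of_real (2 * pi)) * of_int k)) =
          exp (- (\<i> * z * of_int k)) * exp ((2 * of_int (- k) * pi) * \<i>)"
        by (simp add: algebra_simps flip: exp_add)
      also have "exp (complex_of_real (2 * of_int (- k) * pi) * \<i>) = 1"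
        using exp_integer_2pi[OF Ints_of_int, of "- k"] by simp
      finally show ?thesis by simp
    qed
    ultimately have h_periodic: "h (z + of_real (2 * pi)) = h z" for z
      by (simp only: h_def)
    have h_hol: "h holomorphic_on UNIV"
      unfolding h_def[abs_def] by (intro holomorphic_intros g_hol)
    obtain I where
      I: "\<And>s. ((\<lambda>t. h (of_real t + \<i> * of_real s)) has_integral I) {0..2 * pi}"
      by (rule periodic_entire_integral[of h, OF h_hol]) (rule h_periodic, blast)
    \<comment> \<open>The same I is compared with one constant on the line s = 0 and with another on
      the line s = \<beta>.\<close>
    have close: "cmod (I - of_real (2 * pi) * c) \<le> M * (2 * pi)"
      if "\<And>t. cmod (h (of_real t + \<i> * of_real s) - c) \<le> M" "0 \<le> M" for s c M
    proof -
      have "((\<lambda>t. c) has_integral of_real (2 * pi) * c) {0..2 * pi}"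
        using has_integral_const_real[of c 0 "2 * pi"] by (simp add: scaleR_conv_of_real)
      from has_integral_diff[OF I[of s] this]
      have "((\<lambda>t. h (of_real t + \<i> * of_real s) - c) has_integral I - of_real (2 * pi) * c)
          (cbox 0 (2 * pi))"
        by simp
      from has_integral_bound[OF that(2) this] that(1) show ?thesis
        by simp
    qed
    have phase: "cmod (exp (- (\<i> * of_real t * of_int k))) = 1" for t
      by simp
    have \<sigma>x: "\<sigma> t x = exp (\<i> * of_real t * of_int k) *\<^sub>C x" for t
      using \<sigma>_monomial[OF w, of t a] by (simp add: x_def k_def)
    \<comment> \<open>For x in place of u, both boundary functions are constant, because x is
      homogeneous of degree k.\<close>
    have xexp: "\<psi> (y * \<sigma> t x) * exp (- (\<i> * of_real t * of_int k)) = \<psi> (y * x)"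
      "\<psi> (\<sigma> t x * y) * exp (- (\<i> * of_real t * of_int k)) = \<psi> (x * y)" for t
      by (simp_all add: \<sigma>x mult_scaleC_left mult_scaleC_right lin exp_minus)
    have \<sigma>_diff: "\<sigma> t (u - x) = \<sigma> t u - \<sigma> t x" for t
      using \<sigma>_add[of t "u - x" x] by simp
    have "cmod (I - of_real (2 * pi) * \<psi> (y * x)) \<le> (norm y * norm (u - x)) * (2 * pi)"
    proof (rule close[where s = 0])
      fix t
      have "h (of_real t + \<i> * of_real 0) - \<psi> (y * x) =
          \<psi> (y * \<sigma> t (u - x)) * exp (- (\<i> * of_real t * of_int k))"
        unfolding xexp(1)[of t, symmetric]
        by (simp add: h_def g_real \<sigma>_diff right_diff_distrib lin left_diff_distrib)
      then show "cmod (h (of_real t + \<i> * of_real 0) - \<psi> (y * x)) \<le> norm y * norm (u - x)"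
        using states_mult_hom_le[OF \<psi> unital_star_hom_id \<sigma>_hom, of y t "u - x"]
        by (simp add: norm_mult phase)
    qed simp
    moreover have "cmod (I - of_real (2 * pi) * (of_real E * \<psi> (x * y))) \<le>
        (E * (norm y * norm (u - x))) * (2 * pi)"
    proof (rule close[where s = \<beta>])
      fix t
      have "- (\<i> * (of_real t + \<i> * of_real \<beta>) * of_int k) =
          - (\<i> * of_real t * of_int k) + complex_of_real (real_of_int k * \<beta>)"
        by (simp add: complex_eq_iff)
      then have "exp (- (\<i> * (of_real t + \<i> * of_real \<beta>) * of_int k)) =
          exp (- (\<i> * of_real t * of_int k)) * of_real E"
        by (simp only: exp_add exp_of_real E_def)
      then have "h (of_real t + \<i> * of_real \<beta>) - of_real E * \<psi> (x * y) =
          of_real E * (\<psi> (\<sigma> t (u - x) * y) * exp (- (\<i> * of_real t * of_int k)))"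
        unfolding xexp(2)[of t, symmetric]
        by (simp add: h_def g_shift \<sigma>_diff left_diff_distrib right_diff_distrib lin mult_ac)
      then show "cmod (h (of_real t + \<i> * of_real \<beta>) - of_real E * \<psi> (x * y)) \<le>
          E * (norm y * norm (u - x))"
        using states_mult_hom_le[OF \<psi> \<sigma>_hom unital_star_hom_id, of t "u - x" y]
        by (simp add: norm_mult phase E_def mult.commute)
    qed (simp add: E_def)
    ultimately have "cmod (of_real (2 * pi) * \<psi> (y * x) - of_real (2 * pi) * (of_real E * \<psi> (x * y))) \<le>
        (norm y * norm (u - x)) * (2 * pi) + (E * (norm y * norm (u - x))) * (2 * pi)"
      using norm_triangle_ineq4[of "I - of_real (2 * pi) * (of_real E * \<psi> (x * y))"
          "I - of_real (2 * pi) * \<psi> (y * x)"] by simp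
    moreover have "cmod (of_real (2 * pi) * \<psi> (y * x) - of_real (2 * pi) * (of_real E * \<psi> (x * y))) =
        (2 * pi) * cmod (\<psi> (y * x) - of_real E * \<psi> (x * y))"
      unfolding right_diff_distrib[symmetric] norm_mult by simp
    moreover have "(norm y * norm (u - x)) * (2 * pi) + (E * (norm y * norm (u - x))) * (2 * pi) =
        (2 * pi) * ((1 + E) * norm y * norm (u - x))"
      by (simp add: algebra_simps)
    ultimately have "(2 * pi) * cmod (\<psi> (y * x) - of_real E * \<psi> (x * y)) \<le>
        (2 * pi) * ((1 + E) * norm y * norm (u - x))"
      by simp
    then show ?thesis
      by (simp add: mult_le_cancel_left)
  qed
  obtain u where u: "\<And>n. u n \<in> B" "u \<longlonglongrightarrow> x"
    using B(2) closure_sequential[of x B] by auto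
  have "(\<lambda>n. (1 + E) * norm y * norm (u n - x)) \<longlonglongrightarrow> (1 + E) * norm y * norm (x - x)"
    by (intro tendsto_intros u)
  then have "cmod (\<psi> (y * x) - of_real E * \<psi> (x * y)) \<le> (1 + E) * norm y * norm (x - x)"
    by (rule LIMSEQ_le_const) (use main u(1) in blast)
  then have "\<psi> (y * x) = of_real E * \<psi> (x * y)"
    by simp
  moreover have "exp (- ((real (length \<mu>) - real (length \<nu>)) * \<beta>)) * E = 1"
    by (simp add: E_def k_def flip: exp_add)
  then have "complex_of_real (exp (- ((real (length \<mu>) - real (length \<nu>)) * \<beta>))) * of_real E = 1"
    by (simp only: flip: of_real_mult) simp
  ultimately show "\<psi> (monomial \<mu> a \<nu> * y) =
      of_real (exp (- ((real (length \<mu>) - real (length \<nu>)) * \<beta>))) * \<psi> (y * monomial \<mu> a \<nu>)"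
    unfolding x_def by (simp only: mult.assoc[symmetric] mult_1)
qed

end

section \<open>The correspondence between traces and KMS states\<close>

text \<open>Words can grow at either end. As rev (w @ [i]) = i # rev w, this version puts \<alpha>_i
  outside the endomorphism of w, as needed to express a KMS state by its trace;
  \<open>sum_words_Cons\<close> puts \<alpha>_i inside, as needed to recover the trace.\<close>

lemma sum_words_snoc:
  "(\<Sum>w\<in>words_of_length d (Suc m). f w) = (\<Sum>w\<in>words_of_length d m. \<Sum>i<d. f (w @ [i]))"
proof -
  have "bij_betw (\<lambda>(w, i). w @ [i]) (words_of_length d m \<times> {..<d}) (words_of_length d (Suc m))"
  proof (rule bij_betwI')
    fix w
    assume "w \<in> words_of_length d (Suc m)"
    then show "\<exists>p\<in>words_of_length d m \<times> {..<d}. w = (\<lambda>(w, i). w @ [i]) p"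
      by (cases w rule: rev_cases) auto
  qed auto
  from sum.reindex_bij_betw[OF this, of f] show ?thesis
    by (simp add: sum.cartesian_product case_prod_unfold)
qed

lemma sum_words_Cons:
  "(\<Sum>w\<in>words_of_length d (Suc m). f w) = (\<Sum>w\<in>words_of_length d m. \<Sum>i<d. f (i # w))"
proof -
  have "bij_betw (\<lambda>(w, i). i # w) (words_of_length d m \<times> {..<d}) (words_of_length d (Suc m))"
  proof (rule bij_betwI')
    fix w
    assume "w \<in> words_of_length d (Suc m)"
    then show "\<exists>p\<in>words_of_length d m \<times> {..<d}. w = (\<lambda>(w, i). i # w) p"
      by (cases w) auto
  qed auto
  from sum.reindex_bij_betw[OF this, of f] show ?thesis
    by (simp add: sum.cartesian_product case_prod_unfold)
qed

lemma convex_combination_in_states: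
  assumes "\<phi> \<in> states" and "\<psi> \<in> states" and s: "s \<in> {0..1}"
  shows "(\<lambda>x. of_real (1 - s) * \<phi> x + of_real s * \<psi> x) \<in> states"
proof -
  have "complex_of_real (1 - s) \<in> \<real>\<^sub>\<ge>\<^sub>0" "complex_of_real s \<in> \<real>\<^sub>\<ge>\<^sub>0"
    unfolding nonneg_Reals_of_real_iff using s by auto
  moreover have "complex_of_real s + complex_of_real (1 - s) = 1"
    by simp
  ultimately show ?thesis
    using assms(1,2) by (auto simp: states_def algebra_simps intro!: nonneg_Reals_add_I nonneg_Reals_mult_I
        simp del: of_real_diff)
qed

context toeplitz_pimsner_system
begin

text \<open>The common value of all KMS states at the projection 1 - \<Sum> V_i V_i^*, and at the
  same time the constant that normalises the weights.\<close>

definition \<epsilon> :: real where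
  "\<epsilon> = 1 - exp (- \<beta>) * real d"

lemma \<epsilon>_pos: "0 < \<epsilon>"
  using exp_mult_less_1[OF d_ge_1 \<beta>] by (simp add: \<epsilon>_def)

lemma \<beta>_pos: "0 < \<beta>"
proof -
  have "1 \<le> real d"
    using d_ge_1 by simp
  then show ?thesis
    using ln_ge_zero[of "real d"] \<beta> by linarith
qed

text \<open>The compression of \<open>\<psi>\<close> by the projection \<open>1 - \<Sum>\<^sub>i V\<^sub>i V\<^sub>i\<^sup>*\<close>, normalised.\<close>

definition trace_of :: "('b \<Rightarrow> complex) \<Rightarrow> 'a \<Rightarrow> complex" where
  "trace_of \<psi> a =
     (\<psi> (\<iota> a) - of_real (exp (- \<beta>)) * (\<Sum>i<d. \<psi> (\<iota> (\<alpha> i a)))) / of_real \<epsilon>"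

lemma kms_states_subset: "\<psi> \<in> kms_states \<sigma> \<beta> \<Longrightarrow> \<psi> \<in> states"
  by (simp add: kms_states_def)

lemma kms_twisted_\<iota>: "\<psi> \<in> kms_states \<sigma> \<beta> \<Longrightarrow> \<psi> (\<iota> a * x) = \<psi> (x * \<iota> a)"
  using twisted_if_kms[of \<psi> "[]" "[]" a] by (simp add: twisted_def monomial_\<iota>)

text \<open>The projection P commutes with \<iota> a, and \<psi>(\<iota> a P) = \<epsilon> *
  trace_of \<psi> a. Positivity follows since \<iota>(star x * x) P is the square of \<iota> x P;
  the trace property is the KMS identity in degree zero.\<close>

lemma trace_of_in_tracial_states:
  assumes kms: "\<psi> \<in> kms_states \<sigma> \<beta>"
  shows "trace_of \<psi> \<in> tracial_states"
proof -
  have \<psi>: "\<psi> \<in> states"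
    using kms by (rule kms_states_subset)
  note lin = positive_functional_add[OF states_positive[OF \<psi>]]
    positive_functional_diff[OF states_positive[OF \<psi>]]
    positive_functional_scaleC[OF states_positive[OF \<psi>]]
    positive_functional_sum[OF states_positive[OF \<psi>]]
  have \<alpha>: "\<alpha> i (x + y) = \<alpha> i x + \<alpha> i y" "\<alpha> i (c *\<^sub>C x) = c *\<^sub>C \<alpha> i x" "\<alpha> i (x * y) = \<alpha> i x * \<alpha> i y"
    "\<alpha> i 1 = 1" if "i < d" for i x y c
    using \<alpha>_hom[OF that] by (auto simp: unital_star_hom_def)
  define P where "P = 1 - (\<Sum>i<d. V i * star (V i))"
  have P_star: "star P = P"
  proof -
    have "star (\<Sum>i<n. V i * star (V i)) = (\<Sum>i<n. V i * star (V i))" for n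
      by (induction n) (simp_all add: star_add star_mult star_star)
    then show ?thesis by (simp add: P_def star_diff)
  qed
  have P_V: "P * V j = 0" if "j < d" for j
  proof -
    have "(\<Sum>i<d. V i * star (V i)) * V j = (\<Sum>i<d. if i = j then V i else 0)"
      unfolding sum_distrib_right using that
      by (intro sum.cong) (auto simp: mult.assoc V_orthonormal)
    then show ?thesis
      using that by (simp add: P_def left_diff_distrib)
  qed
  have "P * (\<Sum>i<d. V i * star (V i)) = 0"
    unfolding sum_distrib_left by (intro sum.neutral) (simp add: P_V flip: mult.assoc)
  then have P_P: "P * P = P"
    by (subst (2) P_def) (simp add: right_diff_distrib)
  have P_\<iota>: "P * \<iota> a = \<iota> a * P" for a
  proof -
    have "(\<Sum>i<d. V i * star (V i)) * \<iota> a = \<iota> a * (\<Sum>i<d. V i * star (V i))"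
      unfolding sum_distrib_left sum_distrib_right
    proof (rule sum.cong)
      fix i
      assume i: "i \<in> {..<d}"
      have "V i * star (V i) * \<iota> a = V i * \<iota> (\<alpha> i a) * star (V i)"
        using i by (simp add: mult.assoc V_star_\<iota>)
      also have "\<dots> = \<iota> a * (V i * star (V i))"
        using i by (simp add: \<iota>_V flip: mult.assoc)
      finally show "V i * star (V i) * \<iota> a = \<iota> a * (V i * star (V i))" .
    qed simp
    then show ?thesis
      by (simp add: P_def algebra_simps)
  qed
  have \<psi>_P: "\<psi> (\<iota> a * P) = of_real \<epsilon> * trace_of \<psi> a" for a
  proof -
    have "\<psi> (\<iota> a * (V i * star (V i))) = of_real (exp (- \<beta>)) * \<psi> (\<iota> (\<alpha> i a))" if i: "i < d" for i
    proof -
      have "\<psi> (\<iota> a * (V i * star (V i))) = \<psi> (V i * (\<iota> (\<alpha> i a) * star (V i)))"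
        using i by (simp add: \<iota>_V flip: mult.assoc)
      \<comment> \<open>Moving V_i from the front to the back costs e^(-\<beta>), and there it meets
        star (V_i).\<close>
      also have "\<dots> = of_real (exp (- \<beta>)) * \<psi> (\<iota> (\<alpha> i a) * (star (V i) * V i))"
        using twisted_if_kms[OF kms, of "[i]" "[]" 1] i
        by (simp add: twisted_def mult.assoc flip: monomials_V)
      finally show ?thesis
        using i by (simp add: V_orthonormal)
    qed
    moreover have "of_real \<epsilon> * trace_of \<psi> a =
        \<psi> (\<iota> a) - of_real (exp (- \<beta>)) * (\<Sum>i<d. \<psi> (\<iota> (\<alpha> i a)))"
      using \<epsilon>_pos by (simp add: trace_of_def)
    ultimately show ?thesis
      by (simp add: P_def right_diff_distrib lin sum_distrib_left)
  qed
  have "trace_of \<psi> (star x * x) \<in> \<real>\<^sub>\<ge>\<^sub>0" for x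
  proof -
    have "\<iota> (star x * x) * P = star (\<iota> x * P) * (\<iota> x * P)"
    proof -
      have "P * (\<iota> x * P) = \<iota> x * P"
        using P_\<iota>[of x] P_P by (metis mult.assoc)
      then have "\<iota> (star x * x) * P = \<iota> (star x) * P * (\<iota> x * P)"
        by (simp add: \<iota>_simps mult.assoc)
      moreover have "star (\<iota> x * P) = \<iota> (star x) * P"
        using P_\<iota>[of "star x"] by (simp add: star_mult P_star \<iota>_simps)
      ultimately show ?thesis by simp
    qed
    then have "of_real \<epsilon> * trace_of \<psi> (star x * x) \<in> \<real>\<^sub>\<ge>\<^sub>0"
      using positive_functional_nonneg[OF states_positive[OF \<psi>], of "\<iota> x * P"] by (simp flip: \<psi>_P)
    moreover have "complex_of_real (1 / \<epsilon>) \<in> \<real>\<^sub>\<ge>\<^sub>0"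
      unfolding nonneg_Reals_of_real_iff using \<epsilon>_pos by simp
    ultimately have "of_real (1 / \<epsilon>) * (of_real \<epsilon> * trace_of \<psi> (star x * x)) \<in> \<real>\<^sub>\<ge>\<^sub>0"
      by (rule nonneg_Reals_mult_I[rotated])
    then show ?thesis
      using \<epsilon>_pos by simp
  qed
  moreover have "trace_of \<psi> (x + y) = trace_of \<psi> x + trace_of \<psi> y"
    "trace_of \<psi> (c *\<^sub>C x) = c * trace_of \<psi> x" for x y c
    using \<epsilon>_pos
    by (simp_all add: trace_of_def \<alpha> \<iota>_simps lin sum.distrib field_simps flip: sum_distrib_left)
  moreover have "trace_of \<psi> 1 = 1"
  proof -
    have "trace_of \<psi> 1 = (1 - of_real (exp (- \<beta>)) * of_nat d) / of_real \<epsilon>"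
      by (simp add: trace_of_def \<alpha> \<iota>_simps states_one[OF \<psi>])
    also have "1 - of_real (exp (- \<beta>)) * of_nat d = complex_of_real \<epsilon>"
      by (simp add: \<epsilon>_def)
    finally show ?thesis
      using \<epsilon>_pos by simp
  qed
  moreover have "\<psi> (\<iota> x * \<iota> y) = \<psi> (\<iota> y * \<iota> x)" for x y
    by (rule kms_twisted_\<iota>[OF kms])
  then have "trace_of \<psi> (x * y) = trace_of \<psi> (y * x)" for x y
    by (simp add: trace_of_def \<alpha> \<iota>_simps)
  ultimately show ?thesis
    by (simp add: tracial_states_def states_def)
qed

text \<open>For words of different lengths, y = 1 in the twisted identity gives \<psi> =
  e^(-k\<beta>) \<psi> at the monomial, which forces zero because \<beta> > 0. For equal lengths
  V_\<mu> is moved to the back, where star (V_\<nu>) V_\<mu> is 1 or 0; only \<psi> on A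
  remains.\<close>

lemma kms_has_kms_values:
  assumes kms: "\<psi> \<in> kms_states \<sigma> \<beta>"
  shows "has_kms_values d \<alpha> \<iota> V \<beta> (trace_of \<psi>) \<psi>"
proof -
  have \<psi>: "\<psi> \<in> states"
    using kms by (rule kms_states_subset)
  have \<tau>: "trace_of \<psi> \<in> states"
    using trace_of_in_tracial_states[OF kms] by (simp add: tracial_states_def)
  define q where "q = exp (- \<beta>)"
  have q: "0 \<le> q" "q * real d < 1"
    using exp_mult_less_1[OF d_ge_1 \<beta>] by (auto simp: q_def)
  have value_0: "kms_value d \<alpha> \<beta> (trace_of \<psi>) 0 a = \<psi> (\<iota> a)" for a
  proof -
    \<comment> \<open>Since trace_of \<psi> is itself a difference, the m-th term of the series
      times \<epsilon> is s m - s (m + 1). The sum telescopes to s 0 because |s m| \<le> (q d)^m *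
      norm a tends to 0.\<close>
    define S where "S m = (\<Sum>w\<in>words_of_length d m. \<psi> (\<iota> (word_endo \<alpha> (rev w) a)))" for m
    define s where "s m = of_real (q ^ m) * S m" for m
    have bound: "norm (s m) \<le> (q * real d) ^ m * norm a" for m
    proof -
      have "cmod (\<psi> (\<iota> (word_endo \<alpha> (rev w) a))) \<le> norm a" if "w \<in> words_of_length d m" for w
        using states_norm_le[OF states_comp_hom[OF states_comp_hom[OF \<psi> \<iota>_hom] endo_hom[of w]], of a]
          that by simp
      then have "norm (S m) \<le> real (card (words_of_length d m)) * norm a"
        unfolding S_def by (rule sum_norm_bound)
      then have "q ^ m * norm (S m) \<le> q ^ m * (real d ^ m * norm a)"
        using q by (intro mult_left_mono) (simp_all add: card_words_of_length)
      then show ?thesis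
        using q by (simp add: s_def norm_mult norm_power power_mult_distrib mult.assoc)
    qed
    have "s \<longlonglongrightarrow> 0"
    proof (rule Lim_null_comparison)
      show "\<forall>\<^sub>F m in sequentially. norm (s m) \<le> (q * real d) ^ m * norm a"
        using bound by simp
      show "(\<lambda>m. (q * real d) ^ m * norm a) \<longlonglongrightarrow> 0"
        using q by (intro tendsto_mult_left_zero LIMSEQ_power_zero) simp
    qed
    then have tel: "(\<lambda>m. s m - s (Suc m)) sums (s 0 - 0)"
      by (rule telescope_sums')
    have "of_real \<epsilon> * (of_real (exp (- (real (m + 0) * \<beta>))) *
        (\<Sum>w\<in>words_of_length d m. trace_of \<psi> (word_endo \<alpha> (rev w) a))) = s m - s (Suc m)" for m
    proof -
      have "of_real \<epsilon> * (\<Sum>w\<in>words_of_length d m. trace_of \<psi> (word_endo \<alpha> (rev w) a)) =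
          (\<Sum>w\<in>words_of_length d m. \<psi> (\<iota> (word_endo \<alpha> (rev w) a)) -
            of_real q * (\<Sum>i<d. \<psi> (\<iota> (\<alpha> i (word_endo \<alpha> (rev w) a)))))"
        using \<epsilon>_pos by (simp add: sum_distrib_left trace_of_def q_def)
      also have "\<dots> = S m - of_real q * S (Suc m)"
        by (simp only: S_def sum_words_snoc) (simp add: sum_subtractf sum_distrib_left)
      finally have "of_real (q ^ m) *
          (of_real \<epsilon> * (\<Sum>w\<in>words_of_length d m. trace_of \<psi> (word_endo \<alpha> (rev w) a))) =
          s m - s (Suc m)"
        by (simp add: s_def right_diff_distrib)
      moreover have "exp (- (real (m + 0) * \<beta>)) = q ^ m"
        by (simp add: q_def flip: exp_of_nat_mult)
      ultimately show ?thesis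
        by (simp only: mult.left_commute)
    qed
    with tel have "(\<lambda>m. of_real \<epsilon> * (of_real (exp (- (real (m + 0) * \<beta>))) *
        (\<Sum>w\<in>words_of_length d m. trace_of \<psi> (word_endo \<alpha> (rev w) a)))) sums s 0"
      by simp
    moreover have "(\<lambda>m. of_real \<epsilon> * (of_real (exp (- (real (m + 0) * \<beta>))) *
        (\<Sum>w\<in>words_of_length d m. trace_of \<psi> (word_endo \<alpha> (rev w) a)))) sums
        kms_value d \<alpha> \<beta> (trace_of \<psi>) 0 a"
      unfolding kms_value_def \<epsilon>_def
      by (rule sums_mult[OF summable_sums[OF summable_kms_value[OF \<tau>]]])
    moreover have "words_of_length d 0 = {[]}"
      by auto
    then have "s 0 = \<psi> (\<iota> a)"
      by (simp add: s_def S_def)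
    ultimately show ?thesis
      using sums_unique2 by fastforce
  qed
  have "\<psi> (monomial \<mu> a \<nu>) = (if \<mu> = \<nu> then kms_value d \<alpha> \<beta> (trace_of \<psi>) (length \<mu>) a else 0)"
    if w: "\<mu> \<in> words d" "\<nu> \<in> words d" for \<mu> \<nu> a
  proof (cases "length \<mu> = length \<nu>")
    case False
    define k where "k = real (length \<mu>) - real (length \<nu>)"
    have "exp (- (k * \<beta>)) \<noteq> 1"
      using False \<beta>_pos by (simp add: k_def)
    moreover have "\<psi> (monomial \<mu> a \<nu>) = of_real (exp (- (k * \<beta>))) * \<psi> (monomial \<mu> a \<nu>)"
      using twisted_if_kms[OF kms w, of a] unfolding twisted_def k_def by (metis mult_1 mult_1_right)
    ultimately have "\<psi> (monomial \<mu> a \<nu>) = 0"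
      by (metis mult_cancel_right1 of_real_eq_1_iff)
    then show ?thesis
      using False by auto
  next
    case True
    have "\<psi> (monomial \<mu> a \<nu>) = \<psi> (monomial \<mu> 1 [] * (\<iota> a * star (word_prod V \<nu>)))"
      by (simp add: monomial_def \<iota>_simps mult.assoc)
    also have "\<dots> = of_real (exp (- (real (length \<mu>) * \<beta>))) *
        \<psi> (\<iota> a * star (word_prod V \<nu>) * monomial \<mu> 1 [])"
      using twisted_if_kms[OF kms w(1), of "[]" 1] by (simp add: twisted_def)
    also have "\<iota> a * star (word_prod V \<nu>) * monomial \<mu> 1 [] = (if \<mu> = \<nu> then \<iota> a else 0)"
      using word_orthonormal[OF w True] by (simp add: monomial_def \<iota>_simps mult.assoc)
    finally show ?thesis
      using kms_value_add_length[OF \<tau>, of 0 "length \<mu>" a]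
      by (cases "\<mu> = \<nu>")
         (simp_all add: value_0 positive_functional_zero[OF states_positive[OF \<psi>]])
  qed
  then show ?thesis
    by (simp add: has_kms_values_def monomial_def)
qed

text \<open>Summing the series for \<alpha>_i(a) over i and multiplying by q yields the series for a
  without its first term. The difference is that term, \<epsilon> * \<tau> a.\<close>

lemma trace_of_eq:
  assumes \<tau>: "\<tau> \<in> states" and val: "has_kms_values d \<alpha> \<iota> V \<beta> \<tau> \<psi>"
  shows "trace_of \<psi> = \<tau>"
proof
  fix a
  define q where "q = exp (- \<beta>)"
  have q_power: "exp (- (real (m + 0) * \<beta>)) = q ^ m" for m
    by (simp add: q_def flip: exp_of_nat_mult)
  define S where "S m = (\<Sum>w\<in>words_of_length d m. \<tau> (word_endo \<alpha> (rev w) a))" for m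
  have \<psi>_\<iota>: "\<psi> (\<iota> b) = kms_value d \<alpha> \<beta> \<tau> 0 b" for b
    using has_kms_values_monomial[OF val, of "[]" "[]" b] by (simp add: monomial_\<iota>)
  have sm: "summable (\<lambda>m. of_real (q ^ m) * S m)"
    using summable_kms_value[OF \<tau>, of 0 a] unfolding q_power S_def .
  have "of_real q * (\<Sum>i<d. \<psi> (\<iota> (\<alpha> i a))) = of_real \<epsilon> * (\<Sum>m. of_real (q ^ Suc m) * S (Suc m))"
  proof -
    have "(\<Sum>i<d. \<psi> (\<iota> (\<alpha> i a))) = of_real \<epsilon> * (\<Sum>i<d. \<Sum>m. of_real (q ^ m) *
        (\<Sum>w\<in>words_of_length d m. \<tau> (word_endo \<alpha> (rev w) (\<alpha> i a))))"
      by (simp only: \<psi>_\<iota> kms_value_def q_power \<epsilon>_def sum_distrib_left)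
    also have "(\<Sum>i<d. \<Sum>m. of_real (q ^ m) *
        (\<Sum>w\<in>words_of_length d m. \<tau> (word_endo \<alpha> (rev w) (\<alpha> i a)))) =
        (\<Sum>m. \<Sum>i<d. of_real (q ^ m) *
          (\<Sum>w\<in>words_of_length d m. \<tau> (word_endo \<alpha> (rev w) (\<alpha> i a))))"
      by (rule suminf_sum[symmetric]) (use summable_kms_value[OF \<tau>, of 0] in \<open>simp only: q_power\<close>)
    also have "(\<lambda>m. \<Sum>i<d. of_real (q ^ m) *
        (\<Sum>w\<in>words_of_length d m. \<tau> (word_endo \<alpha> (rev w) (\<alpha> i a)))) =
        (\<lambda>m. of_real (q ^ m) * S (Suc m))"
      unfolding S_def sum_words_Cons sum_distrib_left[symmetric]
      by (subst sum.swap) (simp add: word_endo_append)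
    also have "of_real q * (of_real \<epsilon> * (\<Sum>m. of_real (q ^ m) * S (Suc m))) =
        of_real \<epsilon> * (of_real q * (\<Sum>m. of_real (q ^ m) * S (Suc m)))"
      by (rule mult.left_commute)
    also have "of_real q * (\<Sum>m. of_real (q ^ m) * S (Suc m)) =
        (\<Sum>m. of_real q * (of_real (q ^ m) * S (Suc m)))"
    proof (cases "q = 0")
      case False
      have "summable (\<lambda>m. of_real (inverse q) * (of_real (q ^ Suc m) * S (Suc m)))"
        using sm by (intro summable_mult) (simp only: summable_Suc_iff[of "\<lambda>m. complex_of_real (q ^ m) * S m"])
      then have "summable (\<lambda>m. of_real (q ^ m) * S (Suc m))"
        using False by (simp flip: mult.assoc)
      then show ?thesis
        by (rule suminf_mult[symmetric])
    qed simp
    finally show ?thesis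
      by (simp add: mult.assoc)
  qed
  moreover have "\<psi> (\<iota> a) = of_real \<epsilon> * (\<Sum>m. of_real (q ^ m) * S m)"
    by (simp only: \<psi>_\<iota> kms_value_def q_power \<epsilon>_def S_def)
  moreover have "(\<Sum>m. of_real (q ^ Suc m) * S (Suc m)) =
      (\<Sum>m. of_real (q ^ m) * S m) - of_real (q ^ 0) * S 0"
    by (rule suminf_split_head[OF sm])
  moreover have "words_of_length d 0 = {[]}"
    by auto
  then have "S 0 = \<tau> a"
    by (simp add: S_def)
  ultimately have "\<psi> (\<iota> a) - of_real q * (\<Sum>i<d. \<psi> (\<iota> (\<alpha> i a))) = of_real \<epsilon> * \<tau> a"
    by (simp add: right_diff_distrib)
  then show "trace_of \<psi> a = \<tau> a"
    using \<epsilon>_pos by (simp add: trace_of_def q_def)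
qed

text \<open>The choice is harmless, as the values determine the state
  (\<open>states_eq_if_kms_values\<close>). The map makes sense on all states, and its continuity is
  proved there; it lands in the KMS states when \<tau> is a trace.\<close>

definition kms_state_of :: "('a \<Rightarrow> complex) \<Rightarrow> 'b \<Rightarrow> complex" where
  "kms_state_of \<tau> = (SOME \<psi>. \<psi> \<in> states \<and> has_kms_values d \<alpha> \<iota> V \<beta> \<tau> \<psi>)"

lemma
  assumes "\<tau> \<in> states"
  shows kms_state_of_in_states: "kms_state_of \<tau> \<in> states"
    and kms_state_of_values: "has_kms_values d \<alpha> \<iota> V \<beta> \<tau> (kms_state_of \<tau>)"
proof -
  have "\<exists>\<psi>. \<psi> \<in> states \<and> has_kms_values d \<alpha> \<iota> V \<beta> \<tau> \<psi>"
    using exists_state_with_kms_values[OF sys tp \<beta> assms] by blast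
  from someI_ex[OF this]
  show "kms_state_of \<tau> \<in> states" "has_kms_values d \<alpha> \<iota> V \<beta> \<tau> (kms_state_of \<tau>)"
    by (auto simp: kms_state_of_def)
qed

lemma states_eq_if_kms_values:
  assumes "\<phi> \<in> states" "\<psi> \<in> states"
    and "has_kms_values d \<alpha> \<iota> V \<beta> \<tau> \<phi>" "has_kms_values d \<alpha> \<iota> V \<beta> \<tau> \<psi>"
  shows "\<phi> = \<psi>"
proof
  show "\<phi> x = \<psi> x" for x
    by (rule bounded_linear_eq_on_monomials)
       (use assms in \<open>simp_all add: bounded_linear_states has_kms_values_monomial\<close>)
qed

lemma tracial_states_subset: "\<tau> \<in> tracial_states \<Longrightarrow> \<tau> \<in> states"
  by (simp add: tracial_states_def)

lemma kms_state_of_in_kms_states: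
  assumes "\<tau> \<in> tracial_states"
  shows "kms_state_of \<tau> \<in> kms_states \<sigma> \<beta>"
  using tracial_states_subset[OF assms]
  by (intro kms_if_twisted twisted_of_kms_values[OF _ assms])
     (simp_all add: kms_state_of_in_states kms_state_of_values)

lemma trace_of_kms_state_of: "\<tau> \<in> tracial_states \<Longrightarrow> trace_of (kms_state_of \<tau>) = \<tau>"
  by (intro trace_of_eq kms_state_of_values tracial_states_subset)

lemma kms_state_of_trace_of: "\<psi> \<in> kms_states \<sigma> \<beta> \<Longrightarrow> kms_state_of (trace_of \<psi>) = \<psi>"
  by (intro states_eq_if_kms_values[of _ _ "trace_of \<psi>"] kms_state_of_in_states kms_state_of_values
      kms_states_subset kms_has_kms_values tracial_states_subset trace_of_in_tracial_states)

section \<open>Affinity and weak* continuity\<close>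

lemma affine_kms_state_of: "affine_map_on tracial_states kms_state_of"
  unfolding affine_map_on_def
proof (intro ballI)
  fix \<phi> \<phi>' :: "'a \<Rightarrow> complex" and s :: real
  assume "\<phi> \<in> tracial_states" "\<phi>' \<in> tracial_states" and s: "s \<in> {0..1}"
  then have \<phi>: "\<phi> \<in> states" "\<phi>' \<in> states"
    by (auto intro: tracial_states_subset)
  define \<tau> where "\<tau> = (\<lambda>a. of_real (1 - s) * \<phi> a + of_real s * \<phi>' a)"
  define \<psi> where "\<psi> = (\<lambda>x. of_real (1 - s) * kms_state_of \<phi> x + of_real s * kms_state_of \<phi>' x)"
  have \<tau>: "\<tau> \<in> states"
    unfolding \<tau>_def using \<phi> s by (rule convex_combination_in_states)
  have \<psi>: "\<psi> \<in> states"
    unfolding \<psi>_def using \<phi> s by (intro convex_combination_in_states kms_state_of_in_states)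
  \<comment> \<open>The values determine a state, so it is enough that they are affine in the
    trace.\<close>
  have "kms_value d \<alpha> \<beta> \<tau> n a =
      of_real (1 - s) * kms_value d \<alpha> \<beta> \<phi> n a + of_real s * kms_value d \<alpha> \<beta> \<phi>' n a" for n a
  proof -
    let ?f = "\<lambda>\<tau> m. of_real (exp (- (real (m + n) * \<beta>))) *
        (\<Sum>w\<in>words_of_length d m. \<tau> (word_endo \<alpha> (rev w) a)) :: complex"
    have "?f \<tau> = (\<lambda>m. of_real (1 - s) * ?f \<phi> m + of_real s * ?f \<phi>' m)"
      by (rule ext)
        (simp add: \<tau>_def sum.distrib sum_distrib_left[symmetric] distrib_left mult.left_commute
          del: of_real_diff)
    moreover have "suminf (\<lambda>m. of_real (1 - s) * ?f \<phi> m + of_real s * ?f \<phi>' m) =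
        of_real (1 - s) * suminf (?f \<phi>) + of_real s * suminf (?f \<phi>')"
      by (simp only: suminf_add[symmetric] suminf_mult summable_mult summable_kms_value[OF \<phi>(1)]
          summable_kms_value[OF \<phi>(2)])
    ultimately show ?thesis
      unfolding kms_value_def by (simp only: distrib_left mult.left_commute)
  qed
  then have "has_kms_values d \<alpha> \<iota> V \<beta> \<tau> \<psi>"
    using kms_state_of_values[OF \<phi>(1)] kms_state_of_values[OF \<phi>(2)]
    by (simp add: has_kms_values_def \<psi>_def)
  then have "kms_state_of \<tau> = \<psi>"
    using \<tau> \<psi> by (intro states_eq_if_kms_values[of _ _ \<tau>] kms_state_of_in_states kms_state_of_values)
  then show "kms_state_of (\<lambda>a. of_real (1 - s) * \<phi> a + of_real s * \<phi>' a) =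
      (\<lambda>x. of_real (1 - s) * kms_state_of \<phi> x + of_real s * kms_state_of \<phi>' x)"
    by (simp only: \<tau>_def \<psi>_def)
qed

lemma continuous_on_apply: "continuous_on S (\<lambda>\<phi> :: 'x \<Rightarrow> complex. \<phi> a)"
  by (rule continuous_on_subset[OF continuous_on_product_coordinates]) simp

text \<open>Every partial sum is a finite combination of evaluations, and the majorant (q d)^m *
  norm a is the same for all states, so the convergence is uniform.\<close>

lemma continuous_on_kms_value:
  "continuous_on (states :: ('a \<Rightarrow> complex) set) (\<lambda>\<tau>. kms_value d \<alpha> \<beta> \<tau> n a)"
proof -
  define q where "q = exp (- \<beta>)"
  have q: "0 \<le> q" "q * real d < 1"
    using exp_mult_less_1[OF d_ge_1 \<beta>] by (auto simp: q_def)
  let ?f = "\<lambda>m \<tau>. of_real (exp (- (real (m + n) * \<beta>))) *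
      (\<Sum>w\<in>words_of_length d m. \<tau> (word_endo \<alpha> (rev w) a)) :: complex"
  have "uniform_limit states (\<lambda>N \<tau>. \<Sum>m<N. ?f m \<tau>) (\<lambda>\<tau>. \<Sum>m. ?f m \<tau>) sequentially"
  proof (rule Weierstrass_m_test)
    show "summable (\<lambda>m. (q * real d) ^ m * norm a)"
      using q by (intro summable_mult2 summable_geometric) simp
    fix m and \<tau> :: "'a \<Rightarrow> complex"
    assume \<tau>: "\<tau> \<in> states"
    have "cmod (\<tau> (word_endo \<alpha> (rev w) a)) \<le> norm a" if "w \<in> words_of_length d m" for w
      using states_norm_le[OF states_comp_hom[OF \<tau> endo_hom[of w]], of a] that by simp
    then have S: "cmod (\<Sum>w\<in>words_of_length d m. \<tau> (word_endo \<alpha> (rev w) a)) \<le> real d ^ m * norm a"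
      using sum_norm_bound[of "words_of_length d m" "\<lambda>w. \<tau> (word_endo \<alpha> (rev w) a)" "norm a"]
      by (simp add: card_words_of_length)
    have "exp (- (real (m + n) * \<beta>)) \<le> exp (- (real m * \<beta>))"
      using \<beta>_pos by (simp add: distrib_right)
    also have "\<dots> = q ^ m"
      by (simp add: q_def flip: exp_of_nat_mult)
    finally have "cmod (?f m \<tau>) \<le> q ^ m * (real d ^ m * norm a)"
      unfolding norm_mult using S q by (intro mult_mono) auto
    then show "norm (?f m \<tau>) \<le> (q * real d) ^ m * norm a"
      by (simp add: power_mult_distrib mult.assoc)
  qed
  then have "continuous_on states (\<lambda>\<tau> :: 'a \<Rightarrow> complex. \<Sum>m. ?f m \<tau>)"
    by (rule uniform_limit_theorem[rotated])
       (auto intro!: always_eventually continuous_intros continuous_on_apply)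
  then show ?thesis
    unfolding kms_value_def by (intro continuous_intros)
qed

text \<open>On the span of the monomials a coordinate is a finite combination of
  \<open>kms_value\<close>. For general x approximate by u n in the span: the error is at most norm
  (u n - x) whatever the state, so the limit is uniform in \<tau>.\<close>

lemma continuous_on_kms_state_of: "continuous_on states kms_state_of"
proof (rule continuous_on_coordinatewise_then_product)
  fix x
  obtain u where u: "\<And>n. u n \<in> span monomials" "u \<longlonglongrightarrow> x"
    using closure_span_monomials closure_sequential[of x "span monomials"] by auto
  have span: "continuous_on states (\<lambda>\<tau>. kms_state_of \<tau> y)" if "y \<in> span monomials" for y
    using that
  proof (induction rule: span_induct_alt)
    case base
    have "kms_state_of \<tau> 0 = 0" if "\<tau> \<in> states" for \<tau>
      using that by (intro positive_functional_zero states_positive kms_state_of_in_states)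
    then show ?case
      by (simp cong: continuous_on_cong)
  next
    case (step c z y)
    then obtain \<mu> a \<nu> where z: "z = monomial \<mu> a \<nu>" and w: "\<mu> \<in> words d" "\<nu> \<in> words d"
      by (auto elim: monomialsE)
    have "kms_state_of \<tau> (c *\<^sub>R z + y) =
        of_real c * (if \<mu> = \<nu> then kms_value d \<alpha> \<beta> \<tau> (length \<mu>) a else 0) + kms_state_of \<tau> y"
      if "\<tau> \<in> states" for \<tau>
      using states_positive[OF kms_state_of_in_states[OF that]]
        has_kms_values_monomial[OF kms_state_of_values[OF that] w, of a]
      by (simp add: positive_functional_add positive_functional_scaleR z)
    moreover have "continuous_on states (\<lambda>\<tau>. of_real c *
        (if \<mu> = \<nu> then kms_value d \<alpha> \<beta> \<tau> (length \<mu>) a else 0) + kms_state_of \<tau> y)"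
      using step(2) continuous_on_kms_value by (cases "\<mu> = \<nu>") (auto intro!: continuous_intros)
    ultimately show ?case
      by (simp cong: continuous_on_cong)
  qed
  have "uniform_limit states (\<lambda>n \<tau>. kms_state_of \<tau> (u n)) (\<lambda>\<tau>. kms_state_of \<tau> x) sequentially"
  proof (rule uniform_limitI)
    fix e :: real
    assume "0 < e"
    then have "\<forall>\<^sub>F n in sequentially. dist (u n) x < e"
      using u(2) by (simp add: tendsto_iff)
    then show "\<forall>\<^sub>F n in sequentially. \<forall>\<tau>\<in>states. dist (kms_state_of \<tau> (u n)) (kms_state_of \<tau> x) < e"
    proof (rule eventually_mono, intro ballI)
      fix n and \<tau> :: "'a \<Rightarrow> complex"
      assume n: "dist (u n) x < e" and "\<tau> \<in> states"
      then have \<psi>: "kms_state_of \<tau> \<in> states"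
        by (simp add: kms_state_of_in_states)
      have "dist (kms_state_of \<tau> (u n)) (kms_state_of \<tau> x) = cmod (kms_state_of \<tau> (u n - x))"
        by (simp add: dist_norm positive_functional_diff[OF states_positive[OF \<psi>]])
      also have "\<dots> \<le> norm (u n - x)"
        by (rule states_norm_le[OF \<psi>])
      finally show "dist (kms_state_of \<tau> (u n)) (kms_state_of \<tau> x) < e"
        using n by (simp add: dist_norm)
    qed
  qed
  then show "continuous_on states (\<lambda>\<tau>. kms_state_of \<tau> x)"
    by (rule uniform_limit_theorem[rotated]) (simp_all add: span u(1))
qed

text \<open>A finite combination of evaluations at points of \<iota>(A), hence continuous for
  pointwise convergence on any set of functionals; it provides the continuous inverse of
  \<open>kms_state_of\<close>.\<close>

lemma continuous_on_trace_of: "continuous_on S trace_of"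
  unfolding trace_of_def[abs_def]
  by (rule continuous_on_coordinatewise_then_product)
     (use \<epsilon>_pos in \<open>auto intro!: continuous_intros continuous_on_apply\<close>)

lemma weak_star_eq_euclidean: "(weak_star :: ('x \<Rightarrow> complex) topology) = euclidean"
  by (simp add: weak_star_def euclidean_product_topology)

lemma homeomorphic_map_kms_state_of:
  "homeomorphic_map (subtopology weak_star tracial_states)
    (subtopology weak_star (kms_states \<sigma> \<beta>)) kms_state_of"
proof -
  have "continuous_on tracial_states kms_state_of"
    using continuous_on_kms_state_of by (rule continuous_on_subset) (auto simp: tracial_states_def)
  then have "homeomorphic_maps (top_of_set tracial_states) (top_of_set (kms_states \<sigma> \<beta>))
      kms_state_of trace_of"
    using continuous_on_trace_of
    by (auto simp: homeomorphic_maps_def kms_state_of_in_kms_states trace_of_in_tracial_states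
        trace_of_kms_state_of kms_state_of_trace_of)
  then show ?thesis
    unfolding weak_star_eq_euclidean by (rule homeomorphic_maps_imp_map)
qed

end

theorem theorem3p3:
  fixes d :: nat
    and \<alpha> :: "nat \<Rightarrow> 'a::unital_cstar_algebra \<Rightarrow> 'a"
    and \<iota> :: "'a \<Rightarrow> 'b::unital_cstar_algebra"
    and V :: "nat \<Rightarrow> 'b"
    and \<gamma> :: "complex \<Rightarrow> 'b \<Rightarrow> 'b"
    and \<sigma> :: "real \<Rightarrow> 'b \<Rightarrow> 'b"
    and \<beta> :: real
  assumes "cstar_dynamical_system d \<alpha>"
    and "toeplitz_pimsner TYPE('a universe) d \<alpha> \<iota> V"
    and "gauge_action d \<iota> V \<gamma>"
    and "\<And>t. \<sigma> t = \<gamma> (exp (\<i> * complex_of_real t))"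
    and "\<beta> > ln (real d)"
  shows "\<exists>\<Psi> :: ('a \<Rightarrow> complex) \<Rightarrow> ('b \<Rightarrow> complex).
    affine_map_on tracial_states \<Psi> \<and>
    homeomorphic_map (subtopology weak_star tracial_states)
      (subtopology weak_star (kms_states \<sigma> \<beta>)) \<Psi> \<and>
    (\<forall>\<tau>\<in>tracial_states. \<forall>a. \<forall>\<mu>\<in>words d. \<forall>\<nu>\<in>words d.
       \<Psi> \<tau> (word_prod V \<mu> * \<iota> a * star (word_prod V \<nu>)) =
         (if \<mu> = \<nu> then 1 else 0) * of_real (1 - exp (- \<beta>) * real d) *
         (\<Sum>m. of_real (exp (- (real (m + length \<mu>) * \<beta>))) *
            (\<Sum>w\<in>{w \<in> words d. length w = m}. \<tau> (word_endo \<alpha> (rev w) a))))"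
proof -
  interpret toeplitz_pimsner_system d \<alpha> \<iota> V \<gamma> \<sigma> \<beta>
    using assms by unfold_locales
  show ?thesis
  proof (intro exI conjI ballI allI)
    fix \<tau> :: "'a \<Rightarrow> complex" and a \<mu> \<nu>
    assume "\<tau> \<in> tracial_states" and w: "\<mu> \<in> words d" "\<nu> \<in> words d"
    then have "has_kms_values d \<alpha> \<iota> V \<beta> \<tau> (kms_state_of \<tau>)"
      by (intro kms_state_of_values tracial_states_subset)
    then show "kms_state_of \<tau> (word_prod V \<mu> * \<iota> a * star (word_prod V \<nu>)) =
        (if \<mu> = \<nu> then 1 else 0) * of_real (1 - exp (- \<beta>) * real d) *
        (\<Sum>m. of_real (exp (- (real (m + length \<mu>) * \<beta>))) *
          (\<Sum>w\<in>{w \<in> words d. length w = m}. \<tau> (word_endo \<alpha> (rev w) a)))"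
      using w by (auto simp: has_kms_values_def kms_value_def)
  qed (rule affine_kms_state_of homeomorphic_map_kms_state_of)+
qed

end
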